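(* There is a linear-time algorithm that, given an instance $(F,A,B)$ of Formula-Pair with a formula of size $s$ and lists of size $n$, computes two strings $x,y$ over an alphabet of size $\Theta(s)$, of length $O(n\cdot s\cdot 2^{O(\sqrt{\log s})})$, and an integer $\rho$, such that $\mathrm{LCS}(x,y)\ge\rho$ if and only if there are $a\in A,b\in B$ with $F(a,b)=\mathsf{true}$.
   Context: Formula-Pair: given a deMorgan formula $F(x_1,\dots,x_m,y_1,\dots,y_m)$ in which each variable appears exactly once (size $s=2m$), and $A,B\subseteq\{0,1\}^m$ of size $n$, decide whether some $a\in A,b\in B$ satisfy $F(a_1,\dots,a_m,b_1,\dots,b_m)=\mathsf{true}$. $\mathrm{LCS}(x,y)$ is the length of a longest common subsequence. *)

theory Defs
  imports Complex_Main "HOL-Library.Sublist" "HOL-Library.Landau_Symbols"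
begin

section \<open>Formula-Pair\<close>

text \<open>Indices of variables and of vector coordinates start at 0.\<close>

datatype var = XVar nat | YVar nat

text \<open>De Morgan formulas: fan-in two, negations at the leaves.\<close>

datatype formula =
    Pos var
  | Neg var
  | Conj formula formula
  | Disj formula formula

primrec feval :: "(var \<Rightarrow> bool) \<Rightarrow> formula \<Rightarrow> bool" where
  "feval \<alpha> (Pos v) = \<alpha> v"
| "feval \<alpha> (Neg v) = (\<not> \<alpha> v)"
| "feval \<alpha> (Conj F G) = (feval \<alpha> F \<and> feval \<alpha> G)"
| "feval \<alpha> (Disj F G) = (feval \<alpha> F \<or> feval \<alpha> G)"

text \<open>The variable occurrences, one for each leaf.\<close>

primrec leaf_vars :: "formula \<Rightarrow> var list" where
  "leaf_vars (Pos v) = [v]"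
| "leaf_vars (Neg v) = [v]"
| "leaf_vars (Conj F G) = leaf_vars F @ leaf_vars G"
| "leaf_vars (Disj F G) = leaf_vars F @ leaf_vars G"

definition formula_size :: "formula \<Rightarrow> nat" where
  "formula_size F = length (leaf_vars F)"

definition formula_pair_instance ::
    "nat \<Rightarrow> nat \<Rightarrow> formula \<Rightarrow> bool list list \<Rightarrow> bool list list \<Rightarrow> bool" where
  "formula_pair_instance m n F A B \<longleftrightarrow>
     distinct (leaf_vars F) \<and> set (leaf_vars F) = XVar ` {..<m} \<union> YVar ` {..<m} \<and>
     length A = n \<and> length B = n \<and>
     (\<forall>a\<in>set A. length a = m) \<and> (\<forall>b\<in>set B. length b = m)"

primrec pair_assignment :: "bool list \<Rightarrow> bool list \<Rightarrow> var \<Rightarrow> bool" where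
  "pair_assignment a b (XVar i) = a ! i"
| "pair_assignment a b (YVar i) = b ! i"


section \<open>Longest common subsequences\<close>

definition LCS :: "'a list \<Rightarrow> 'a list \<Rightarrow> nat" where
  "LCS x y = Max {length z | z. subseq z x \<and> subseq z y}"


section \<open>A word RAM\<close>

text \<open>
  Programs are finite pieces of structured code over registers and one random-access
  memory; the state is the pair of register contents and memory contents.
  Every operation, comparison and memory access costs one time unit. Subtraction is
  truncated at 0, and division by 0 yields 0.
\<close>

type_synonym state = "(nat \<Rightarrow> nat) \<times> (nat \<Rightarrow> nat)"

datatype operand = Imm nat | Reg nat

datatype binop = Add | Sub | Mul | Div | Mod

datatype test = Eq operand operand | Less operand operand

datatype com =
    Skip
  | Move nat operand
  | Bin nat binop operand operand
  | Load nat operand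
  | Store operand operand
  | Seq com com
  | IfThenElse test com com
  | WhileDo test com

primrec opval :: "state \<Rightarrow> operand \<Rightarrow> nat" where
  "opval \<sigma> (Imm v) = v"
| "opval \<sigma> (Reg r) = fst \<sigma> r"

primrec binval :: "binop \<Rightarrow> nat \<Rightarrow> nat \<Rightarrow> nat" where
  "binval Add u v = u + v"
| "binval Sub u v = u - v"
| "binval Mul u v = u * v"
| "binval Div u v = u div v"
| "binval Mod u v = u mod v"

primrec testval :: "state \<Rightarrow> test \<Rightarrow> bool" where
  "testval \<sigma> (Eq a b) = (opval \<sigma> a = opval \<sigma> b)"
| "testval \<sigma> (Less a b) = (opval \<sigma> a < opval \<sigma> b)"

definition set_reg :: "nat \<Rightarrow> nat \<Rightarrow> state \<Rightarrow> state" where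
  "set_reg r v \<sigma> = ((fst \<sigma>)(r := v), snd \<sigma>)"

definition set_mem :: "nat \<Rightarrow> nat \<Rightarrow> state \<Rightarrow> state" where
  "set_mem p v \<sigma> = (fst \<sigma>, (snd \<sigma>)(p := v))"

text \<open>
  \<open>exec W c \<sigma> t \<tau>\<close>: started in \<open>\<sigma>\<close>, the program \<open>c\<close> halts in \<open>\<tau>\<close> after \<open>t\<close> time units,
  where machine words range over the numbers below \<open>W\<close>. A run that would produce
  a larger number, or use one as an address, gets stuck and so has no derivation.
\<close>

inductive exec :: "nat \<Rightarrow> com \<Rightarrow> state \<Rightarrow> nat \<Rightarrow> state \<Rightarrow> bool" for W :: nat where
  Skip: "exec W Skip \<sigma> 1 \<sigma>"
| Move: "v = opval \<sigma> a \<Longrightarrow> v < W \<Longrightarrow> exec W (Move r a) \<sigma> 1 (set_reg r v \<sigma>)"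
| Bin: "v = binval f (opval \<sigma> a) (opval \<sigma> b) \<Longrightarrow> v < W \<Longrightarrow>
    exec W (Bin r f a b) \<sigma> 1 (set_reg r v \<sigma>)"
| Load: "p = opval \<sigma> a \<Longrightarrow> p < W \<Longrightarrow> v = snd \<sigma> p \<Longrightarrow> v < W \<Longrightarrow>
    exec W (Load r a) \<sigma> 1 (set_reg r v \<sigma>)"
| Store: "p = opval \<sigma> a \<Longrightarrow> p < W \<Longrightarrow> v = opval \<sigma> b \<Longrightarrow> v < W \<Longrightarrow>
    exec W (Store a b) \<sigma> 1 (set_mem p v \<sigma>)"
| Seq: "exec W c \<sigma> t \<sigma>' \<Longrightarrow> exec W d \<sigma>' u \<tau> \<Longrightarrow> exec W (Seq c d) \<sigma> (t + u) \<tau>"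
| IfTrue: "testval \<sigma> e \<Longrightarrow> exec W c \<sigma> t \<tau> \<Longrightarrow> exec W (IfThenElse e c d) \<sigma> (1 + t) \<tau>"
| IfFalse: "\<not> testval \<sigma> e \<Longrightarrow> exec W d \<sigma> t \<tau> \<Longrightarrow> exec W (IfThenElse e c d) \<sigma> (1 + t) \<tau>"
| WhileFalse: "\<not> testval \<sigma> e \<Longrightarrow> exec W (WhileDo e c) \<sigma> 1 \<sigma>"
| WhileTrue: "testval \<sigma> e \<Longrightarrow> exec W c \<sigma> t \<sigma>' \<Longrightarrow> exec W (WhileDo e c) \<sigma>' u \<tau> \<Longrightarrow>
    exec W (WhileDo e c) \<sigma> (1 + t + u) \<tau>"

inductive_cases exec_elims:
  "exec W Skip \<sigma> t \<tau>"
  "exec W (Move r a) \<sigma> t \<tau>"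
  "exec W (Bin r f a b) \<sigma> t \<tau>"
  "exec W (Load r a) \<sigma> t \<tau>"
  "exec W (Store a b) \<sigma> t \<tau>"
  "exec W (Seq c d) \<sigma> t \<tau>"
  "exec W (IfThenElse e c d) \<sigma> t \<tau>"
inductive_cases exec_WhileE: "exec W (WhileDo e c) \<sigma> t \<tau>"

lemma exec_deterministic:
  "exec W c \<sigma> t \<tau> \<Longrightarrow> exec W c \<sigma> t' \<tau>' \<Longrightarrow> t' = t \<and> \<tau>' = \<tau>"
proof (induction arbitrary: t' \<tau>' rule: exec.induct)
  case (Seq c \<sigma> t \<sigma>' d u \<tau>)
  from Seq.prems show ?case
  proof (rule exec_elims(6))
    fix t1 \<sigma>1 u1
    assume t': "t' = t1 + u1" and c: "exec W c \<sigma> t1 \<sigma>1" and d: "exec W d \<sigma>1 u1 \<tau>'"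
    from Seq.IH(1)[OF c] d have "exec W d \<sigma>' u1 \<tau>'" by simp
    from Seq.IH(2)[OF this] Seq.IH(1)[OF c] t' show ?thesis by simp
  qed
next
  case (IfTrue \<sigma> e c t \<tau> d)
  from IfTrue.prems show ?case
    by (rule exec_elims(7)) (use IfTrue.hyps in \<open>auto dest: IfTrue.IH\<close>)
next
  case (IfFalse \<sigma> e d t \<tau> c)
  from IfFalse.prems show ?case
    by (rule exec_elims(7)) (use IfFalse.hyps in \<open>auto dest: IfFalse.IH\<close>)
next
  case (WhileFalse \<sigma> e c)
  from WhileFalse.prems show ?case
    by (rule exec_WhileE) (use WhileFalse.hyps in auto)
next
  case (WhileTrue \<sigma> e c t \<sigma>' u \<tau>)
  from WhileTrue.prems show ?case
  proof (rule exec_WhileE)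
    fix t1 \<sigma>1 u1
    assume t': "t' = Suc (t1 + u1)" and c: "exec W c \<sigma> t1 \<sigma>1"
      and d: "exec W (WhileDo e c) \<sigma>1 u1 \<tau>'"
    from WhileTrue.IH(1)[OF c] d have "exec W (WhileDo e c) \<sigma>' u1 \<tau>'" by simp
    from WhileTrue.IH(2)[OF this] WhileTrue.IH(1)[OF c] t' show ?thesis by simp
  qed (use WhileTrue.hyps in auto)
qed (erule exec_elims, simp)+


section \<open>Input and output conventions\<close>

text \<open>
  Formulas are written in prefix notation. Relative to \<open>m\<close>, the variables
  \<open>XVar i\<close> and \<open>YVar i\<close> have the numbers \<open>i\<close> and \<open>m + i\<close>.
\<close>

primrec var_number :: "nat \<Rightarrow> var \<Rightarrow> nat" where
  "var_number m (XVar i) = i"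
| "var_number m (YVar i) = m + i"

primrec encode_formula :: "nat \<Rightarrow> formula \<Rightarrow> nat list" where
  "encode_formula m (Pos v) = [2 + 2 * var_number m v]"
| "encode_formula m (Neg v) = [3 + 2 * var_number m v]"
| "encode_formula m (Conj F G) = 0 # encode_formula m F @ encode_formula m G"
| "encode_formula m (Disj F G) = 1 # encode_formula m F @ encode_formula m G"

definition encode_instance ::
    "nat \<Rightarrow> nat \<Rightarrow> formula \<Rightarrow> bool list list \<Rightarrow> bool list list \<Rightarrow> nat list" where
  "encode_instance m n F A B =
     [m, n] @ encode_formula m F @ map of_bool (concat A) @ map of_bool (concat B)"

text \<open>The input occupies the memory cells from address 0 on; everything else is 0.\<close>

definition initial_state :: "nat list \<Rightarrow> state" where
  "initial_state inp = ((\<lambda>r. 0), (\<lambda>p. if p < length inp then inp ! p else 0))"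

definition read_block :: "state \<Rightarrow> nat \<Rightarrow> nat \<Rightarrow> nat list" where
  "read_block \<sigma> p l = map (snd \<sigma>) [p..<p + l]"

text \<open>
  Register 0 holds the number in the output; registers 1 and 2 hold the start address and
  the length of the first string, registers 3 and 4 those of the second.
\<close>

definition ram_output :: "state \<Rightarrow> nat list \<times> nat list \<times> nat" where
  "ram_output \<sigma> = (read_block \<sigma> (fst \<sigma> 1) (fst \<sigma> 2), read_block \<sigma> (fst \<sigma> 3) (fst \<sigma> 4), fst \<sigma> 0)"

text \<open>
  \<open>k\<close> fixes the word length: words are numbers below \<open>N ^ k\<close> for inputs of \<open>N\<close> words,
  that is, they have \<open>k * log N\<close> bits.
\<close>

definition computes_within ::
    "nat \<Rightarrow> com \<Rightarrow> nat list \<Rightarrow> nat \<Rightarrow> nat list \<times> nat list \<times> nat \<Rightarrow> bool" where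
  "computes_within k c inp t out \<longleftrightarrow>
     (\<exists>\<tau>. exec (length inp ^ k) c (initial_state inp) t \<tau> \<and> ram_output \<tau> = out)"

end

theory Submission
  imports Defs
begin

text \<open>
  For a subformula with \<open>r\<close> conjunctions and a pad symbol \<open>d\<close> (its dollar) we build strings \<open>X\<close>
  (from the first vector) and \<open>Y\<close> (from the second) such that \<open>Y\<close> contains \<open>d\<close> exactly \<open>r\<close> times and
  the longest common subsequence of \<open>X d^K\<close> (for any \<open>K \<ge> r\<close>) and \<open>Y\<close> has length \<open>r + 1\<close> if the
  subformula is true and \<open>r\<close> otherwise. Let \<open>L\<close> be the smaller and \<open>H\<close> the larger
  child of a gate. \<open>H\<close> inherits the dollar \<open>d\<close> of the gate, \<open>L\<close> gets a fresh one, \<open>e\<close>, and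
  \<open>p\<close> is another fresh symbol:
  \<^item> conjunction: \<open>X_L e^r_L X_H\<close> against \<open>d^(r_L + 1) Y_L Y_H\<close>;
  \<^item> disjunction: \<open>p^r_L X_H X_L e^r_L\<close> against \<open>d^r_L Y_L p^r_L Y_H\<close>.

  Along a chain of larger children all pads share one dollar, so that a gate costs only
  \<open>O(|L|)\<close> additional symbols and the total is \<open>O(s log s)\<close>, without any rebalancing of the formula.
  Since every pair of gadgets has a common subsequence of length \<open>M\<close> and only satisfying pairs
  have one of length \<open>M + 1\<close> (for \<open>M\<close> the number of conjunctions of the whole formula), it remains to
  align the gadgets of \<open>A\<close>, written twice in a row, with those of \<open>B\<close>: with separators \<open>0^M\<close>
  between them and \<open>0^(nM)\<close> around the second string, every match beyond a shifted alignment loses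
  as many zeros as it can gain.

  Both strings can be emitted by a traversal of the formula with an explicit stack of
  pending tasks, taking constant time for each emitted symbol.
\<close>

section \<open>Common subsequences of separated blocks\<close>

lemma set_subseq: "subseq z x \<Longrightarrow> set z \<subseteq> set x"
  by (induction rule: list_emb.induct) auto

lemma subseq_avoid_append:
  assumes "subseq z (u @ v)" "set z \<inter> set u = {}"
  shows "subseq z v"
proof -
  from assms(1) obtain z1 z2 where z: "z = z1 @ z2" "subseq z1 u" "subseq z2 v"
    by (auto simp: subseq_append_iff)
  with assms(2) set_subseq[of z1 u] have "z1 = []" by (cases z1) auto
  with z show ?thesis by simp
qed

lemma subseq_append_avoid:
  assumes "subseq z (u @ v)" "set z \<inter> set v = {}"
  shows "subseq z u"
proof -
  from assms(1) obtain z1 z2 where z: "z = z1 @ z2" "subseq z1 u" "subseq z2 v"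
    by (auto simp: subseq_append_iff)
  with assms(2) set_subseq[of z2 v] have "z2 = []" by (cases z2) auto
  with z show ?thesis by simp
qed

lemma count_list_subseq: "subseq z x \<Longrightarrow> count_list z c \<le> count_list x c"
  by (induction rule: list_emb.induct) auto

lemma count_list_replicate [simp]: "count_list (replicate k d) c = (if c = d then k else 0)"
  by (induction k) auto

lemma subseq_replicate_count: "subseq (replicate (count_list x d) d) x"
  by (induction x) auto

lemma subseq_replicate_le: "k \<le> l \<Longrightarrow> subseq (replicate k d) (replicate l d)"
  using subseq_replicate_count[of "replicate l d" d]
  by (metis le_add_diff_inverse replicate_add subseq_drop_many subseq_order.order_refl add.commute)

lemma length_eq_count_list: "set z \<subseteq> {d} \<Longrightarrow> length z = count_list z d"
  by (induction z) auto

lemma length_subseq_const: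
  assumes "subseq z x" "set z \<subseteq> {d}"
  shows "length z \<le> count_list x d"
  using count_list_subseq[OF assms(1), of d] length_eq_count_list[OF assms(2)] by simp

lemma length_filter_split: "length z = length (filter P z) + length (filter (\<lambda>c. \<not> P c) z)"
  by (induction z) auto

text \<open>The lengths of common subsequences form a nonempty set bounded by
  \<open>length x\<close>, so the maximum is attained and lower bounds on it become statements about
  a single witness.\<close>

lemma LCS_ge_iff: "r \<le> LCS x y \<longleftrightarrow> (\<exists>z. subseq z x \<and> subseq z y \<and> r \<le> length z)"
proof -
  let ?S = "{length z | z. subseq z x \<and> subseq z y}"
  have "?S \<subseteq> {..length x}" by (auto dest: list_emb_length)
  hence fin: "finite ?S" by (rule finite_subset) simp
  moreover have "?S \<noteq> {}" using list_emb_Nil by blast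
  ultimately show ?thesis unfolding LCS_def by (subst Max_ge_iff) auto
qed

lemma append_eq_append_cases:
  assumes "a @ b = c @ d"
  obtains (left) w where "c = a @ w" "b = w @ d" | (right) w where "a = c @ w" "w @ b = d"
  using assms by (auto simp: append_eq_append_conv2)

section \<open>Strings of blocks separated by runs of one symbol\<close>

definition blocks :: "'a \<Rightarrow> nat \<Rightarrow> 'a list list \<Rightarrow> 'a list" where
  "blocks s M Xs = concat (map (\<lambda>X. X @ replicate M s) Xs)"

lemma blocks_simps [simp]:
  "blocks s M [] = []"
  "blocks s M (X # Xs) = X @ replicate M s @ blocks s M Xs"
  "blocks s M (Xs @ Ys) = blocks s M Xs @ blocks s M Ys"
  by (simp_all add: blocks_def)

text \<open>Each block passed completely contributes at most \<open>M\<close> to a match with the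
  separator-free \<open>Y\<close>, and the separator run behind it puts \<open>M\<close> copies of
  \<open>s\<close> into \<open>t\<close>, which pay for that contribution. Only the last block
  touched stays unpaid, whence the summand \<open>M\<close>.\<close>

lemma prefix_blocks_bound:
  assumes "\<And>X z. X \<in> set Xs \<Longrightarrow> subseq z X \<Longrightarrow> subseq z Y \<Longrightarrow> length z \<le> M"
    and "s \<notin> set Y" "t @ v = blocks s M Xs" "subseq z t" "subseq z Y"
  shows "length z \<le> M + count_list t s"
  using assms
proof (induction Xs arbitrary: t z)
  case Nil
  then show ?case by (auto dest: list_emb_length)
next
  case (Cons X Xs)
  have z_s: "s \<notin> set z" using set_subseq Cons.prems by blast
  from Cons.prems(3) have "t @ v = X @ replicate M s @ blocks s M Xs" by simp
  then consider (in_X) w where "X = t @ w"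
    | (beyond) t' where "t = X @ t'" "t' @ v = replicate M s @ blocks s M Xs"
    by (rule append_eq_append_cases)
  then show ?case
  proof cases
    case in_X
    hence "subseq z X" using Cons.prems(4) by (simp add: subseq_rev_drop_many)
    thus ?thesis using Cons.prems(1)[of X z] Cons.prems(5) by simp
  next
    case beyond
    from beyond(2) consider (in_sep) w where "replicate M s = t' @ w"
      | (past) t'' where "t' = replicate M s @ t''" "t'' @ v = blocks s M Xs"
      by (rule append_eq_append_cases)
    then show ?thesis
    proof cases
      case in_sep
      have "set t' \<subseteq> {s}" using in_sep by (metis Un_iff set_append set_replicate_conv_if subsetI empty_iff)
      hence "set z \<inter> set t' = {}" using z_s by blast
      hence "subseq z X" using Cons.prems(4) beyond(1) subseq_append_avoid by blast
      thus ?thesis using Cons.prems(1)[of X z] Cons.prems(5) by simp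
    next
      case past
      from Cons.prems(4) beyond(1) obtain z1 z2 where z: "z = z1 @ z2" "subseq z1 X" "subseq z2 t'"
        by (auto simp: subseq_append_iff)
      have sub: "subseq z1 Y" "subseq z2 Y"
        using Cons.prems(5) z(1) subseq_order.order_trans subseq_drop_many subseq_rev_drop_many by blast+
      have "set z2 \<inter> set (replicate M s) = {}" using z_s z(1) by auto
      hence "subseq z2 t''" using z(3) past(1) subseq_avoid_append by blast
      hence "length z2 \<le> M + count_list t'' s"
        by (intro Cons.IH[OF _ Cons.prems(2) past(2) _ sub(2)]) (use Cons.prems(1) in auto)
      moreover have "length z1 \<le> M" using Cons.prems(1)[of X z1] z(2) sub(1) by simp
      ultimately show ?thesis using z(1) beyond(1) past(1) by simp
    qed
  qed
qed

text \<open>The induction drops the blocks that lie before the factor \<open>t\<close>. If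
  \<open>t\<close> starts inside a block, the rest of this block counts as a first block of its own;
  if it starts inside a separator run, the leading separators are stripped. Both reduce the claim to
  the prefix case.\<close>

lemma factor_blocks_bound:
  assumes "\<And>X z. X \<in> set Xs \<Longrightarrow> subseq z X \<Longrightarrow> subseq z Y \<Longrightarrow> length z \<le> M"
    and "s \<notin> set Y" "u @ t @ v = blocks s M Xs" "subseq z t" "subseq z Y"
  shows "length z \<le> M + count_list t s"
  using assms
proof (induction Xs arbitrary: u)
  case Nil
  then show ?case by (auto dest: list_emb_length)
next
  case (Cons X Xs)
  have z_s: "s \<notin> set z" using set_subseq Cons.prems by blast
  from Cons.prems(3) have "u @ t @ v = X @ replicate M s @ blocks s M Xs" by simp
  then consider (in_X) w where "X = u @ w" "t @ v = w @ replicate M s @ blocks s M Xs"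
    | (beyond) u' where "u = X @ u'" "u' @ t @ v = replicate M s @ blocks s M Xs"
    by (rule append_eq_append_cases)
  then show ?case
  proof cases
    case in_X
    show ?thesis
    proof (rule prefix_blocks_bound[OF _ Cons.prems(2) _ Cons.prems(4,5)])
      show "t @ v = blocks s M (w # Xs)" using in_X by simp
      fix X' z' assume "X' \<in> set (w # Xs)" "subseq z' X'" "subseq z' Y"
      thus "length z' \<le> M" using Cons.prems(1)[of X z'] Cons.prems(1)[of X' z'] in_X(1)
        by (auto simp: subseq_drop_many)
    qed
  next
    case beyond
    from beyond(2) consider (in_sep) w where "replicate M s = u' @ w" "t @ v = w @ blocks s M Xs"
      | (past) u'' where "u'' @ t @ v = blocks s M Xs"
      by (rule append_eq_append_cases)
    then show ?thesis
    proof cases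
      case past
      show ?thesis
        by (intro Cons.IH[OF _ Cons.prems(2) past Cons.prems(4,5)]) (use Cons.prems(1) in auto)
    next
      case in_sep
      hence w: "set w \<subseteq> {s}" by (metis Un_iff set_append set_replicate_conv_if subsetI empty_iff)
      from in_sep(2) consider (a) w' where "w = t @ w'" | (b) t' where "t = w @ t'" "t' @ v = blocks s M Xs"
        by (rule append_eq_append_cases)
      then show ?thesis
      proof cases
        case a
        hence "set z \<subseteq> {s}" using set_subseq[OF Cons.prems(4)] w by auto
        hence "z = []" using z_s by (cases z) auto
        thus ?thesis by simp
      next
        case b
        have "subseq z t'" using subseq_avoid_append[of z w t'] Cons.prems(4) b(1) w z_s by blast
        hence "length z \<le> M + count_list t' s"
          by (intro prefix_blocks_bound[OF _ Cons.prems(2) b(2) _ Cons.prems(5)]) (use Cons.prems(1) in auto)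
        thus ?thesis using b(1) by simp
      qed
    qed
  qed
qed

text \<open>Splitting a match along the blocks of the second string cuts \<open>t\<close> into
  consecutive factors. Each block of \<open>Ys\<close> gains at most \<open>M\<close> beyond the
  copies of \<open>s\<close> in its factor, and matched separators are charged to the copies of
  \<open>s\<close> in theirs. The prefix \<open>u\<close> lets the induction continue with a later
  factor.\<close>

lemma blocks_common_bound:
  assumes "\<And>X Y z. X \<in> set Xs \<Longrightarrow> Y \<in> set Ys \<Longrightarrow> subseq z X \<Longrightarrow> subseq z Y \<Longrightarrow> length z \<le> M"
    and "\<And>Y. Y \<in> set Ys \<Longrightarrow> s \<notin> set Y"
    and "u @ t @ v = blocks s M Xs" "subseq z t"
    and "subseq z (blocks s M Ys @ replicate p s)"
  shows "length z \<le> length Ys * M + count_list t s"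
  using assms
proof (induction Ys arbitrary: u t z)
  case Nil
  hence "set z \<subseteq> {s}" using set_subseq[of z "replicate p s"] by (auto split: if_splits)
  thus ?case using length_subseq_const[OF Nil.prems(4)] by simp
next
  case (Cons Y Ys)
  from Cons.prems(5) obtain z1 z2 z3 where z: "z = z1 @ z2 @ z3" "subseq z1 Y"
    "subseq z2 (replicate M s)" "subseq z3 (blocks s M Ys @ replicate p s)"
    by (simp add: subseq_append_iff[of z] subseq_append_iff[of _ "replicate M s"]) metis
  from Cons.prems(4) z(1) obtain t1 t2 t3 where t: "t = t1 @ t2 @ t3" "subseq z1 t1" "subseq z2 t2" "subseq z3 t3"
    by (auto dest!: list_emb_appendD)
  have "length z1 \<le> M + count_list t1 s"
    by (rule factor_blocks_bound[of Xs Y M s u t1 "t2 @ t3 @ v"]) (use Cons.prems t z in auto)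
  moreover have "set z2 \<subseteq> {s}" using set_subseq[OF z(3)] by (auto split: if_splits)
  hence "length z2 \<le> count_list t2 s" using length_subseq_const[OF t(3)] by simp
  moreover have "length z3 \<le> length Ys * M + count_list t3 s"
    by (rule Cons.IH[of "u @ t1 @ t2"]) (use Cons.prems t z in auto)
  ultimately show ?case using z(1) t(1) by simp
qed

lemma concat_map_subseq:
  assumes "\<And>k. k \<in> set ks \<Longrightarrow> subseq (f k) (g k)"
  shows "subseq (concat (map f ks)) (concat (map g ks))"
  using assms by (induction ks) (auto intro: list_emb_append_mono)

lemma count_list_blocks:
  "(\<And>X. X \<in> set Xs \<Longrightarrow> s \<notin> set X) \<Longrightarrow> count_list (blocks s M Xs) s = length Xs * M"
  by (induction Xs) auto

text \<open>Without a good pair, every match is charged to the \<open>2 * n * M\<close> separators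
  of the first string, plus \<open>M\<close> for each of the \<open>n\<close> blocks of the second.
  With one, a cyclic shift places the good pair face to face; the blocks of the first string are
  repeated so that every shift fits.\<close>

theorem aligned_blocks_LCS:
  fixes X Y :: "nat \<Rightarrow> 'a list"
  assumes common: "\<And>i j. i < n \<Longrightarrow> j < n \<Longrightarrow> \<exists>z. subseq z (X i) \<and> subseq z (Y j) \<and> length z = M"
    and bound: "\<And>i j z. i < n \<Longrightarrow> j < n \<Longrightarrow> \<not> P i j \<Longrightarrow> subseq z (X i) \<Longrightarrow> subseq z (Y j) \<Longrightarrow> length z \<le> M"
    and good: "\<And>i j. i < n \<Longrightarrow> j < n \<Longrightarrow> P i j \<Longrightarrow> \<exists>z. subseq z (X i) \<and> subseq z (Y j) \<and> length z = Suc M"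
    and s: "\<And>i. i < n \<Longrightarrow> s \<notin> set (X i)" "\<And>i. i < n \<Longrightarrow> s \<notin> set (Y i)"
  shows "3 * (n * M) + 1 \<le> LCS (blocks s M (map (\<lambda>q. X (q mod n)) [0..<2 * n]))
      (replicate (n * M) s @ blocks s M (map Y [0..<n]) @ replicate (n * M) s)
    \<longleftrightarrow> (\<exists>i<n. \<exists>j<n. P i j)" (is "_ \<le> LCS ?x ?y \<longleftrightarrow> ?E")
proof
  assume "3 * (n * M) + 1 \<le> LCS ?x ?y"
  then obtain z where z: "subseq z ?x" "subseq z ?y" "3 * (n * M) + 1 \<le> length z"
    unfolding LCS_ge_iff by blast
  show ?E
  proof (rule ccontr)
    assume none: "\<not> ?E"
    \<comment> \<open>The leading run of \<open>?y\<close> is charged to a prefix of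
      \<open>?x\<close>, since the bound for the blocks allows for a trailing run only.\<close>
    from z(2) obtain z1 z2 where z12: "z = z1 @ z2" "subseq z1 (replicate (n * M) s)"
      "subseq z2 (blocks s M (map Y [0..<n]) @ replicate (n * M) s)"
      by (auto simp: subseq_append_iff)
    from z(1) z12(1) obtain t1 t2 where t: "?x = t1 @ t2" "subseq z1 t1" "subseq z2 t2"
      by (auto dest: list_emb_appendD)
    have "set z1 \<subseteq> {s}" using set_subseq[OF z12(2)] by (auto split: if_splits)
    hence "length z1 \<le> count_list t1 s" using length_subseq_const[OF t(2)] by simp
    moreover have "length z2 \<le> length (map Y [0..<n]) * M + count_list t2 s"
    proof (rule blocks_common_bound[OF _ _ _ t(3) z12(3)])
      show "t1 @ t2 @ [] = ?x" using t(1) by simp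
      fix U V z' assume UV: "U \<in> set (map (\<lambda>q. X (q mod n)) [0..<2 * n])" "V \<in> set (map Y [0..<n])"
        "subseq z' U" "subseq z' V"
      then obtain q j where q: "q < 2 * n" "U = X (q mod n)" "j < n" "V = Y j" by auto
      hence "q mod n < n" by simp
      thus "length z' \<le> M" using bound[of "q mod n" j z'] none UV q by blast
    qed (use s in auto)
    \<comment> \<open>The factors \<open>t1\<close> and \<open>t2\<close> share these separators,
      which leaves \<open>3 * n * M\<close> as the total.\<close>
    moreover have "count_list ?x s = 2 * n * M"
      using s(1) by (subst count_list_blocks) auto
    ultimately show False using z(3) z12(1) t(1) by simp
  qed
next
  assume ?E
  then obtain i j where ij: "i < n" "j < n" "P i j" by blast
  \<comment> \<open>The shift that makes block \<open>j\<close> of the second string face a copy of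
    block \<open>i\<close>; adding \<open>n\<close> first prevents truncation of the
    subtraction.\<close>
  define t where "t = (i + n - j) mod n"
  have t: "t < n" using ij by (simp add: t_def)
  have tj: "(t + j) mod n = i" using ij by (simp add: t_def mod_add_left_eq)
  have "\<exists>z. subseq z (X ((t + k) mod n)) \<and> subseq z (Y k) \<and> length z = M + of_bool (k = j)" if "k < n" for k
    using common[of "(t + k) mod n" k] good[of i j] ij tj that by (cases "k = j") auto
  then obtain w where w: "\<And>k. k < n \<Longrightarrow> subseq (w k) (X ((t + k) mod n)) \<and> subseq (w k) (Y k) \<and> length (w k) = M + of_bool (k = j)"
    by metis
  let ?w = "concat (map (\<lambda>k. w k @ replicate M s) [0..<n])"
  \<comment> \<open>The \<open>t\<close> blocks of \<open>?x\<close> before the aligned window and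
    the \<open>n - t\<close> blocks behind it contribute only their separators, matched with the
    outer runs of \<open>?y\<close>; together these are \<open>n * M\<close> symbols.\<close>
  let ?z = "replicate (t * M) s @ ?w @ replicate ((n - t) * M) s"
  have zeros: "subseq (replicate (length Xs * M) s) (blocks s M Xs)" for Xs :: "'a list list"
    by (induction Xs) (auto simp: replicate_add intro: list_emb_append_mono subseq_drop_many)
  have split: "[0..<2 * n] = [0..<t] @ map (\<lambda>k. t + k) [0..<n] @ [t + n..<2 * n]"
  proof -
    have "[0..<2 * n] = [0..<t] @ [t..<2 * n]" using t by (metis upt_add_eq_append le0 le_add_diff_inverse less_imp_le mult_2 trans_le_add1)
    moreover have "[t..<2 * n] = [t..<t + n] @ [t + n..<2 * n]"
      using t upt_add_eq_append[of t "t + n" "n - t"] by (simp add: mult_2)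
    moreover have "[t..<t + n] = map (\<lambda>k. t + k) [0..<n]" 
      using map_add_upt[of t n] by (simp add: add.commute)
    ultimately show ?thesis by simp
  qed
  have "subseq ?z ?x"
  proof -
    have "subseq ?w (blocks s M (map (\<lambda>k. X ((t + k) mod n)) [0..<n]))"
      unfolding blocks_def map_map comp_def
      by (rule concat_map_subseq) (use w in \<open>auto intro: list_emb_append_mono\<close>)
    moreover have "subseq (replicate (t * M) s) (blocks s M (map (\<lambda>q. X (q mod n)) [0..<t]))"
      using zeros[of "map (\<lambda>q. X (q mod n)) [0..<t]"] by simp
    moreover have "subseq (replicate ((n - t) * M) s) (blocks s M (map (\<lambda>q. X (q mod n)) [t + n..<2 * n]))"
      using zeros[of "map (\<lambda>q. X (q mod n)) [t + n..<2 * n]"] t by (simp add: mult_2)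
    ultimately show ?thesis unfolding split by (auto simp: comp_def intro!: list_emb_append_mono)
  qed
  moreover have "subseq ?z ?y"
  proof (intro list_emb_append_mono)
    show "subseq ?w (blocks s M (map Y [0..<n]))"
      unfolding blocks_def map_map comp_def
      by (rule concat_map_subseq) (use w in \<open>auto intro: list_emb_append_mono\<close>)
  qed (use t in \<open>auto intro!: subseq_replicate_le\<close>)
  moreover have "length ?z = 3 * (n * M) + 1"
  proof -
    have "length ?w = (\<Sum>k\<leftarrow>[0..<n]. length (w k) + M)"
      by (simp add: length_concat comp_def)
    also have "\<dots> = (\<Sum>k\<leftarrow>[0..<n]. 2 * M + of_bool (k = j))"
      by (intro arg_cong[of _ _ sum_list] map_cong) (use w in auto)
    also have "\<dots> = (\<Sum>k<n. 2 * M + of_bool (k = j))"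
      by (simp add: sum_list_distinct_conv_sum_set atLeast0LessThan)
    also have "\<dots> = 2 * (n * M) + 1"
      using ij(2) by (simp add: sum.distrib sum.delta of_bool_def)
    finally have w_len: "length ?w = 2 * (n * M) + 1" .
    have "t * M + (n - t) * M = n * M" using t by (simp flip: add_mult_distrib)
    thus ?thesis using w_len by simp
  qed
  ultimately show "3 * (n * M) + 1 \<le> LCS ?x ?y"
    unfolding LCS_ge_iff by (metis order_refl)
qed

section \<open>Gadgets\<close>

text \<open>\<open>S\<close> is the private alphabet, \<open>d\<close> the dollar and
  \<open>r\<close> the base length; 1 and 2 are the junk symbols of the two sides. The upper bound
  must hold for every \<open>K\<close>, as enclosing gates supply further dollars, whereas a witness
  may use only \<open>r\<close> of them. A match of length \<open>r\<close> is always available: the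
  \<open>r\<close> dollars of \<open>Y\<close>.\<close>

definition gadget :: "nat set \<Rightarrow> nat \<Rightarrow> nat \<Rightarrow> bool \<Rightarrow> nat list \<Rightarrow> nat list \<Rightarrow> bool" where
  "gadget S d r t X Y \<longleftrightarrow>
     d \<notin> S \<and> {1, 2} \<inter> insert d S = {} \<and> set X \<subseteq> insert 1 S \<and> set Y \<subseteq> insert 2 (insert d S) \<and>
     count_list Y d = r \<and>
     (\<forall>K z. subseq z (X @ replicate K d) \<longrightarrow> subseq z Y \<longrightarrow> length z \<le> r + of_bool t) \<and>
     (t \<longrightarrow> (\<exists>z. subseq z (X @ replicate r d) \<and> subseq z Y \<and> length z = Suc r))"

lemma gadgetD:
  assumes "gadget S d r t X Y"
  shows "d \<notin> S" "1 \<notin> S" "2 \<notin> S" "d \<noteq> 1" "d \<noteq> 2" "set X \<subseteq> insert 1 S" "set Y \<subseteq> insert 2 (insert d S)"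
    "count_list Y d = r"
  using assms by (auto simp: gadget_def)

lemma gadgetI:
  assumes "d \<notin> S" "1 \<notin> S" "2 \<notin> S" "d \<noteq> 1" "d \<noteq> 2" "set X \<subseteq> insert 1 S" "set Y \<subseteq> insert 2 (insert d S)"
    and "count_list Y d = r"
    and "\<And>K z. subseq z (X @ replicate K d) \<Longrightarrow> subseq z Y \<Longrightarrow> length z \<le> r + of_bool t"
    and "t \<Longrightarrow> \<exists>z. subseq z (X @ replicate r d) \<and> subseq z Y \<and> length z = Suc r"
  shows "gadget S d r t X Y"
  unfolding gadget_def using assms by (intro conjI allI impI) simp_all

lemma gadget_bound:
  assumes "gadget S d r t X Y" "subseq z (X @ replicate K d)" "subseq z Y"
  shows "length z \<le> r + of_bool t"
  using assms unfolding gadget_def by blast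

lemma gadget_witness:
  assumes "gadget S d r t X Y" t
  obtains z where "subseq z (X @ replicate r d)" "subseq z Y" "length z = Suc r"
  using assms unfolding gadget_def by blast

lemma gadget_mono:
  assumes "gadget S d r t X Y" "S \<subseteq> S'" "d \<notin> S'" "1 \<notin> S'" "2 \<notin> S'"
  shows "gadget S' d r t X Y"
  using assms unfolding gadget_def by auto

text \<open>A satisfied leaf shows its symbol on both sides. A falsified one shows junk on one side,
  which never occurs on the other, so that nothing can be matched.\<close>

lemma gadget_leaf:
  assumes "v \<noteq> d" "v \<noteq> 1" "v \<noteq> 2" "d \<noteq> 1" "d \<noteq> 2"
    and "X = v \<and> Y = v \<and> t \<or> X = 1 \<and> Y = v \<and> \<not> t \<or> X = v \<and> Y = 2 \<and> \<not> t"
  shows "gadget {v} d 0 t [X] [Y]"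
proof -
  have "length z \<le> of_bool t" if z: "subseq z (X # replicate K d)" "subseq z [Y]" for z K
  proof (cases "X = Y")
    case True
    with assms have t by auto
    with list_emb_length[OF z(2)] show ?thesis by simp
  next
    case False
    have "set z \<subseteq> {X, d} \<inter> {Y}" using set_subseq[OF z(1)] set_subseq[OF z(2)] by (auto split: if_splits)
    with False assms have "set z \<subseteq> {}" by blast
    thus ?thesis by simp
  qed
  moreover have "\<exists>z. subseq z [X] \<and> subseq z [Y] \<and> length z = Suc 0" if t
    by (rule exI[of _ "[X]"]) (use that assms in auto)
  moreover have "set [X] \<subseteq> insert 1 {v}" "set [Y] \<subseteq> insert 2 (insert d {v})" "count_list [Y] d = 0"
    using assms by auto
  ultimately show ?thesis using assms(1-5) by (intro gadgetI) auto
qed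

text \<open>A match that starts with a dollar of \<open>Y\<close> can use nothing but dollars.\<close>

lemma dollar_first:
  assumes "subseq z (X @ replicate K d)" "d \<notin> set X" "subseq z (replicate w d @ V)"
  obtains "subseq z V" | "set z \<subseteq> {d}"
proof -
  from assms(3) obtain z1 z2 where z: "z = z1 @ z2" "subseq z1 (replicate w d)" "subseq z2 V"
    by (auto simp: subseq_append_iff)
  show thesis
  proof (cases z1)
    case Nil
    with z that(1) show thesis by simp
  next
    case (Cons c z1')
    have "c = d" using set_subseq[OF z(2)] Cons by (auto split: if_splits)
    with Cons z(1) have zd: "z = d # z1' @ z2" by simp
    from assms(1) obtain u1 u2 where u: "z = u1 @ u2" "subseq u1 X" "subseq u2 (replicate K d)"
      by (auto simp: subseq_append_iff)
    have "u1 = []" using u(1,2) zd set_subseq[of u1 X] assms(2) by (cases u1) auto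
    hence "set z \<subseteq> {d}" using u set_subseq[OF u(3)] by (auto split: if_splits)
    with that(2) show thesis .
  qed
qed

text \<open>A match that uses a leading dollar consists of dollars only and cannot exceed their
  number in \<open>Y\<close>. Any other match splits by alphabet into a match of \<open>B\<close>
  and one of \<open>H\<close>, so it has length at most
  \<open>rB + rH + of_bool tB + of_bool tH\<close>. The one extra leading dollar raises the base
  length by one, which hides the gain of a single true child.\<close>

lemma gadget_conj:
  assumes B: "gadget SB dB rB tB XB YB" and H: "gadget SH d rH tH XH YH"
    and disj: "SB \<inter> SH = {}" "dB \<notin> SH" "d \<notin> SB" "dB \<noteq> d"
  shows "gadget (insert dB (SB \<union> SH)) d (Suc (rB + rH)) (tB \<and> tH)
    (XB @ replicate rB dB @ XH) (replicate (Suc rB) d @ YB @ YH)"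
  (is "gadget ?S d ?r ?t ?X ?Y")
proof -
  note b = gadgetD[OF B] and h = gadgetD[OF H]
  have cnt: "count_list ?Y d = ?r"
  proof -
    have "d \<notin> set YB" using b(7) disj(3,4) h(5) by auto
    thus ?thesis using h(8) by simp
  qed
  have "length z \<le> ?r + of_bool ?t" if z: "subseq z (?X @ replicate K d)" "subseq z ?Y" for z K
  proof -
    have "d \<notin> set ?X" using b h disj by (auto split: if_splits)
    then consider (body) "subseq z (YB @ YH)" | (const) "set z \<subseteq> {d}"
      using dollar_first[OF z(1) _ z(2)] by blast
    then show ?thesis
    proof cases
      case const
      thus ?thesis using length_subseq_const[OF z(2) const] cnt by simp
    next
      case body
      \<comment> \<open>Each junk symbol occurs on one side only and so cannot appear in a
        match.\<close>
      have zset: "set z \<subseteq> insert dB SB \<union> insert d SH"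
      proof
        fix c assume "c \<in> set z"
        hence "c \<in> set (?X @ replicate K d)" "c \<in> set ?Y" using set_subseq z by blast+
        thus "c \<in> insert dB SB \<union> insert d SH" using b h by auto
      qed
      let ?P = "\<lambda>c. c \<in> insert dB SB"
      let ?zB = "filter ?P z" and ?zH = "filter (\<lambda>c. \<not> ?P c) z"
      have zH_set: "set ?zH \<subseteq> insert d SH" using zset by auto
      have "subseq ?zB (XB @ replicate rB dB)"
      proof -
        have "subseq ?zB ((XB @ replicate rB dB) @ (XH @ replicate K d))"
          using subseq_order.order_trans[OF subseq_filter_left z(1)] by simp
        thus ?thesis by (rule subseq_append_avoid) (use h b disj in \<open>auto split: if_splits\<close>)
      qed
      moreover have "subseq ?zB YB"
        by (rule subseq_append_avoid[OF subseq_order.order_trans[OF subseq_filter_left body]])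
          (use h b disj in auto)
      ultimately have "length ?zB \<le> rB + of_bool tB" by (rule gadget_bound[OF B])
      moreover have "subseq ?zH (XH @ replicate K d)"
      proof -
        have "subseq ?zH ((XB @ replicate rB dB) @ (XH @ replicate K d))"
          using subseq_order.order_trans[OF subseq_filter_left z(1)] by simp
        thus ?thesis by (rule subseq_avoid_append) (use zH_set h b disj in \<open>auto split: if_splits\<close>)
      qed
      moreover have "subseq ?zH YH"
        by (rule subseq_avoid_append[OF subseq_order.order_trans[OF subseq_filter_left body]])
          (use zH_set h b disj in auto)
      ultimately have "length ?zB + length ?zH \<le> (rB + of_bool tB) + (rH + of_bool tH)"
        using gadget_bound[OF H, of ?zH K] by linarith
      thus ?thesis using length_filter_split[of z ?P] by (auto simp: of_bool_def split: if_splits)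
    qed
  qed
  moreover have "\<exists>z. subseq z (?X @ replicate ?r d) \<and> subseq z ?Y \<and> length z = Suc ?r" if ?t
  proof -
    have tt: tB tH using that by simp_all
    obtain zB where zB: "subseq zB (XB @ replicate rB dB)" "subseq zB YB" "length zB = Suc rB"
      by (rule gadget_witness[OF B tt(1)])
    obtain zH where zH: "subseq zH (XH @ replicate rH d)" "subseq zH YH" "length zH = Suc rH"
      by (rule gadget_witness[OF H tt(2)])
    have "subseq (zB @ zH) ((XB @ replicate rB dB) @ ((XH @ replicate rH d) @ replicate (Suc rB) d))"
      by (rule list_emb_append_mono[OF zB(1) subseq_rev_drop_many[OF zH(1)]])
    moreover have "replicate rH d @ replicate (Suc rB) d = replicate ?r d"
      by (simp only: replicate_add[symmetric] add.commute add_Suc_right)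
    ultimately have "subseq (zB @ zH) (?X @ replicate ?r d)" by simp
    moreover have "subseq (zB @ zH) ?Y"
      by (rule subseq_drop_many[OF list_emb_append_mono[OF zB(2) zH(2)]])
    ultimately show ?thesis using zB zH by (intro exI[of _ "zB @ zH"]) auto
  qed
  moreover have "set ?X \<subseteq> insert 1 ?S" "set ?Y \<subseteq> insert 2 (insert d ?S)"
    using b h by (auto split: if_splits)
  moreover have "d \<notin> ?S" "1 \<notin> ?S" "2 \<notin> ?S" using b(1-5) h(1-5) disj by simp_all
  ultimately show ?thesis using cnt h(4,5) by (intro gadgetI)
qed

text \<open>The children stand in opposite orders in the two strings, so a match cannot gain from
  both. Taking \<open>A\<close> leaves the \<open>rH\<close> dollars of \<open>YH\<close>; taking
  \<open>H\<close> leaves the \<open>rA\<close> copies of \<open>p\<close>, which precede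
  \<open>H\<close> on both sides. Either way the other child is replaced by its base length.\<close>

lemma gadget_disj:
  assumes A: "gadget SA dA rA tA XA YA" and H: "gadget SH d rH tH XH YH"
    and disj: "SA \<inter> SH = {}" "dA \<notin> SH" "d \<notin> SA" "dA \<noteq> d"
    and p: "p \<notin> SA" "p \<notin> SH" "p \<noteq> dA" "p \<noteq> d" "p \<noteq> 1" "p \<noteq> 2"
  shows "gadget (insert p (insert dA (SA \<union> SH))) d (rA + rH) (tA \<or> tH)
    (replicate rA p @ XH @ XA @ replicate rA dA) (replicate rA d @ YA @ replicate rA p @ YH)"
  (is "gadget ?S d ?r ?t ?X ?Y")
proof -
  note a = gadgetD[OF A] and h = gadgetD[OF H]
  have cnt: "count_list ?Y d = ?r"
  proof -
    have "d \<notin> set YA" using a(7) disj(3,4) h(5) by auto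
    thus ?thesis using h(8) p(4) by simp
  qed
  have "length z \<le> ?r + of_bool ?t" if z: "subseq z (?X @ replicate K d)" "subseq z ?Y" for z K
  proof -
    have "d \<notin> set ?X" using a h disj p by (auto split: if_splits)
    then consider (body) "subseq z (YA @ replicate rA p @ YH)" | (const) "set z \<subseteq> {d}"
      using dollar_first[OF z(1) _ z(2)] by blast
    then show ?thesis
    proof cases
      case const
      thus ?thesis using length_subseq_const[OF z(2) const] cnt by simp
    next
      case body
      then obtain z1 z2 where z12: "z = z1 @ z2" "subseq z1 YA" "subseq z2 (replicate rA p @ YH)"
        by (auto simp: subseq_append_iff)
      from z(1) have "subseq z ((replicate rA p @ XH) @ ((XA @ replicate rA dA) @ replicate K d))" by simp
      then obtain u1 u2 where u: "z = u1 @ u2" "subseq u1 (replicate rA p @ XH)"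
        "subseq u2 ((XA @ replicate rA dA) @ replicate K d)"
        by (rule subseq_appendE)
      have zset: "set z \<subseteq> insert p (insert d (insert dA (SA \<union> SH)))"
      proof
        fix c assume "c \<in> set z"
        hence "c \<in> set (?X @ replicate K d)" "c \<in> set ?Y" using set_subseq z by blast+
        thus "c \<in> insert p (insert d (insert dA (SA \<union> SH)))" using a h by auto
      qed
      have z1_set: "set z1 \<subseteq> insert dA SA"
        using set_subseq[OF z12(2)] zset z12(1) a(3,5,7) h p by auto
      have z2_set: "set z2 \<subseteq> insert p (insert d SH)"
      proof
        fix c assume "c \<in> set z2"
        hence "c \<in> set (replicate rA p @ YH)" "c \<in> set z" using set_subseq[OF z12(3)] z12(1) by auto
        thus "c \<in> insert p (insert d SH)" using zset a h p by auto
      qed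
      have u1_set: "set u1 \<subseteq> insert p SH"
      proof
        fix c assume "c \<in> set u1"
        hence "c \<in> set (replicate rA p @ XH)" "c \<in> set z" using set_subseq[OF u(2)] u(1) by auto
        thus "c \<in> insert p SH" using zset a h p by auto
      qed
      have u2_set: "set u2 \<subseteq> insert d (insert dA SA)"
      proof
        fix c assume "c \<in> set u2"
        hence "c \<in> set ((XA @ replicate rA dA) @ replicate K d)" "c \<in> set z" using set_subseq[OF u(3)] u(1) by auto
        thus "c \<in> insert d (insert dA SA)" using zset a h p by auto
      qed
      \<comment> \<open>The cut of \<open>z\<close> behind \<open>YA\<close> is compared with its
        cut behind \<open>XH\<close>: in the first case nothing comes from \<open>YA\<close>, in the
        second only dollars come from \<open>YH\<close>.\<close>
      from z12(1) u(1) have "z1 @ z2 = u1 @ u2" by simp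
      then show ?thesis
      proof (cases rule: append_eq_append_cases)
        case (left w)
        have "set z1 \<subseteq> {}"
        proof
          fix c assume "c \<in> set z1"
          hence "c \<in> insert dA SA" "c \<in> insert p SH" using left(1) z1_set u1_set by auto
          thus "c \<in> {}" using disj p by auto
        qed
        hence z2: "z = z2" using z12(1) by simp
        let ?zp = "filter (\<lambda>c. c = p) z" and ?zH = "filter (\<lambda>c. \<not> c = p) z"
        have "subseq ?zp (replicate rA p @ YH)"
          using subseq_order.order_trans[OF subseq_filter_left] z12(3) z2 by blast
        hence "length ?zp \<le> count_list (replicate rA p @ YH) p" by (rule length_subseq_const) auto
        also have "\<dots> = rA" using h(7) p by (auto simp: count_list_0_iff)
        finally have len_p: "length ?zp \<le> rA" .
        have zH_set: "set ?zH \<subseteq> insert d SH" using z2_set z2 by auto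
        have "subseq ?zH (replicate rA p @ YH)"
          using subseq_order.order_trans[OF subseq_filter_left] z12(3) z2 by blast
        hence "subseq ?zH YH" by (rule subseq_avoid_append) (auto split: if_splits)
        moreover have "subseq ?zH (XH @ replicate K d)"
        proof -
          have zH: "?zH = filter (\<lambda>c. \<not> c = p) u1 @ filter (\<lambda>c. \<not> c = p) u2" using u(1) by simp
          have "subseq (filter (\<lambda>c. \<not> c = p) u1) XH"
            by (rule subseq_avoid_append[OF subseq_order.order_trans[OF subseq_filter_left u(2)]])
              (auto split: if_splits)
          moreover have "subseq (filter (\<lambda>c. \<not> c = p) u2) (replicate K d)"
          proof (rule subseq_avoid_append[OF subseq_order.order_trans[OF subseq_filter_left u(3)]])
            have "c \<notin> set (XA @ replicate rA dA)" if "c \<in> set (filter (\<lambda>c. \<not> c = p) u2)" for c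
            proof -
              from that zH zH_set have "c \<in> insert d SH" by auto
              thus ?thesis using a(6) disj h(1,2) gadgetD(4)[OF H] by auto
            qed
            thus "set (filter (\<lambda>c. \<not> c = p) u2) \<inter> set (XA @ replicate rA dA) = {}" by blast
          qed
          ultimately show ?thesis unfolding zH by (rule list_emb_append_mono)
        qed
        ultimately have "length ?zH \<le> rH + of_bool tH" by (intro gadget_bound[OF H])
        with len_p length_filter_split[of z "\<lambda>c. c = p"] show ?thesis
          by (auto simp: of_bool_def split: if_splits)
      next
        case (right w)
        have "set z2 \<subseteq> {d}"
        proof
          fix c assume "c \<in> set z2"
          hence "c \<in> insert p (insert d SH)" "c \<in> insert d (insert dA SA)"
            using right(2) z2_set u2_set by auto
          thus "c \<in> {d}" using disj p by auto
        qed
        moreover have "subseq z2 YH"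
          by (rule subseq_avoid_append[OF z12(3)]) (use \<open>set z2 \<subseteq> {d}\<close> p in \<open>auto split: if_splits\<close>)
        ultimately have "length z2 \<le> rH" using length_subseq_const[of z2 YH d] h(8) by simp
        moreover have "subseq z1 (XA @ replicate rA dA)"
        proof -
          have "subseq z1 z" using z12(1) by (simp add: subseq_rev_drop_many)
          hence "subseq z1 ((replicate rA p @ XH) @ (XA @ replicate rA dA) @ replicate K d)"
            using subseq_order.order_trans[OF _ z(1)] by simp
          hence "subseq z1 ((XA @ replicate rA dA) @ replicate K d)"
          proof (rule subseq_avoid_append)
            have "c \<notin> set (replicate rA p @ XH)" if "c \<in> set z1" for c
            proof -
              from that z1_set have "c \<in> insert dA SA" by auto
              thus ?thesis using h(6) a(2,4) disj p by auto
            qed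
            thus "set z1 \<inter> set (replicate rA p @ XH) = {}" by blast
          qed
          thus ?thesis by (rule subseq_append_avoid) (use z1_set disj in \<open>auto split: if_splits\<close>)
        qed
        hence "length z1 \<le> rA + of_bool tA" using gadget_bound[OF A _ z12(2), of rA] by simp
        ultimately show ?thesis using z12(1) by (auto simp: of_bool_def split: if_splits)
      qed
    qed
  qed
  moreover have "\<exists>z. subseq z (?X @ replicate ?r d) \<and> subseq z ?Y \<and> length z = Suc ?r" if ?t
    using that
  proof
    assume tA: tA
    obtain zA where zA: "subseq zA (XA @ replicate rA dA)" "subseq zA YA" "length zA = Suc rA"
      by (rule gadget_witness[OF A tA])
    \<comment> \<open>The witness of \<open>A\<close> is completed by the \<open>rH\<close> dollars
      of \<open>YH\<close>.\<close>
    have "subseq (zA @ replicate rH d) ((replicate rA p @ XH) @ (XA @ replicate rA dA) @ replicate ?r d)"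
      by (rule subseq_drop_many[OF list_emb_append_mono[OF zA(1) subseq_replicate_le]]) simp
    moreover have "subseq (zA @ replicate rH d) ?Y"
      by (rule subseq_drop_many[OF list_emb_append_mono[OF zA(2) subseq_drop_many]])
        (use subseq_replicate_count[of YH d] h(8) in simp)
    ultimately show ?thesis using zA by (intro exI[of _ "zA @ replicate rH d"]) auto
  next
    assume tH: tH
    obtain zH where zH: "subseq zH (XH @ replicate rH d)" "subseq zH YH" "length zH = Suc rH"
      by (rule gadget_witness[OF H tH])
    \<comment> \<open>The dollars of \<open>zH\<close> are now found behind \<open>XA\<close> and
      its pad; the other symbols stay in \<open>XH\<close>.\<close>
    have "subseq zH (XH @ (XA @ replicate rA dA) @ replicate ?r d)"
    proof -
      from zH(1) obtain v1 v2 where v: "zH = v1 @ v2" "subseq v1 XH" "subseq v2 (replicate rH d)"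
        by (rule subseq_appendE)
      have "subseq v2 (replicate ?r d)"
        using v(3) subseq_replicate_le[of rH ?r d] subseq_order.order_trans by auto
      thus ?thesis unfolding v(1) by (rule list_emb_append_mono[OF v(2) subseq_drop_many])
    qed
    hence "subseq (replicate rA p @ zH) (replicate rA p @ XH @ (XA @ replicate rA dA) @ replicate ?r d)"
      by (rule list_emb_append_mono[OF subseq_order.order_refl])
    moreover have "subseq (replicate rA p @ zH) ?Y"
      by (rule subseq_drop_many[OF subseq_drop_many[OF list_emb_append_mono[OF subseq_order.order_refl zH(2)]]])
    ultimately show ?thesis using zH by (intro exI[of _ "replicate rA p @ zH"]) auto
  qed
  moreover have "set ?X \<subseteq> insert 1 ?S" "set ?Y \<subseteq> insert 2 (insert d ?S)"
    using a h by (auto split: if_splits)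
  moreover have "d \<notin> ?S" "1 \<notin> ?S" "2 \<notin> ?S" using a(1-5) h(1-5) disj p by simp_all
  ultimately show ?thesis using cnt h(4,5) by (intro gadgetI)
qed

section \<open>The strings of a formula\<close>

primrec nodes :: "formula \<Rightarrow> nat" where
  "nodes (Pos v) = 1"
| "nodes (Neg v) = 1"
| "nodes (Conj F G) = Suc (nodes F + nodes G)"
| "nodes (Disj F G) = Suc (nodes F + nodes G)"

primrec ands :: "formula \<Rightarrow> nat" where
  "ands (Pos v) = 0"
| "ands (Neg v) = 0"
| "ands (Conj F G) = Suc (ands F + ands G)"
| "ands (Disj F G) = ands F + ands G"

lemma nodes_pos [simp]: "0 < nodes F"
  by (cases F) auto

lemma formula_size_simps [simp]:
  "formula_size (Pos v) = 1" "formula_size (Neg v) = 1"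
  "formula_size (Conj F G) = formula_size F + formula_size G"
  "formula_size (Disj F G) = formula_size F + formula_size G"
  by (auto simp: formula_size_def)

lemma Suc_nodes: "Suc (nodes F) = 2 * formula_size F"
  by (induction F) auto

lemma Suc_ands_le: "Suc (ands F) \<le> formula_size F"
  by (induction F) auto

lemma length_encode_formula [simp]: "length (encode_formula m F) = nodes F"
  by (induction F) auto

text \<open>The node at address \<open>i \<ge> 2\<close> owns the symbol \<open>2 * i\<close> and the dollar \<open>2 * i + 1\<close>; 0 is the
  separator, and 1 and 2 are junk symbols that occur only in \<open>x\<close> and only in \<open>y\<close>, respectively.\<close>

primrec leafx :: "bool list \<Rightarrow> nat \<Rightarrow> bool \<Rightarrow> var \<Rightarrow> nat" where
  "leafx a i b (XVar j) = (if a ! j = b then 2 * i else 1)"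
| "leafx a i b (YVar j) = 2 * i"

primrec leafy :: "bool list \<Rightarrow> nat \<Rightarrow> bool \<Rightarrow> var \<Rightarrow> nat" where
  "leafy a i b (XVar j) = 2 * i"
| "leafy a i b (YVar j) = (if a ! j = b then 2 * i else 2)"

text \<open>Addresses follow the prefix code: the first child of the node at \<open>i\<close> starts
  at \<open>Suc i\<close>, the second at \<open>c\<close>. The dollar of the node is no parameter,
  since on this side it is appended from outside. At a tie the second child counts as the larger
  one.\<close>

fun gx :: "bool list \<Rightarrow> nat \<Rightarrow> formula \<Rightarrow> nat list" where
  "gx a i (Pos v) = [leafx a i True v]"
| "gx a i (Neg v) = [leafx a i False v]"
| "gx a i (Conj F G) = (let c = Suc (i + nodes F) in
     if nodes G < nodes F
     then gx a c G @ replicate (ands G) (Suc (2 * c)) @ gx a (Suc i) F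
     else gx a (Suc i) F @ replicate (ands F) (Suc (2 * Suc i)) @ gx a c G)"
| "gx a i (Disj F G) = (let c = Suc (i + nodes F) in
     if nodes G < nodes F
     then replicate (ands G) (2 * i) @ gx a (Suc i) F @ gx a c G @ replicate (ands G) (Suc (2 * c))
     else replicate (ands F) (2 * i) @ gx a c G @ gx a (Suc i) F @ replicate (ands F) (Suc (2 * Suc i)))"

text \<open>The parameter \<open>d\<close> is the dollar inherited along the chain of larger
  children; a smaller child starts afresh with the dollar of its own address.\<close>

fun gy :: "bool list \<Rightarrow> nat \<Rightarrow> nat \<Rightarrow> formula \<Rightarrow> nat list" where
  "gy b i d (Pos v) = [leafy b i True v]"
| "gy b i d (Neg v) = [leafy b i False v]"
| "gy b i d (Conj F G) = (let c = Suc (i + nodes F) in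
     if nodes G < nodes F
     then replicate (Suc (ands G)) d @ gy b c (Suc (2 * c)) G @ gy b (Suc i) d F
     else replicate (Suc (ands F)) d @ gy b (Suc i) (Suc (2 * Suc i)) F @ gy b c d G)"
| "gy b i d (Disj F G) = (let c = Suc (i + nodes F) in
     if nodes G < nodes F
     then replicate (ands G) d @ gy b c (Suc (2 * c)) G @ replicate (ands G) (2 * i) @ gy b (Suc i) d F
     else replicate (ands F) d @ gy b (Suc i) (Suc (2 * Suc i)) F @ replicate (ands F) (2 * i) @ gy b c d G)"

text \<open>The dollar of \<open>i\<close> itself is left out: if it occurs at all, it is the \<open>d\<close> with which the
  gadget of that node is used.\<close>

definition symbols :: "nat \<Rightarrow> formula \<Rightarrow> nat set" where
  "symbols i F = {2 * i..<2 * (i + nodes F)} - {Suc (2 * i)}"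

text \<open>Address and dollar are generalized because the larger child keeps \<open>d\<close> while
  the smaller one takes the dollar of its own address, which its \<open>symbols\<close> leave free.
  Disjoint address ranges make the private alphabets of the children disjoint.\<close>

lemma gadget_formula:
  assumes "2 \<le> i" "2 < d" "d \<notin> symbols i F"
  shows "gadget (symbols i F) d (ands F) (feval (pair_assignment a b) F) (gx a i F) (gy b i d F)"
  using assms
proof (induction F arbitrary: i d)
  case (Pos v)
  have symb: "symbols i (Pos v) = {2 * i}" by (auto simp: symbols_def)
  show ?case
    unfolding symb ands.simps gx.simps gy.simps
    by (rule gadget_leaf; cases v) (use Pos.prems symb in auto)
next
  case (Neg v)
  have symb: "symbols i (Neg v) = {2 * i}" by (auto simp: symbols_def)
  show ?case
    unfolding symb ands.simps gx.simps gy.simps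
    by (rule gadget_leaf; cases v) (use Neg.prems symb in auto)
next
  case (Conj F G)
  let ?c = "Suc (i + nodes F)"
  have sub: "symbols (Suc i) F \<subseteq> symbols i (Conj F G)" "symbols ?c G \<subseteq> symbols i (Conj F G)"
    and d_sub: "Suc (2 * Suc i) \<in> symbols i (Conj F G)" "Suc (2 * ?c) \<in> symbols i (Conj F G)"
    using nodes_pos[of F] nodes_pos[of G] by (auto simp: symbols_def Suc_le_eq simp del: nodes_pos)
  \<comment> \<open>Both dollars are provided, since either child may turn out to be the smaller
    one.\<close>
  have F: "gadget (symbols (Suc i) F) d' (ands F) (feval (pair_assignment a b) F) (gx a (Suc i) F) (gy b (Suc i) d' F)"
    if "d' = d \<or> d' = Suc (2 * Suc i)" for d'
    by (rule Conj.IH(1)) (use Conj.prems sub that in \<open>auto simp: symbols_def\<close>)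
  have G: "gadget (symbols ?c G) d' (ands G) (feval (pair_assignment a b) G) (gx a ?c G) (gy b ?c d' G)"
    if "d' = d \<or> d' = Suc (2 * ?c)" for d'
    by (rule Conj.IH(2)) (use Conj.prems sub that in \<open>auto simp: symbols_def\<close>)
  have disj: "symbols (Suc i) F \<inter> symbols ?c G = {}"
    "Suc (2 * Suc i) \<notin> symbols ?c G" "Suc (2 * ?c) \<notin> symbols (Suc i) F"
    using nodes_pos[of F] by (auto simp: symbols_def simp del: nodes_pos)
  have small: "1 \<notin> symbols i (Conj F G)" "2 \<notin> symbols i (Conj F G)"
    using Conj.prems by (auto simp: symbols_def)
  show ?case
  proof (cases "nodes G < nodes F")
    case True
    have "gadget (insert (Suc (2 * ?c)) (symbols ?c G \<union> symbols (Suc i) F)) d (Suc (ands G + ands F))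
        (feval (pair_assignment a b) G \<and> feval (pair_assignment a b) F)
        (gx a i (Conj F G)) (gy b i d (Conj F G))"
      using gadget_conj[OF G[of "Suc (2 * ?c)"] F[of d]] disj sub d_sub Conj.prems(3) True
      by (auto simp: Let_def)
    from gadget_mono[OF this, of "symbols i (Conj F G)"] sub d_sub Conj.prems(3) small
    show ?thesis by (simp add: add.commute conj_commute)
  next
    case False
    have "gadget (insert (Suc (2 * Suc i)) (symbols (Suc i) F \<union> symbols ?c G)) d (Suc (ands F + ands G))
        (feval (pair_assignment a b) F \<and> feval (pair_assignment a b) G)
        (gx a i (Conj F G)) (gy b i d (Conj F G))"
      using gadget_conj[OF F[of "Suc (2 * Suc i)"] G[of d]] disj sub d_sub Conj.prems(3) False
      by (auto simp: Let_def)
    from gadget_mono[OF this, of "symbols i (Conj F G)"] sub d_sub Conj.prems(3) small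
    show ?thesis by simp
  qed
next
  case (Disj F G)
  let ?c = "Suc (i + nodes F)"
  have sub: "symbols (Suc i) F \<subseteq> symbols i (Disj F G)" "symbols ?c G \<subseteq> symbols i (Disj F G)"
    and d_sub: "Suc (2 * Suc i) \<in> symbols i (Disj F G)" "Suc (2 * ?c) \<in> symbols i (Disj F G)"
      "2 * i \<in> symbols i (Disj F G)"
    using nodes_pos[of F] nodes_pos[of G] by (auto simp: symbols_def Suc_le_eq simp del: nodes_pos)
  have F: "gadget (symbols (Suc i) F) d' (ands F) (feval (pair_assignment a b) F) (gx a (Suc i) F) (gy b (Suc i) d' F)"
    if "d' = d \<or> d' = Suc (2 * Suc i)" for d'
    by (rule Disj.IH(1)) (use Disj.prems sub that in \<open>auto simp: symbols_def\<close>)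
  have G: "gadget (symbols ?c G) d' (ands G) (feval (pair_assignment a b) G) (gx a ?c G) (gy b ?c d' G)"
    if "d' = d \<or> d' = Suc (2 * ?c)" for d'
    by (rule Disj.IH(2)) (use Disj.prems sub that in \<open>auto simp: symbols_def\<close>)
  have disj: "symbols (Suc i) F \<inter> symbols ?c G = {}"
    "Suc (2 * Suc i) \<notin> symbols ?c G" "Suc (2 * ?c) \<notin> symbols (Suc i) F"
    "2 * i \<notin> symbols (Suc i) F" "2 * i \<notin> symbols ?c G" "2 * i \<noteq> Suc (2 * Suc i)" "2 * i \<noteq> Suc (2 * ?c)"
    "2 * i \<noteq> 1" "2 * i \<noteq> 2"
    using Disj.prems(1) nodes_pos[of F] by (auto simp: symbols_def simp del: nodes_pos)
  have small: "1 \<notin> symbols i (Disj F G)" "2 \<notin> symbols i (Disj F G)"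
    using Disj.prems by (auto simp: symbols_def)
  show ?case
  proof (cases "nodes G < nodes F")
    case True
    have "gadget (insert (2 * i) (insert (Suc (2 * ?c)) (symbols ?c G \<union> symbols (Suc i) F))) d (ands G + ands F)
        (feval (pair_assignment a b) G \<or> feval (pair_assignment a b) F)
        (gx a i (Disj F G)) (gy b i d (Disj F G))"
      using gadget_disj[OF G[of "Suc (2 * ?c)"] F[of d], of "2 * i"] disj sub d_sub Disj.prems(3) True
      by (auto simp: Let_def)
    from gadget_mono[OF this, of "symbols i (Disj F G)"] sub d_sub Disj.prems(3) small
    show ?thesis by (simp add: add.commute disj_commute)
  next
    case False
    have "gadget (insert (2 * i) (insert (Suc (2 * Suc i)) (symbols (Suc i) F \<union> symbols ?c G))) d (ands F + ands G)
        (feval (pair_assignment a b) F \<or> feval (pair_assignment a b) G)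
        (gx a i (Disj F G)) (gy b i d (Disj F G))"
      using gadget_disj[OF F[of "Suc (2 * Suc i)"] G[of d], of "2 * i"] disj sub d_sub Disj.prems(3) False
      by (auto simp: Let_def)
    from gadget_mono[OF this, of "symbols i (Disj F G)"] sub d_sub Disj.prems(3) small
    show ?thesis by simp
  qed
qed

text \<open>Bounds the string on either side: the pads of a gate are at most twice as many as the
  leaves of its smaller child.\<close>

primrec gadget_cost :: "formula \<Rightarrow> nat" where
  "gadget_cost (Pos v) = 1"
| "gadget_cost (Neg v) = 1"
| "gadget_cost (Conj F G) = gadget_cost F + gadget_cost G + 2 * min (formula_size F) (formula_size G)"
| "gadget_cost (Disj F G) = gadget_cost F + gadget_cost G + 2 * min (formula_size F) (formula_size G)"

lemma nodes_less_iff: "nodes F < nodes G \<longleftrightarrow> formula_size F < formula_size G"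
  using Suc_nodes[of F] Suc_nodes[of G] by linarith

lemma length_gx_le: "length (gx a i F) \<le> gadget_cost F"
proof (induction F arbitrary: i)
  case (Conj F G)
  show ?case
    using Conj.IH(1)[of "Suc i"] Conj.IH(2)[of "Suc (i + nodes F)"] Suc_ands_le[of F] Suc_ands_le[of G]
    by (auto simp: Let_def nodes_less_iff min_def)
next
  case (Disj F G)
  show ?case
    using Disj.IH(1)[of "Suc i"] Disj.IH(2)[of "Suc (i + nodes F)"] Suc_ands_le[of F] Suc_ands_le[of G]
    by (auto simp: Let_def nodes_less_iff min_def)
qed auto

lemma length_gy_le: "length (gy b i d F) \<le> gadget_cost F"
proof (induction F arbitrary: i d)
  case (Conj F G)
  let ?c = "Suc (i + nodes F)"
  show ?case
    using Conj.IH(1)[of "Suc i" d] Conj.IH(2)[of ?c d] Conj.IH(1)[of "Suc i" "Suc (2 * Suc i)"]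
      Conj.IH(2)[of ?c "Suc (2 * ?c)"] Suc_ands_le[of F] Suc_ands_le[of G]
    by (auto simp: Let_def nodes_less_iff min_def)
next
  case (Disj F G)
  let ?c = "Suc (i + nodes F)"
  show ?case
    using Disj.IH(1)[of "Suc i" d] Disj.IH(2)[of ?c d] Disj.IH(1)[of "Suc i" "Suc (2 * Suc i)"]
      Disj.IH(2)[of ?c "Suc (2 * ?c)"] Suc_ands_le[of F] Suc_ands_le[of G]
    by (auto simp: Let_def nodes_less_iff min_def)
qed auto

lemma formula_size_pos [simp]: "0 < formula_size F"
  using Suc_ands_le[of F] by simp

text \<open>The term \<open>2 * min p q\<close> is at most the mixed term \<open>2 * p * q\<close>
  of the square. This integer bound serves to keep addresses within the word range.\<close>

lemma gadget_cost_le_square: "gadget_cost F \<le> (formula_size F)\<^sup>2"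
proof -
  have step: "p\<^sup>2 + q\<^sup>2 + 2 * min p q \<le> (p + q)\<^sup>2" if "0 < p" "0 < q" for p q :: nat
  proof -
    have "min p q \<le> p * q" using that by (cases "p \<le> q") (auto simp: min_def)
    thus ?thesis by (simp add: power2_sum)
  qed
  show ?thesis
  proof (induction F)
    case (Conj F G)
    thus ?case using step[of "formula_size F" "formula_size G"] by simp
  next
    case (Disj F G)
    thus ?case using step[of "formula_size F" "formula_size G"] by simp
  qed auto
qed

text \<open>For \<open>p \<le> q\<close>, the extra \<open>p\<close> turns
  \<open>p * log 2 p\<close> into \<open>p * log 2 (2 * p)\<close>, which is at most
  \<open>p * log 2 (p + q)\<close>: a leaf pays for a gate only if its subformula at least doubles
  there.\<close>

lemma gadget_cost_le_log:
  "real (gadget_cost F) \<le> real (formula_size F) * (1 + 2 * log 2 (real (formula_size F)))"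
proof -
  have aux: "p * log 2 p + q * log 2 q + p \<le> (p + q) * log 2 (p + q)" if "1 \<le> p" "p \<le> q" for p q :: real
  proof -
    have "p * log 2 p + p = p * log 2 (2 * p)" using that by (simp add: log_mult algebra_simps)
    also have "\<dots> \<le> p * log 2 (p + q)" using that by (intro mult_left_mono) auto
    finally have "p * log 2 p + p \<le> p * log 2 (p + q)" .
    moreover have "q * log 2 q \<le> q * log 2 (p + q)" using that by (intro mult_left_mono) auto
    ultimately show ?thesis by (simp add: algebra_simps)
  qed
  have step: "p * (1 + 2 * log 2 p) + q * (1 + 2 * log 2 q) + 2 * min p q \<le> (p + q) * (1 + 2 * log 2 (p + q))"
    if "1 \<le> p" "1 \<le> q" for p q :: real
    using aux[of p q] aux[of q p] that by (cases "p \<le> q") (auto simp: min_def algebra_simps)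
  have ge1: "1 \<le> real (formula_size H)" for H
    using formula_size_pos[of H] by linarith
  show ?thesis
  proof (induction F)
    case (Conj F G)
    thus ?case using step[OF ge1[of F] ge1[of G]] by (simp add: of_nat_min)
  next
    case (Disj F G)
    thus ?case using step[OF ge1[of F] ge1[of G]] by (simp add: of_nat_min)
  qed auto
qed

text \<open>The root of the formula sits at address 2, behind \<open>m\<close> and \<open>n\<close>,
  and so owns the dollar 5. The indices modulo \<open>n\<close> write the gadgets twice in a
  row.\<close>

definition xstr :: "nat \<Rightarrow> formula \<Rightarrow> bool list list \<Rightarrow> nat list" where
  "xstr n F A = blocks 0 (ands F)
     (map (\<lambda>q. gx (A ! (q mod n)) 2 F @ replicate (ands F) 5) [0..<2 * n])"

definition ystr :: "nat \<Rightarrow> formula \<Rightarrow> bool list list \<Rightarrow> nat list" where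
  "ystr n F B = replicate (n * ands F) 0 @ blocks 0 (ands F) (map (\<lambda>q. gy (B ! q) 2 5 F) [0..<n]) @
     replicate (n * ands F) 0"

lemma gadget_root: "gadget (symbols 2 F) 5 (ands F) (feval (pair_assignment a b) F) (gx a 2 F) (gy b 2 5 F)"
  by (rule gadget_formula) (auto simp: symbols_def)

text \<open>The alignment theorem applies with \<open>M = ands F\<close>: all pairs share the
  dollars of the root, and the root gadgets exceed this length exactly for satisfying pairs.\<close>

theorem LCS_xstr_ystr:
  assumes "length A = n" "length B = n"
  shows "3 * (n * ands F) + 1 \<le> LCS (xstr n F A) (ystr n F B) \<longleftrightarrow>
    (\<exists>a\<in>set A. \<exists>b\<in>set B. feval (pair_assignment a b) F)"
proof -
  let ?M = "ands F"
  let ?X = "\<lambda>i. gx (A ! i) 2 F @ replicate ?M 5" and ?Y = "\<lambda>j. gy (B ! j) 2 5 F"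
  have "3 * (n * ?M) + 1 \<le> LCS (xstr n F A) (ystr n F B) \<longleftrightarrow>
    (\<exists>i<n. \<exists>j<n. feval (pair_assignment (A ! i) (B ! j)) F)"
    unfolding xstr_def ystr_def
  proof (rule aligned_blocks_LCS[of n ?X ?Y ?M])
    fix i j
    note g = gadget_root[of F "A ! i" "B ! j"]
    have "subseq (replicate ?M 5) (?Y j)"
      using subseq_replicate_count[of "?Y j" 5] gadgetD(8)[OF g] by simp
    thus "\<exists>z. subseq z (?X i) \<and> subseq z (?Y j) \<and> length z = ?M"
      by (intro exI[of _ "replicate ?M 5"]) (auto intro: subseq_drop_many)
    show "length z \<le> ?M"
      if "\<not> feval (pair_assignment (A ! i) (B ! j)) F" "subseq z (?X i)" "subseq z (?Y j)" for z
      using gadget_bound[OF g that(2,3)] that(1) by simp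
    show "\<exists>z. subseq z (?X i) \<and> subseq z (?Y j) \<and> length z = Suc ?M"
      if "feval (pair_assignment (A ! i) (B ! j)) F"
      using gadget_witness[OF g that] by blast
    show "0 \<notin> set (?X i)" "0 \<notin> set (?Y i)"
      using gadgetD(6)[OF g] gadgetD(7)[OF gadget_root[of F "A ! i" "B ! i"]]
      by (auto simp: symbols_def)
  qed
  also have "\<dots> \<longleftrightarrow> (\<exists>a\<in>set A. \<exists>b\<in>set B. feval (pair_assignment a b) F)"
    using assms by (metis in_set_conv_nth)
  finally show ?thesis .
qed

section \<open>Alphabet and length of the two strings\<close>

lemma set_blocks: "set (blocks s M Xs) \<subseteq> insert s (\<Union>(set ` set Xs))"
  by (induction Xs) auto

text \<open>The addresses lie below \<open>2 + nodes F\<close>, which is \<open>2 * s + 1\<close>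
  for a formula with \<open>s\<close> leaves, and every address owns two symbols.\<close>

lemma root_symbols:
  "insert 0 (insert 1 (insert 2 (insert 5 (symbols 2 F)))) \<subseteq> {..<4 * formula_size F + 2}"
proof -
  have "5 < 4 * formula_size F + 2" using formula_size_pos[of F] by linarith
  thus ?thesis using Suc_nodes[of F] by (auto simp: symbols_def)
qed

lemma set_xstr: "set (xstr n F A) \<subseteq> {..<4 * formula_size F + 2}"
proof -
  have "set (xstr n F A) \<subseteq> insert 0 (insert 1 (insert 5 (symbols 2 F)))"
    unfolding xstr_def using gadgetD(6)[OF gadget_root[of F]]
    by (intro order.trans[OF set_blocks]) auto
  thus ?thesis using root_symbols by blast
qed

lemma set_ystr: "set (ystr n F B) \<subseteq> {..<4 * formula_size F + 2}"
proof -
  have "set (blocks 0 (ands F) (map (\<lambda>q. gy (B ! q) 2 5 F) [0..<n])) \<subseteq> insert 0 (insert 2 (insert 5 (symbols 2 F)))"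
    using gadgetD(7)[OF gadget_root[of F]]
    by (intro order.trans[OF set_blocks]) auto
  hence "set (ystr n F B) \<subseteq> insert 0 (insert 2 (insert 5 (symbols 2 F)))"
    unfolding ystr_def by auto
  thus ?thesis using root_symbols by blast
qed

lemma length_blocks_le:
  "(\<And>X. X \<in> set Xs \<Longrightarrow> length X \<le> L) \<Longrightarrow> length (blocks s M Xs) \<le> length Xs * (L + M)"
  by (induction Xs) force+

lemma length_xstr_le: "length (xstr n F A) \<le> 2 * n * (gadget_cost F + 2 * ands F)"
proof -
  have "length (xstr n F A) \<le> length (map (\<lambda>q. gx (A ! (q mod n)) 2 F @ replicate (ands F) (5::nat)) [0..<2 * n])
      * ((gadget_cost F + ands F) + ands F)"
    unfolding xstr_def by (rule length_blocks_le) (auto simp: length_gx_le)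
  thus ?thesis by (simp add: algebra_simps)
qed

lemma length_ystr_le: "length (ystr n F B) \<le> n * (gadget_cost F + 3 * ands F)"
proof -
  have "length (blocks 0 (ands F) (map (\<lambda>q. gy (B ! q) 2 5 F) [0..<n]))
      \<le> length (map (\<lambda>q. gy (B ! q) 2 5 F) [0..<n]) * (gadget_cost F + ands F)"
    by (rule length_blocks_le) (auto simp: length_gy_le)
  thus ?thesis by (simp add: ystr_def algebra_simps)
qed

section \<open>Timed weakest preconditions\<close>

text \<open>Total correctness: a run exists, so the program halts and never leaves the word range.
  The elapsed time is handed to \<open>Q\<close>, so that time bounds are proved along with the
  result.\<close>

definition wp :: "nat \<Rightarrow> com \<Rightarrow> (nat \<Rightarrow> state \<Rightarrow> bool) \<Rightarrow> state \<Rightarrow> bool" where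
  "wp W c Q \<sigma> \<longleftrightarrow> (\<exists>t \<tau>. exec W c \<sigma> t \<tau> \<and> Q t \<tau>)"

lemma wp_Skip [simp]: "wp W Skip Q \<sigma> \<longleftrightarrow> Q 1 \<sigma>"
  unfolding wp_def by (metis One_nat_def exec.Skip exec_elims(1))

text \<open>As equivalences on explicit pairs, this rule and its companions let the simplifier
  execute straight-line code symbolically.\<close>

lemma wp_Move [simp]:
  "wp W (Move r a) Q (R, M) \<longleftrightarrow> opval (R, M) a < W \<and> Q 1 (R(r := opval (R, M) a), M)"
proof
  assume "wp W (Move r a) Q (R, M)"
  thus "opval (R, M) a < W \<and> Q 1 (R(r := opval (R, M) a), M)"
    by (auto simp: wp_def set_reg_def elim!: exec_elims)
next
  assume "opval (R, M) a < W \<and> Q 1 (R(r := opval (R, M) a), M)"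
  thus "wp W (Move r a) Q (R, M)"
    using exec.Move[OF refl, of "(R, M)" a W r] by (auto simp: wp_def set_reg_def)
qed

lemma wp_Bin [simp]:
  "wp W (Bin r f a b) Q (R, M) \<longleftrightarrow> binval f (opval (R, M) a) (opval (R, M) b) < W \<and>
     Q 1 (R(r := binval f (opval (R, M) a) (opval (R, M) b)), M)" (is "_ \<longleftrightarrow> ?r")
proof
  assume "wp W (Bin r f a b) Q (R, M)"
  thus ?r by (auto simp: wp_def set_reg_def elim!: exec_elims)
next
  assume ?r
  thus "wp W (Bin r f a b) Q (R, M)"
    using exec.Bin[OF refl, of f "(R, M)" a b W r] by (auto simp: wp_def set_reg_def)
qed

lemma wp_Load [simp]:
  "wp W (Load r a) Q (R, M) \<longleftrightarrow> opval (R, M) a < W \<and> M (opval (R, M) a) < W \<and>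
     Q 1 (R(r := M (opval (R, M) a)), M)" (is "_ \<longleftrightarrow> ?r")
proof
  assume "wp W (Load r a) Q (R, M)"
  thus ?r by (auto simp: wp_def set_reg_def elim!: exec_elims)
next
  assume ?r
  thus "wp W (Load r a) Q (R, M)"
    using exec.Load[OF refl, of "(R, M)" a W _ r] by (auto simp: wp_def set_reg_def)
qed

lemma wp_Store [simp]:
  "wp W (Store a b) Q (R, M) \<longleftrightarrow> opval (R, M) a < W \<and> opval (R, M) b < W \<and>
     Q 1 (R, M(opval (R, M) a := opval (R, M) b))" (is "_ \<longleftrightarrow> ?r")
proof
  assume "wp W (Store a b) Q (R, M)"
  thus ?r by (auto simp: wp_def set_mem_def elim!: exec_elims)
next
  assume ?r
  thus "wp W (Store a b) Q (R, M)"
    using exec.Store[OF refl, of "(R, M)" a W _ b] by (auto simp: wp_def set_mem_def)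
qed

lemma wp_Seq [simp]:
  "wp W (Seq c d) Q \<sigma> \<longleftrightarrow> wp W c (\<lambda>t. wp W d (\<lambda>u. Q (t + u))) \<sigma>"
proof
  assume "wp W (Seq c d) Q \<sigma>"
  thus "wp W c (\<lambda>t. wp W d (\<lambda>u. Q (t + u))) \<sigma>"
    unfolding wp_def by (metis exec_elims(6))
next
  assume "wp W c (\<lambda>t. wp W d (\<lambda>u. Q (t + u))) \<sigma>"
  thus "wp W (Seq c d) Q \<sigma>" unfolding wp_def by (metis exec.Seq)
qed

lemma wp_If [simp]:
  "wp W (IfThenElse e c d) Q \<sigma> \<longleftrightarrow>
     (if testval \<sigma> e then wp W c (\<lambda>t. Q (1 + t)) \<sigma> else wp W d (\<lambda>t. Q (1 + t)) \<sigma>)" (is "_ \<longleftrightarrow> ?r")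
proof
  assume "wp W (IfThenElse e c d) Q \<sigma>"
  then obtain t \<tau> where t: "exec W (IfThenElse e c d) \<sigma> t \<tau>" "Q t \<tau>" by (auto simp: wp_def)
  from t(1) show ?r by (rule exec_elims(7)) (use t(2) in \<open>auto simp: wp_def simp del: split_paired_Ex\<close>)
next
  assume ?r
  thus "wp W (IfThenElse e c d) Q \<sigma>"
    unfolding wp_def by (metis exec.IfFalse exec.IfTrue)
qed

lemma wp_mono:
  assumes "wp W c Q \<sigma>" "\<And>t \<tau>. Q t \<tau> \<Longrightarrow> Q' t \<tau>"
  shows "wp W c Q' \<sigma>"
  using assms unfolding wp_def by blast

text \<open>The invariant carries a time credit \<open>k\<close>, which also bounds the number of iterations.\<close>

lemma wp_While:
  assumes "I k \<sigma>"
    and step: "\<And>k \<sigma>. I k \<sigma> \<Longrightarrow> testval \<sigma> e \<Longrightarrow> wp W c (\<lambda>t \<tau>. \<exists>k'. Suc t + k' \<le> k \<and> I k' \<tau>) \<sigma>"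
    and exit: "\<And>k' t \<tau>. I k' \<tau> \<Longrightarrow> \<not> testval \<tau> e \<Longrightarrow> t \<le> Suc k \<Longrightarrow> Q t \<tau>"
  shows "wp W (WhileDo e c) Q \<sigma>"
proof -
  have "\<exists>t \<tau> k'. exec W (WhileDo e c) \<sigma> t \<tau> \<and> I k' \<tau> \<and> \<not> testval \<tau> e \<and> t \<le> Suc k" using assms(1)
  proof (induction k arbitrary: \<sigma> rule: less_induct)
    case (less k)
    show ?case
    proof (cases "testval \<sigma> e")
      case False
      thus ?thesis using less.prems exec.WhileFalse[OF False] by (intro exI[of _ 1] exI[of _ \<sigma>] exI[of _ k]) auto
    next
      case True
      from step[OF less.prems True] obtain t \<tau> k'
        where t: "exec W c \<sigma> t \<tau>" "Suc t + k' \<le> k" "I k' \<tau>" by (auto simp: wp_def)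
      from less.IH[OF _ t(3)] t(2) obtain u \<tau>' k''
        where u: "exec W (WhileDo e c) \<tau> u \<tau>'" "I k'' \<tau>'" "\<not> testval \<tau>' e" "u \<le> Suc k'"
        by (metis add_Suc less_add_Suc2 less_le_trans)
      from exec.WhileTrue[OF True t(1) u(1)] u t(2) show ?thesis
        by (intro exI[of _ "1 + t + u"] exI[of _ \<tau>'] exI[of _ k'']) auto
    qed
  qed
  thus ?thesis using exit unfolding wp_def by blast
qed

primrec seqs :: "com list \<Rightarrow> com" where
  "seqs [] = Skip"
| "seqs (c # cs) = Seq c (seqs cs)"

section \<open>Occurrences of subformulas at their addresses in the prefix code\<close>

primrec occ :: "nat \<Rightarrow> formula \<Rightarrow> (nat \<times> formula) set" where
  "occ i (Pos v) = {(i, Pos v)}"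
| "occ i (Neg v) = {(i, Neg v)}"
| "occ i (Conj F G) = insert (i, Conj F G) (occ (Suc i) F \<union> occ (Suc (i + nodes F)) G)"
| "occ i (Disj F G) = insert (i, Disj F G) (occ (Suc i) F \<union> occ (Suc (i + nodes F)) G)"

lemma occ_self [simp]: "(i, F) \<in> occ i F"
  by (cases F) auto

lemma occ_bounds: "(j, G) \<in> occ i F \<Longrightarrow> i \<le> j \<and> j + nodes G \<le> i + nodes F"
  by (induction F arbitrary: i) fastforce+

lemma occ_trans: "(j, G) \<in> occ i F \<Longrightarrow> occ j G \<subseteq> occ i F"
  by (induction F arbitrary: i) fastforce+

lemma occ_exists: "i \<le> j \<Longrightarrow> j < i + nodes F \<Longrightarrow> \<exists>G. (j, G) \<in> occ i F"
proof (induction F arbitrary: i)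
  case (Conj F G)
  consider "j = i" | "Suc i \<le> j" "j < Suc i + nodes F" | "Suc (i + nodes F) \<le> j" using Conj.prems by atomize_elim auto
  then show ?case
  proof cases
    case 2
    with Conj.IH(1)[of "Suc i"] show ?thesis by auto
  next
    case 3
    with Conj.IH(2)[of "Suc (i + nodes F)"] Conj.prems show ?thesis by auto
  qed auto
next
  case (Disj F G)
  consider "j = i" | "Suc i \<le> j" "j < Suc i + nodes F" | "Suc (i + nodes F) \<le> j" using Disj.prems by atomize_elim auto
  then show ?case
  proof cases
    case 2
    with Disj.IH(1)[of "Suc i"] show ?thesis by auto
  next
    case 3
    with Disj.IH(2)[of "Suc (i + nodes F)"] Disj.prems show ?thesis by auto
  qed auto
qed auto

text \<open>The code of a subformula is a contiguous segment starting at its address, so one load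
  reveals the kind of a node and, at a leaf, its literal.\<close>

lemma occ_code:
  assumes "\<And>k. k < nodes F \<Longrightarrow> f (i + k) = encode_formula m F ! k" "(j, G) \<in> occ i F"
  shows "f j = hd (encode_formula m G)"
  using assms
proof (induction F arbitrary: i)
  case (Conj F1 F2)
  have 1: "f (Suc i + k) = encode_formula m F1 ! k" if "k < nodes F1" for k
    using Conj.prems(1)[of "Suc k"] that by (simp add: nth_append)
  have 2: "f (Suc (i + nodes F1) + k) = encode_formula m F2 ! k" if "k < nodes F2" for k
    using Conj.prems(1)[of "Suc (nodes F1 + k)"] that by (simp add: nth_append add.assoc)
  show ?case using Conj.prems(2) Conj.IH(1)[of "Suc i", OF 1] Conj.IH(2)[of "Suc (i + nodes F1)", OF 2]
      Conj.prems(1)[of 0] by auto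
next
  case (Disj F1 F2)
  have 1: "f (Suc i + k) = encode_formula m F1 ! k" if "k < nodes F1" for k
    using Disj.prems(1)[of "Suc k"] that by (simp add: nth_append)
  have 2: "f (Suc (i + nodes F1) + k) = encode_formula m F2 ! k" if "k < nodes F2" for k
    using Disj.prems(1)[of "Suc (nodes F1 + k)"] that by (simp add: nth_append add.assoc)
  show ?case using Disj.prems(2) Disj.IH(1)[of "Suc i", OF 1] Disj.IH(2)[of "Suc (i + nodes F1)", OF 2]
      Disj.prems(1)[of 0] by auto
qed (use occ_self in force)+

lemma occ_leaf_vars: "(j, G) \<in> occ i F \<Longrightarrow> set (leaf_vars G) \<subseteq> set (leaf_vars F)"
  by (induction F arbitrary: i) fastforce+

section \<open>Pending tasks of the traversal and their potential\<close>

datatype task = Rep nat nat | Node nat nat formula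

text \<open>The subformula of a \<open>Node\<close> is present only in the proof; the machine knows
  it by its address.\<close>

fun task_words :: "task \<Rightarrow> nat \<times> nat \<times> nat" where
  "task_words (Rep s c) = (0, s, c)"
| "task_words (Node i d G) = (1, i, d)"

definition gadget_string :: "nat \<Rightarrow> bool list \<Rightarrow> nat \<Rightarrow> nat \<Rightarrow> formula \<Rightarrow> nat list" where
  "gadget_string md v i d G = (if md = 1 then gx v i G else gy v i d G)"

fun flat :: "nat \<Rightarrow> bool list \<Rightarrow> task \<Rightarrow> nat list" where
  "flat md v (Rep s c) = replicate c s"
| "flat md v (Node i d G) = gadget_string md v i d G"

text \<open>An upper bound on the loop iterations that a task will cause. A repetition takes one
  more iteration to discard its empty rest; \<open>4 * l - 3\<close> is 1 at a leaf and leaves room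
  for the tasks into which a gate is split.\<close>

fun pot :: "nat \<Rightarrow> bool list \<Rightarrow> task \<Rightarrow> nat" where
  "pot md v (Rep s c) = Suc c"
| "pot md v (Node i d G) = 4 * length (gadget_string md v i d G) - 3"

abbreviation flats :: "nat \<Rightarrow> bool list \<Rightarrow> task list \<Rightarrow> nat list" where
  "flats md v ts \<equiv> concat (map (flat md v) ts)"

abbreviation pots :: "nat \<Rightarrow> bool list \<Rightarrow> task list \<Rightarrow> nat" where
  "pots md v ts \<equiv> sum_list (map (pot md v) ts)"

text \<open>Listed in the order of emission, hence from the top of the stack down. \<open>l\<close>
  and \<open>L\<close> belong to the smaller child, \<open>h\<close> and \<open>H\<close> to the
  larger one.\<close>

definition gate_tasks :: "nat \<Rightarrow> bool \<Rightarrow> nat \<Rightarrow> nat \<Rightarrow> nat \<Rightarrow> formula \<Rightarrow> nat \<Rightarrow> formula \<Rightarrow> task list" where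
  "gate_tasks md cj i d l L h H =
     (if md = 1 then
        if cj then [Node l (Suc (2 * l)) L, Rep (Suc (2 * l)) (ands L), Node h d H]
        else [Rep (2 * i) (ands L), Node h d H, Node l (Suc (2 * l)) L, Rep (Suc (2 * l)) (ands L)]
      else
        if cj then [Rep d (Suc (ands L)), Node l (Suc (2 * l)) L, Node h d H]
        else [Rep d (ands L), Node l (Suc (2 * l)) L, Rep (2 * i) (ands L), Node h d H])"

text \<open>Keeps the subtraction in \<open>pot\<close> from truncating.\<close>

lemma gadget_string_nonempty [simp]: "0 < length (gadget_string md v i d G)"
proof -
  have "0 < length (gx v i G)" by (induction G arbitrary: i) (auto simp: Let_def)
  moreover have "0 < length (gy v i d G)" by (induction G arbitrary: i d) (auto simp: Let_def)
  ultimately show ?thesis by (simp add: gadget_string_def)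
qed

lemma flats_gate_tasks:
  assumes "(l, L, h, H) = (if nodes G < nodes F then (Suc (i + nodes F), G, Suc i, F)
    else (Suc i, F, Suc (i + nodes F), G))"
  shows "flats md v (gate_tasks md True i d l L h H) = gadget_string md v i d (Conj F G)"
    "flats md v (gate_tasks md False i d l L h H) = gadget_string md v i d (Disj F G)"
  using assms by (auto simp: gate_tasks_def gadget_string_def Let_def split: if_splits)

text \<open>Against four times the emitted length, the two child nodes save 6 and the at most two
  repetitions cost at most 1 each, so the sum stays at least 4 below.\<close>

lemma pots_gate_tasks:
  "pots md v (gate_tasks md cj i d l L h H) < 4 * length (flats md v (gate_tasks md cj i d l L h H)) - 3"
proof -
  have "pots md v (gate_tasks md cj i d l L h H) + 4 \<le> 4 * length (flats md v (gate_tasks md cj i d l L h H))"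
    using gadget_string_nonempty[of md v l "Suc (2 * l)" L] gadget_string_nonempty[of md v h d H]
    by (cases "md = 1"; cases cj)
      (simp_all add: gate_tasks_def del: gadget_string_nonempty length_greater_0_conv)
  thus ?thesis by linarith
qed

section \<open>The emitting loop\<close>

text \<open>Registers: 10 \<open>m\<close>, 11 \<open>n\<close>, 12 the input length \<open>N\<close>, 14 the bottom of the task stack, 15 its top,
  16 the end of the output, 30 the mode (1 for \<open>x\<close>, 2 for \<open>y\<close>, also the junk symbol),
  36 the current vector; 40 and above are scratch. The node at address \<open>i\<close> has its number of
  nodes stored at \<open>N + i\<close> and its number of conjunctions at \<open>2 * N + i\<close>.\<close>

definition push :: "operand \<Rightarrow> operand \<Rightarrow> operand \<Rightarrow> com" where
  "push a b c = seqs [Store (Reg 15) a, Bin 15 Add (Reg 15) (Imm 1), Store (Reg 15) b,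
     Bin 15 Add (Reg 15) (Imm 1), Store (Reg 15) c, Bin 15 Add (Reg 15) (Imm 1)]"

definition emit :: "operand \<Rightarrow> com" where
  "emit s = seqs [Store (Reg 16) s, Bin 16 Add (Reg 16) (Imm 1)]"

definition rep_prog :: com where
  "rep_prog = IfThenElse (Eq (Reg 42) (Imm 0)) Skip
     (seqs [emit (Reg 41), Bin 42 Sub (Reg 42) (Imm 1), push (Imm 0) (Reg 41) (Reg 42)])"

text \<open>A literal with variable number \<open>w\<close> has code \<open>2 + 2 * w\<close> or
  \<open>3 + 2 * w\<close>, so halving gives \<open>w + 1\<close> and the parity is the falsifying
  bit. If the variable belongs to the current side and its bit equals the parity, the leaf symbol is
  replaced by the junk symbol, which is the mode itself.\<close>

definition leaf_prog :: com where
  "leaf_prog = seqs [Bin 44 Mul (Reg 41) (Imm 2), Bin 45 Div (Reg 43) (Imm 2), Bin 45 Sub (Reg 45) (Imm 1),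
     Bin 46 Mod (Reg 43) (Imm 2),
     IfThenElse (Less (Reg 45) (Reg 10)) (Move 47 (Imm 1)) (Move 47 (Imm 2)),
     IfThenElse (Eq (Reg 47) (Reg 30))
       (seqs [Bin 48 Add (Reg 36) (Reg 45), Load 48 (Reg 48),
          IfThenElse (Eq (Reg 48) (Reg 46)) (Move 44 (Reg 30)) Skip])
       Skip,
     emit (Reg 44)]"

text \<open>Afterwards registers 48 and 49 hold the addresses of the smaller and the larger child,
  50 the number of conjunctions of the smaller one, 51 its dollar, 52 the pad symbol of the gate and
  53 the successor of register 50.\<close>

definition gate_head :: com where
  "gate_head = seqs [Bin 44 Add (Reg 41) (Imm 1), Bin 45 Add (Reg 44) (Reg 12), Load 46 (Reg 45),
     Bin 45 Add (Reg 44) (Reg 46), Bin 47 Add (Reg 45) (Reg 12), Load 47 (Reg 47),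
     IfThenElse (Less (Reg 47) (Reg 46))
       (seqs [Move 48 (Reg 45), Move 49 (Reg 44)]) (seqs [Move 48 (Reg 44), Move 49 (Reg 45)]),
     Bin 50 Add (Reg 48) (Reg 12), Bin 50 Add (Reg 50) (Reg 12), Load 50 (Reg 50),
     Bin 51 Mul (Reg 48) (Imm 2), Bin 51 Add (Reg 51) (Imm 1), Bin 52 Mul (Reg 41) (Imm 2),
     Bin 53 Add (Reg 50) (Imm 1)]"

text \<open>The order of emission is reversed, as the task pushed last is popped first.\<close>

definition gate_push :: com where
  "gate_push = IfThenElse (Eq (Reg 30) (Imm 1))
     (IfThenElse (Eq (Reg 43) (Imm 0))
       (seqs [push (Imm 1) (Reg 49) (Reg 42), push (Imm 0) (Reg 51) (Reg 50), push (Imm 1) (Reg 48) (Reg 51)])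
       (seqs [push (Imm 0) (Reg 51) (Reg 50), push (Imm 1) (Reg 48) (Reg 51),
          push (Imm 1) (Reg 49) (Reg 42), push (Imm 0) (Reg 52) (Reg 50)]))
     (IfThenElse (Eq (Reg 43) (Imm 0))
       (seqs [push (Imm 1) (Reg 49) (Reg 42), push (Imm 1) (Reg 48) (Reg 51), push (Imm 0) (Reg 42) (Reg 53)])
       (seqs [push (Imm 1) (Reg 49) (Reg 42), push (Imm 0) (Reg 52) (Reg 50),
          push (Imm 1) (Reg 48) (Reg 51), push (Imm 0) (Reg 42) (Reg 50)]))"

definition pop :: com where
  "pop = seqs [Bin 15 Sub (Reg 15) (Imm 1), Load 42 (Reg 15), Bin 15 Sub (Reg 15) (Imm 1), Load 41 (Reg 15),
     Bin 15 Sub (Reg 15) (Imm 1), Load 40 (Reg 15)]"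

definition run_body :: com where
  "run_body = Seq pop (IfThenElse (Eq (Reg 40) (Imm 0)) rep_prog
     (Seq (Load 43 (Reg 41)) (IfThenElse (Less (Imm 1) (Reg 43)) leaf_prog (Seq gate_head gate_push))))"

definition run :: com where
  "run = WhileDo (Less (Reg 14) (Reg 15)) run_body"

section \<open>The stack and the output in memory\<close>

definition pushm :: "(nat \<Rightarrow> nat) \<Rightarrow> nat \<Rightarrow> nat \<Rightarrow> nat \<Rightarrow> nat \<Rightarrow> (nat \<Rightarrow> nat)" where
  "pushm M p a b c = M(p := a, Suc p := b, Suc (Suc p) := c)"

lemma wp_push:
  assumes "a \<noteq> Reg 15" "b \<noteq> Reg 15" "c \<noteq> Reg 15"
  shows "R 15 + 3 < W \<Longrightarrow> opval (R, M) a < W \<Longrightarrow> opval (R, M) b < W \<Longrightarrow> opval (R, M) c < W \<Longrightarrow>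
    wp W (push a b c) Q (R, M) \<longleftrightarrow>
    Q 7 (R(15 := R 15 + 3), pushm M (R 15) (opval (R, M) a) (opval (R, M) b) (opval (R, M) c))"
  using assms by (cases a; cases b; cases c) (simp_all add: push_def pushm_def eval_nat_numeral)

fun stk :: "nat \<Rightarrow> (nat \<Rightarrow> nat) \<Rightarrow> task list \<Rightarrow> bool" where
  "stk S M [] = True"
| "stk S M (t # ts) = (let p = S + 3 * length ts in
     (M p, M (Suc p), M (Suc (Suc p))) = task_words t \<and> stk S M ts)"

definition outp :: "nat \<Rightarrow> (nat \<Rightarrow> nat) \<Rightarrow> nat list \<Rightarrow> bool" where
  "outp B M out \<longleftrightarrow> (\<forall>k<length out. M (B + k) = out ! k)"

lemma stk_cong: "(\<And>p. S \<le> p \<Longrightarrow> p < S + 3 * length ts \<Longrightarrow> M' p = M p) \<Longrightarrow> stk S M' ts = stk S M ts"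
  by (induction ts) (auto simp: Let_def)

lemma stk_push:
  "stk S M ts \<Longrightarrow> task_words t = (a, b, c) \<Longrightarrow> stk S (pushm M (S + 3 * length ts) a b c) (t # ts)"
  using stk_cong[of S ts "pushm M (S + 3 * length ts) a b c" M] by (simp add: pushm_def)

lemma outp_push: "outp B M out \<Longrightarrow> B + length out \<le> p \<Longrightarrow> outp B (pushm M p a b c) out"
  by (auto simp: outp_def pushm_def)

lemma outp_emit: "outp B M out \<Longrightarrow> p = B + length out \<Longrightarrow> outp B (M(p := s)) (out @ [s])"
  by (auto simp: outp_def nth_append less_Suc_eq)

text \<open>Memory layout: the input below \<open>N\<close>, the two node tables up to
  \<open>3 * N\<close>, then the output, and the task stack from \<open>SB\<close> on. All words and
  addresses in use have to stay below \<open>W\<close>.\<close>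

locale ram =
  fixes m n N SB W :: nat and F :: formula and inp :: "nat \<Rightarrow> nat"
  assumes encoded: "\<And>k. k < nodes F \<Longrightarrow> inp (2 + k) = encode_formula m F ! k"
    and leaves: "set (leaf_vars F) \<subseteq> XVar ` {..<m} \<union> YVar ` {..<m}"
    and N_ge: "2 + nodes F \<le> N"
    and inp_less: "\<And>p. p < N \<Longrightarrow> inp p < W"
    and SB_ge: "8 * N \<le> SB" and W_gt: "SB < W"
begin

definition static :: "(nat \<Rightarrow> nat) \<Rightarrow> bool" where
  "static M \<longleftrightarrow> (\<forall>p<N. M p = inp p) \<and>
     (\<forall>i G. (i, G) \<in> occ 2 F \<longrightarrow> M (N + i) = nodes G \<and> M (2 * N + i) = ands G)"

fun ok :: "task \<Rightarrow> bool" where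
  "ok (Rep s c) = (s < 2 * N)"
| "ok (Node i d G) = ((i, G) \<in> occ 2 F \<and> d < 2 * N)"

text \<open>Invariant of the loop between two iterations. \<open>R0\<close> is a snapshot of the
  registers below 40, which the loop leaves alone except for the stack top and the output end; the
  registers from 40 on are free.\<close>

definition cfg :: "(nat \<Rightarrow> nat) \<Rightarrow> (nat \<Rightarrow> nat) \<Rightarrow> (nat \<Rightarrow> nat) \<Rightarrow> nat list \<Rightarrow> task list \<Rightarrow> bool" where
  "cfg R0 R M out ts \<longleftrightarrow> (\<forall>r<40. r \<noteq> 15 \<and> r \<noteq> 16 \<longrightarrow> R r = R0 r) \<and>
     R 15 = SB + 3 * length ts \<and> R 16 = 3 * N + length out \<and>
     static M \<and> outp (3 * N) M out \<and> stk SB M ts \<and> (\<forall>t\<in>set ts. ok t)"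

text \<open>In mode 2 the variables are numbered from \<open>m\<close> on, so the vector starts at
  \<open>va + m\<close>; the code can then add the variable number to \<open>va\<close> in both
  modes.\<close>

definition vec :: "nat \<Rightarrow> nat \<Rightarrow> bool list \<Rightarrow> bool" where
  "vec md va v \<longleftrightarrow> (\<forall>j<m. va + (md - 1) * m + j < N \<and> inp (va + (md - 1) * m + j) = of_bool (v ! j))"

definition params :: "(nat \<Rightarrow> nat) \<Rightarrow> nat \<Rightarrow> bool list \<Rightarrow> bool" where
  "params R0 md v \<longleftrightarrow> R0 10 = m \<and> R0 12 = N \<and> R0 14 = SB \<and> R0 30 = md \<and> (md = 1 \<or> md = 2) \<and>
     vec md (R0 36) v"

lemma occ_less: "(i, G) \<in> occ 2 F \<Longrightarrow> 2 \<le> i \<and> i + nodes G \<le> N \<and> i < N"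
  using occ_bounds[of i G 2 F] N_ge nodes_pos[of G] by linarith

lemma staticD: "static M \<Longrightarrow> (i, G) \<in> occ 2 F \<Longrightarrow> M (N + i) = nodes G \<and> M (2 * N + i) = ands G"
  by (simp add: static_def)

lemma static_upd: "static M \<Longrightarrow> 3 * N \<le> p \<Longrightarrow> static (M(p := s))"
  unfolding static_def by (auto dest: occ_less)

lemma static_push: "static M \<Longrightarrow> 3 * N \<le> p \<Longrightarrow> static (pushm M p a b c)"
  by (simp add: pushm_def static_upd)

lemma stk_emit: "stk SB M ts \<Longrightarrow> p < SB \<Longrightarrow> stk SB (M(p := s)) ts"
  using stk_cong[of SB ts "M(p := s)" M] by simp

lemma cfg_push:
  assumes "cfg R0 R M out ts" "3 * N + length out \<le> SB" "task_words t = (a, b, c)" "ok t"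
  shows "cfg R0 (R(15 := SB + 3 * length ts + 3)) (pushm M (SB + 3 * length ts) a b c) out (t # ts)"
  using assms stk_push[of SB M ts t a b c] outp_push static_push SB_ge by (simp add: cfg_def)

lemma cfg_emit:
  assumes "cfg R0 R M out ts" "3 * N + length out < SB"
  shows "cfg R0 (R(16 := Suc (3 * N + length out))) (M(3 * N + length out := s)) (out @ [s]) ts"
  using assms stk_emit static_upd outp_emit by (simp add: cfg_def)

lemma cfg_scratch:
  assumes "cfg R0 R M out ts" "\<forall>r<40. R' r = R r"
  shows "cfg R0 R' M out ts"
  using assms by (simp add: cfg_def)

lemma ok_words:
  assumes "ok t" "task_words t = (a, b, c)" "SB + pot md v t < W"
  shows "a < W \<and> b < W \<and> c < W"
  using assms W_gt SB_ge by (cases t) (auto dest!: occ_less)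

section \<open>Single operations of the loop body\<close>

lemma pop_correct:
  assumes "cfg R0 R M out (t # ts)" "task_words t = (a, b, c)" "SB + 3 * length (t # ts) < W" "a < W" "b < W" "c < W"
    and Q: "\<And>R'. cfg R0 R' M out ts \<Longrightarrow> R' 40 = a \<Longrightarrow> R' 41 = b \<Longrightarrow> R' 42 = c \<Longrightarrow> Q 7 (R', M)"
  shows "wp W pop Q (R, M)"
proof -
  have sp: "R 15 = SB + 3 * length ts + 3" "M (SB + 3 * length ts) = a" "M (Suc (SB + 3 * length ts)) = b"
    "M (Suc (Suc (SB + 3 * length ts))) = c"
    using assms(1,2) by (auto simp: cfg_def Let_def)
  let ?R = "R(15 := SB + 3 * length ts, 42 := c, 41 := b, 40 := a)"
  have "cfg R0 ?R M out ts" using assms(1) by (auto simp: cfg_def Let_def)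
  hence "Q 7 (?R, M)" using Q by simp
  moreover have "R(15 := SB + 3 * length ts + 2, 42 := c, 15 := Suc (SB + 3 * length ts), 41 := b,
      15 := SB + 3 * length ts, 40 := a) = ?R" by auto
  ultimately show ?thesis using sp assms(3-6)
    by (simp add: pop_def fun_upd_twist eval_nat_numeral)
qed

lemma wp_emit:
  assumes "R 16 + 1 < W" "opval (R, M) s < W"
  shows "wp W (emit s) Q (R, M) \<longleftrightarrow> Q 3 (R(16 := Suc (R 16)), M(R 16 := opval (R, M) s))"
  using assms by (simp add: emit_def eval_nat_numeral)

lemma cfg_regs:
  assumes "cfg R0 R M out ts" "params R0 md v"
  shows "R 10 = m" "R 12 = N" "R 14 = SB" "R 30 = md" "R 36 = R0 36" "R 15 = SB + 3 * length ts"
    "R 16 = 3 * N + length out"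
  using assms by (auto simp: cfg_def params_def)

lemma rep_correct:
  assumes c: "cfg R0 R M out ts" and p: "params R0 md v" and r: "R 41 = s" "R 42 = c" "R 40 = 0"
    and ok: "s < 2 * N" "SB + 3 * length ts + 3 < W" "c < W" "3 * N + length out + c \<le> SB"
  shows "wp W rep_prog (\<lambda>k (R', M'). k \<le> 13 \<and> (if c = 0 then cfg R0 R' M' out ts
    else cfg R0 R' M' (out @ [s]) (Rep s (c - 1) # ts))) (R, M)"
proof (cases "c = 0")
  case True
  with c r show ?thesis by (simp add: rep_prog_def)
next
  case False
  note regs = cfg_regs[OF c p]
  have s: "s < W" using ok(1) SB_ge W_gt by linarith
  let ?R1 = "R(16 := Suc (3 * N + length out))" and ?M1 = "M(3 * N + length out := s)"
  have c1: "cfg R0 ?R1 ?M1 (out @ [s]) ts" using cfg_emit[OF c] False ok(4) by simp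
  have c2: "cfg R0 (?R1(42 := c - 1)) ?M1 (out @ [s]) ts" by (rule cfg_scratch[OF c1]) simp
  have c3: "cfg R0 (?R1(42 := c - 1, 15 := SB + 3 * length ts + 3)) (pushm ?M1 (SB + 3 * length ts) 0 s (c - 1))
      (out @ [s]) (Rep s (c - 1) # ts)"
    by (rule cfg_push[OF c2]) (use ok False in auto)
  show ?thesis
    using False r regs ok s c3 W_gt SB_ge by (simp add: rep_prog_def wp_emit wp_push)
qed

lemma leaf_correct:
  assumes c: "cfg R0 R M out ts" and p: "params R0 md v" and G: "(i, G) \<in> occ 2 F" "G = (if b then Pos w else Neg w)"
    and r: "R 41 = i" "R 43 = hd (encode_formula m G)"
    and ok: "3 * N + length out < SB"
  shows "wp W leaf_prog (\<lambda>k (R', M'). k \<le> 20 \<and> cfg R0 R' M' (out @ gadget_string md v i d G) ts) (R, M)"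
proof -
  note regs = cfg_regs[OF c p]
  have w: "w \<in> XVar ` {..<m} \<union> YVar ` {..<m}"
    using occ_leaf_vars[OF G(1)] G(2) leaves by (auto split: if_splits)
  have i: "i < N" using occ_less[OF G(1)] by simp
  have M: "q < N \<Longrightarrow> M q = inp q" for q using c by (simp add: cfg_def static_def)
  have md: "md = 1 \<or> md = 2" and vec: "vec md (R0 36) v" using p by (auto simp: params_def)
  define sym where "sym = (if md = 1 then leafx v i b w else leafy v i b w)"
  have str: "gadget_string md v i d G = [sym]" using G(2) by (simp add: gadget_string_def sym_def)
  have code: "R 43 = 2 + of_bool (\<not> b) + 2 * var_number m w" using r(2) G(2) by simp
  hence dv: "R 43 div 2 - 1 = var_number m w" "R 43 mod 2 = of_bool (\<not> b)"
    "R 43 div 2 < W" "var_number m w < W"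
  proof -
    show "R 43 div 2 - 1 = var_number m w" "R 43 mod 2 = of_bool (\<not> b)"
      using code by (cases b; simp)+
    have "R 43 = inp i" using occ_code[of F inp 2 m i G] encoded G(1) r(2) by simp
    hence "R 43 < W" using inp_less[OF i] by simp
    thus "R 43 div 2 < W" "var_number m w < W" using code by linarith+
  qed
  have fin: "cfg R0 (R'(16 := Suc (3 * N + length out))) (M(3 * N + length out := c')) (out @ [c']) ts"
    if "\<forall>r<40. R' r = R r" for R' c'
    using cfg_emit[OF cfg_scratch[OF c that] ok] by simp
  have bit: "w = XVar j \<Longrightarrow> md = 1 \<Longrightarrow> R0 36 + j < N \<and> inp (R0 36 + j) = of_bool (v ! j)"
    "w = YVar j \<Longrightarrow> md = 2 \<Longrightarrow> R0 36 + (m + j) < N \<and> inp (R0 36 + (m + j)) = of_bool (v ! j)" for j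
    using vec w by (auto simp: vec_def add.assoc)
  have bd: "i * 2 < W" "0 < W" "Suc 0 < W" "2 < W" "Suc (3 * N + length out) < W" "3 * N + length out < W"
    using SB_ge W_gt i ok by linarith+
  have dv': "R 43 div 2 - Suc 0 = var_number m w" using dv(1) by simp
  note sim = leaf_prog_def wp_emit r(1) regs dv' dv(2-4) bd mult.commute[of 2]
  show ?thesis
  proof (cases w)
    case (XVar j)
    with w have j: "j < m" by auto
    show ?thesis
    proof (cases "md = 1")
      case True
      have M1: "M (R0 36 + j) = of_bool (v ! j)" "R0 36 + j < W"
        using bit(1)[OF XVar True] M[of "R0 36 + j"] SB_ge W_gt by auto
      show ?thesis
        unfolding str sym_def using j True XVar M1 dv(4) by (cases b; cases "v ! j"; simp add: sim; intro fin; simp)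
    next
      case False
      show ?thesis
        unfolding str sym_def using j md False XVar dv(4) by (cases b; simp add: sim; intro fin; simp)
    qed
  next
    case (YVar j)
    with w have j: "j < m" by auto
    show ?thesis
    proof (cases "md = 2")
      case True
      have M1: "M (R0 36 + (m + j)) = of_bool (v ! j)" "R0 36 + (m + j) < W"
        using bit(2)[OF YVar True] M[of "R0 36 + (m + j)"] SB_ge W_gt by auto
      show ?thesis
        unfolding str sym_def using j True YVar M1 dv(4) by (cases b; cases "v ! j"; simp add: sim; intro fin; simp)
    next
      case False
      show ?thesis
        unfolding str sym_def using j md False YVar dv(4) by (cases b; simp add: sim; intro fin; simp)
    qed
  qed
qed

lemma gate_head_correct:
  assumes c: "cfg R0 R M out ts" and p: "params R0 md v" and G: "(i, G) \<in> occ 2 F" "G = Conj F1 F2 \<or> G = Disj F1 F2"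
    and r: "R 41 = i"
    and lh: "(l, L, h, H) = (if nodes F2 < nodes F1 then (Suc (i + nodes F1), F2, Suc i, F1)
      else (Suc i, F1, Suc (i + nodes F1), F2))"
    and Q: "\<And>R' k. \<forall>r<44. R' r = R r \<Longrightarrow> R' 48 = l \<Longrightarrow> R' 49 = h \<Longrightarrow> R' 50 = ands L \<Longrightarrow>
      R' 51 = Suc (2 * l) \<Longrightarrow> R' 52 = 2 * i \<Longrightarrow> R' 53 = Suc (ands L) \<Longrightarrow> k \<le> 19 \<Longrightarrow> Q k (R', M)"
  shows "wp W gate_head Q (R, M)"
proof -
  note regs = cfg_regs[OF c p]
  let ?c = "Suc (i + nodes F1)"
  have sub: "(Suc i, F1) \<in> occ 2 F" "(?c, F2) \<in> occ 2 F"
    using occ_trans[OF G(1)] G(2) by auto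
  have M: "M (N + Suc i) = nodes F1" "M (N + ?c) = nodes F2" "M (N + N + Suc i) = ands F1" "M (N + N + ?c) = ands F2"
  proof -
    have "static M" using c by (simp add: cfg_def)
    from staticD[OF this sub(1)] staticD[OF this sub(2)]
    show "M (N + Suc i) = nodes F1" "M (N + ?c) = nodes F2"
      "M (N + N + Suc i) = ands F1" "M (N + N + ?c) = ands F2" by (simp_all flip: mult_2)
  qed
  have bd: "i < N" "Suc i < N" "?c < N" "nodes F1 < N" "nodes F2 < N"
    using occ_less[OF sub(1)] occ_less[OF sub(2)] by auto
  have an: "ands F1 < N" "ands F2 < N"
    using bd Suc_ands_le[of F1] Suc_ands_le[of F2] Suc_nodes[of F1] Suc_nodes[of F2] by linarith+
  have W: "8 * N < W" using SB_ge W_gt by linarith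
  show ?thesis
  proof (cases "nodes F2 < nodes F1")
    case True
    thus ?thesis using lh W bd an M
      by (simp add: gate_head_def r regs ac_simps) (rule Q; simp add: ac_simps)
  next
    case False
    thus ?thesis using lh W bd an M
      by (simp add: gate_head_def r regs ac_simps) (rule Q; simp add: ac_simps)
  qed
qed

text \<open>Each entry pairs a task with the operands from which it is pushed. Operands other than
  register 15 keep their values under a push, so one symbolic list at a time covers each of the four
  gate patterns.\<close>

lemma pushes_correct:
  assumes "cfg R0 R M out ts"
    and "\<And>t a b c. (t, a, b, c) \<in> set ps \<Longrightarrow> Reg 15 \<notin> {a, b, c} \<and> ok t \<and>
      task_words t = (opval (R, M) a, opval (R, M) b, opval (R, M) c) \<and> opval (R, M) c < W"
    and "SB + 3 * (length ts + length ps) < W" "3 * N + length out \<le> SB"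
  shows "wp W (seqs (map (\<lambda>(t, a, b, c). push a b c) ps)) (\<lambda>k (R', M'). k \<le> 7 * length ps + 1 \<and>
    cfg R0 R' M' out (rev (map fst ps) @ ts)) (R, M)"
  using assms
proof (induction ps arbitrary: R M ts)
  case Nil
  thus ?case by simp
next
  case (Cons q ps)
  obtain t a b c where q: "q = (t, a, b, c)" by (cases q)
  have t: "a \<noteq> Reg 15" "b \<noteq> Reg 15" "c \<noteq> Reg 15" "ok t"
      "task_words t = (opval (R, M) a, opval (R, M) b, opval (R, M) c)" "opval (R, M) c < W"
    using Cons.prems(2)[of t a b c] q by auto
  have lt: "opval (R, M) a < W" "opval (R, M) b < W"
    using t(4,5) SB_ge W_gt N_ge by (cases t; auto dest!: occ_less)+
  have sp: "R 15 = SB + 3 * length ts" using Cons.prems(1) by (simp add: cfg_def)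
  let ?R = "R(15 := R 15 + 3)" and ?M = "pushm M (R 15) (opval (R, M) a) (opval (R, M) b) (opval (R, M) c)"
  have "cfg R0 ?R ?M out (t # ts)"
    unfolding sp by (rule cfg_push[OF Cons.prems(1,4) t(5,4)])
  note cfg' = this
  have same: "opval (?R, ?M) e = opval (R, M) e" if "e \<noteq> Reg 15" for e
    using that by (cases e) auto
  have "wp W (seqs (map (\<lambda>(t, a, b, c). push a b c) ps)) (\<lambda>k (R', M'). k \<le> 7 * length ps + 1 \<and>
    cfg R0 R' M' out (rev (map fst ps) @ t # ts)) (?R, ?M)"
  proof (rule Cons.IH[OF cfg'])
    fix t' a' b' c' assume "(t', a', b', c') \<in> set ps"
    hence "(t', a', b', c') \<in> set (q # ps)" by simp
    from Cons.prems(2)[OF this] show "Reg 15 \<notin> {a', b', c'} \<and> ok t' \<and>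
      task_words t' = (opval (?R, ?M) a', opval (?R, ?M) b', opval (?R, ?M) c') \<and> opval (?R, ?M) c' < W"
      using same[of a'] same[of b'] same[of c'] by auto
  qed (use Cons.prems(3,4) in simp_all)
  moreover have "R 15 + 3 < W" using Cons.prems(3) sp by simp
  ultimately show ?case
    unfolding q list.map seqs.simps wp_Seq split
    by (subst wp_push[OF t(1-3) _ lt t(6)]) (auto elim!: wp_mono)
qed

lemma gate_push_correct:
  assumes c: "cfg R0 R M out ts" and p: "params R0 md v"
    and ok: "(l, L) \<in> occ 2 F" "(h, H) \<in> occ 2 F" "i < N" "d < 2 * N"
    and r: "R 42 = d" "R 43 = (if cj then 0 else 1)" "R 48 = l" "R 49 = h" "R 50 = ands L"
      "R 51 = Suc (2 * l)" "R 52 = 2 * i" "R 53 = Suc (ands L)"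
    and bd: "SB + 3 * length ts + 12 < W" "3 * N + length out \<le> SB"
  shows "wp W gate_push (\<lambda>k (R', M'). k \<le> 31 \<and> cfg R0 R' M' out (gate_tasks md cj i d l L h H @ ts)) (R, M)"
proof -
  note regs = cfg_regs[OF c p]
  have b: "l < N" "h < N" "ands L < N"
    using occ_less[OF ok(1)] occ_less[OF ok(2)] Suc_ands_le[of L] Suc_nodes[of L] by linarith+
  have W: "Suc (2 * l) < W" "d < W" "ands L < W" "Suc (ands L) < W" "2 * i < 2 * N" "Suc (2 * l) < 2 * N"
    using b ok(3,4) SB_ge W_gt by linarith+
  have push: "wp W (seqs (map (\<lambda>(t, a, b, c). push a b c) ps)) (\<lambda>k (R', M'). k \<le> 29 \<and>
      cfg R0 R' M' out (rev (map fst ps) @ ts)) (R, M)"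
    if "\<forall>(t, a, b, c) \<in> set ps. Reg 15 \<notin> {a, b, c} \<and> ok t \<and>
      task_words t = (opval (R, M) a, opval (R, M) b, opval (R, M) c) \<and> opval (R, M) c < W" "length ps \<le> 4" for ps
    by (rule wp_mono[OF pushes_correct[OF c]]) (use that bd in \<open>auto split: prod.splits\<close>)
  \<comment> \<open>The first two lists belong to conjunction and disjunction in mode 1, the others
    to the same in mode 2; each is the reverse of \<open>gate_tasks\<close>.\<close>
  note ps = push[of "[(Node h d H, Imm 1, Reg 49, Reg 42), (Rep (Suc (2 * l)) (ands L), Imm 0, Reg 51, Reg 50),
        (Node l (Suc (2 * l)) L, Imm 1, Reg 48, Reg 51)]"]
    push[of "[(Rep (Suc (2 * l)) (ands L), Imm 0, Reg 51, Reg 50), (Node l (Suc (2 * l)) L, Imm 1, Reg 48, Reg 51),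
        (Node h d H, Imm 1, Reg 49, Reg 42), (Rep (2 * i) (ands L), Imm 0, Reg 52, Reg 50)]"]
    push[of "[(Node h d H, Imm 1, Reg 49, Reg 42), (Node l (Suc (2 * l)) L, Imm 1, Reg 48, Reg 51),
        (Rep d (Suc (ands L)), Imm 0, Reg 42, Reg 53)]"]
    push[of "[(Node h d H, Imm 1, Reg 49, Reg 42), (Rep (2 * i) (ands L), Imm 0, Reg 52, Reg 50),
        (Node l (Suc (2 * l)) L, Imm 1, Reg 48, Reg 51), (Rep d (ands L), Imm 0, Reg 42, Reg 50)]"]
  note ps' = ps[unfolded list.map prod.case One_nat_def]
  have md: "md = 1 \<or> md = 2" using p by (auto simp: params_def)
  show ?thesis
    unfolding gate_push_def wp_If
    apply (cases cj; rule disjE[OF md])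
       apply (simp_all add: gate_tasks_def regs r del: seqs.simps wp_Seq)
       apply (rule wp_mono[OF ps'(1)]; (auto simp: W ok r task_words.simps)[])
      apply (rule wp_mono[OF ps'(3)]; (auto simp: W ok r)[])
     apply (rule wp_mono[OF ps'(2)]; (auto simp: W ok r)[])
    apply (rule wp_mono[OF ps'(4)]; (auto simp: W ok r)[])
    done
qed

section \<open>Potential and running time of the loop\<close>

lemma pot_pos: "0 < pot md v t"
proof (cases t)
  case (Node i d G)
  show ?thesis
    using gadget_string_nonempty[of md v i d G] unfolding Node pot.simps by linarith
qed simp

lemma length_le_pots: "length ts \<le> pots md v ts"
proof (induction ts)
  case (Cons t ts)
  thus ?case using pot_pos[of md v t] by simp
qed simp

text \<open>Written and pending output together never change: an iteration moves symbols from the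
  pending to the written part, splits a gate, or discards an empty repetition. Meanwhile the
  potential drops strictly, in constant time.\<close>

lemma run_body_correct:
  assumes c: "cfg R0 R M out (t # ts)" and p: "params R0 md v"
    and bd: "SB + 3 * pots md v (t # ts) + 12 < W" "3 * N + length out + length (flats md v (t # ts)) < SB"
  shows "wp W run_body (\<lambda>k (R', M'). k \<le> 70 \<and> (\<exists>out' ts'. cfg R0 R' M' out' ts' \<and>
    out' @ flats md v ts' = out @ flats md v (t # ts) \<and> pots md v ts' < pots md v (t # ts))) (R, M)"
    (is "wp W run_body ?Q (R, M)")
proof -
  have len: "length (t # ts) \<le> pots md v (t # ts)" by (rule length_le_pots)
  have okt: "ok t" using c by (simp add: cfg_def)
  obtain a b e where w: "task_words t = (a, b, e)" by (cases "task_words t") auto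
  have lt: "a < W" "b < W" "e < W" using ok_words[OF okt w, of md v] bd(1) by simp_all
  have small: "SB + 3 * length (t # ts) < W" using len bd(1) by linarith
  show ?thesis
    unfolding run_body_def wp_Seq
  proof (rule pop_correct[OF c w small lt])
    fix R' assume c': "cfg R0 R' M out ts" and r: "R' 40 = a" "R' 41 = b" "R' 42 = e"
    show "wp W (IfThenElse (Eq (Reg 40) (Imm 0)) rep_prog
     (Seq (Load 43 (Reg 41)) (IfThenElse (Less (Imm 1) (Reg 43)) leaf_prog (Seq gate_head gate_push))))
      (\<lambda>u. ?Q (7 + u)) (R', M)"
    proof (cases t)
      case (Rep s cn)
      have "wp W rep_prog (\<lambda>k (R', M'). k \<le> 13 \<and> (if cn = 0 then cfg R0 R' M' out ts
        else cfg R0 R' M' (out @ [s]) (Rep s (cn - 1) # ts))) (R', M)"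
        by (rule rep_correct[OF c' p]) (use w r okt Rep bd len lt in auto)
      hence "wp W rep_prog (\<lambda>k. ?Q (8 + k)) (R', M)"
      proof (rule wp_mono, clarify)
        fix k :: nat and R'' M'' assume k: "k \<le> 13" and
          q: "if cn = 0 then cfg R0 R'' M'' out ts else cfg R0 R'' M'' (out @ [s]) (Rep s (cn - 1) # ts)"
        show "8 + k \<le> 70 \<and> (\<exists>out' ts'. cfg R0 R'' M'' out' ts' \<and>
          out' @ flats md v ts' = out @ flats md v (t # ts) \<and> pots md v ts' < pots md v (t # ts))"
        proof (cases cn)
          case 0
          with q k Rep show ?thesis by (intro conjI exI[of _ out] exI[of _ ts]) auto
        next
          case (Suc cn')
          with q k Rep show ?thesis
            by (intro conjI exI[of _ "out @ [s]"] exI[of _ "Rep s cn' # ts"]) auto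
        qed
      qed
      thus ?thesis using r w Rep by simp
    next
      case (Node i d G)
      hence iG: "(i, G) \<in> occ 2 F" "d < 2 * N" and abe: "a = 1" "b = i" "e = d" using okt w by auto
      have iN: "i < N" using occ_less[OF iG(1)] by simp
      have Mi: "M i = hd (encode_formula m G)" "M i < W"
        using c' iN occ_code[of F inp 2 m i G] encoded iG(1) inp_less[of i] by (auto simp: cfg_def static_def)
      have sm: "SB + 3 * length ts + 12 < W" using bd(1) len by simp
      let ?R = "R'(43 := M i)"
      have c2: "cfg R0 ?R M out ts" by (rule cfg_scratch[OF c']) simp
      have r2: "?R 41 = i" "?R 42 = d" "?R 43 = M i" using r abe by auto
      have out_lt: "3 * N + length out < SB" using bd(2) by simp
      show ?thesis
      proof (cases "\<exists>b w. G = (if b then Pos w else Neg w)")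
        case True
        then obtain b' w' where G: "G = (if b' then Pos w' else Neg w')" by blast
        have "wp W leaf_prog (\<lambda>k (R', M'). k \<le> 20 \<and> cfg R0 R' M' (out @ gadget_string md v i d G) ts) (?R, M)"
          by (rule leaf_correct[OF c2 p iG(1) G]) (use r2 Mi out_lt in auto)
        hence "wp W leaf_prog (\<lambda>k. ?Q (10 + k)) (?R, M)"
        proof (rule wp_mono, clarify)
          fix k :: nat and R'' M'' assume "k \<le> 20" "cfg R0 R'' M'' (out @ gadget_string md v i d G) ts"
          thus "10 + k \<le> 70 \<and> (\<exists>out' ts'. cfg R0 R'' M'' out' ts' \<and>
            out' @ flats md v ts' = out @ flats md v (t # ts) \<and> pots md v ts' < pots md v (t # ts))"
            using Node pot_pos[of md v t]
            by (intro conjI exI[of _ "out @ gadget_string md v i d G"] exI[of _ ts]) auto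
        qed
        moreover have "1 < M i" using Mi(1) G by (auto split: if_splits)
        ultimately show ?thesis using r abe Mi(2) iN SB_ge W_gt by simp
      next
        case False
        then obtain F1 F2 cj where G: "G = (if cj then Conj F1 F2 else Disj F1 F2)"
          by (cases G) (metis (full_types))+
        have M43: "M i = (if cj then 0 else 1)" using Mi(1) G by simp
        define lh where "lh = (if nodes F2 < nodes F1 then (Suc (i + nodes F1), F2, Suc i, F1)
          else (Suc i, F1, Suc (i + nodes F1), F2))"
        obtain l L h H where lh': "(l, L, h, H) = lh" by (metis prod_cases4)
        have sub: "(Suc i, F1) \<in> occ 2 F" "(Suc (i + nodes F1), F2) \<in> occ 2 F"
          using occ_trans[OF iG(1)] G by (auto split: if_splits)
        have lhocc: "(l, L) \<in> occ 2 F" "(h, H) \<in> occ 2 F"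
          using lh' sub by (auto simp: lh_def split: if_splits)
        have str: "flats md v (gate_tasks md cj i d l L h H) = flat md v t"
          using flats_gate_tasks[OF lh'[unfolded lh_def]] G Node by simp
        have potlt: "pots md v (gate_tasks md cj i d l L h H) < pot md v t"
          using pots_gate_tasks[of md v cj i d l L h H] Node unfolding str by simp
        have "wp W (Seq gate_head gate_push) (\<lambda>k. ?Q (10 + k)) (?R, M)"
          unfolding wp_Seq
        proof (rule gate_head_correct[OF c2 p iG(1)])
          show "G = Conj F1 F2 \<or> G = Disj F1 F2" using G by simp
          show "?R 41 = i" by (rule r2)
          show "(l, L, h, H) = (if nodes F2 < nodes F1 then (Suc (i + nodes F1), F2, Suc i, F1)
            else (Suc i, F1, Suc (i + nodes F1), F2))" using lh' unfolding lh_def .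
          fix R1 k1 assume R1: "\<forall>r<44. R1 r = ?R r" "R1 48 = l" "R1 49 = h" "R1 50 = ands L"
            "R1 51 = Suc (2 * l)" "R1 52 = 2 * i" "R1 53 = Suc (ands L)" and k1: "k1 \<le> (19::nat)"
          have c3: "cfg R0 R1 M out ts" by (rule cfg_scratch[OF c2]) (use R1(1) in auto)
          have "wp W gate_push (\<lambda>k (R', M'). k \<le> 31 \<and> cfg R0 R' M' out (gate_tasks md cj i d l L h H @ ts)) (R1, M)"
            by (rule gate_push_correct[OF c3 p lhocc iN iG(2)]) (use R1 r2 M43 sm out_lt in auto)
          thus "wp W gate_push (\<lambda>u. ?Q (10 + (k1 + u))) (R1, M)"
          proof (rule wp_mono, clarify)
            fix k :: nat and R'' M'' assume "k \<le> 31" "cfg R0 R'' M'' out (gate_tasks md cj i d l L h H @ ts)"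
            thus "10 + (k1 + k) \<le> 70 \<and> (\<exists>out' ts'. cfg R0 R'' M'' out' ts' \<and>
              out' @ flats md v ts' = out @ flats md v (t # ts) \<and> pots md v ts' < pots md v (t # ts))"
              using k1 str potlt
              by (intro conjI exI[of _ out] exI[of _ "gate_tasks md cj i d l L h H @ ts"]) auto
          qed
        qed
        moreover have "\<not> 1 < M i" using M43 by simp
        ultimately show ?thesis using r abe Mi(2) iN SB_ge W_gt by simp
      qed
    qed
  qed
qed

text \<open>Each unit of potential pays 71 time units: at most 70 for the body and 1 for the
  test.\<close>

lemma run_correct:
  assumes c: "cfg R0 R M out ts" and p: "params R0 md v"
    and bd: "SB + 3 * pots md v ts + 12 < W" "3 * N + length out + length (flats md v ts) < SB"
    and Q: "\<And>k R' M'. k \<le> 71 * pots md v ts + 1 \<Longrightarrow> cfg R0 R' M' (out @ flats md v ts) [] \<Longrightarrow> Q k (R', M')"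
  shows "wp W run Q (R, M)"
proof -
  let ?I = "\<lambda>k (R', M'). \<exists>out' ts'. cfg R0 R' M' out' ts' \<and> out' @ flats md v ts' = out @ flats md v ts \<and>
    k = 71 * pots md v ts' \<and> pots md v ts' \<le> pots md v ts"
  have init: "?I (71 * pots md v ts) (R, M)" using c by auto
  have unpack: "\<exists>R1 M1 out1 ts1. \<sigma> = (R1, M1) \<and> cfg R0 R1 M1 out1 ts1 \<and>
      out1 @ flats md v ts1 = out @ flats md v ts \<and> k = 71 * pots md v ts1 \<and> pots md v ts1 \<le> pots md v ts"
    if "?I k \<sigma>" for k \<sigma>
    using that by (cases \<sigma>) auto
  show ?thesis
    unfolding run_def
  proof (rule wp_While[of ?I, OF init])
    fix k \<sigma> assume Ik: "?I k \<sigma>" and run: "testval \<sigma> (Less (Reg 14) (Reg 15))"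
    from unpack[OF Ik] obtain R1 M1 out1 ts1 where I: "\<sigma> = (R1, M1)" "cfg R0 R1 M1 out1 ts1"
      "out1 @ flats md v ts1 = out @ flats md v ts" "k = 71 * pots md v ts1" "pots md v ts1 \<le> pots md v ts"
      by blast
    have "ts1 \<noteq> []" using run cfg_regs[OF I(2) p] I(1) by auto
    then obtain t ts2 where ts1: "ts1 = t # ts2" by (cases ts1) auto
    have l: "length out1 + length (flats md v ts1) = length out + length (flats md v ts)"
      using arg_cong[OF I(3), of length] by simp
    let ?B = "\<lambda>q (R', M'). q \<le> 70 \<and> (\<exists>out' ts'. cfg R0 R' M' out' ts' \<and>
      out' @ flats md v ts' = out1 @ flats md v (t # ts2) \<and> pots md v ts' < pots md v (t # ts2))"
    have body: "wp W run_body ?B \<sigma>"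
      using I(2,5) bd l unfolding ts1 I(1) by (intro run_body_correct[OF _ p]) linarith+
    have post: "\<exists>k'. Suc q + k' \<le> k \<and> ?I k' \<tau>" if "?B q \<tau>" for q \<tau>
    proof -
      from that obtain R' M' out' ts' where \<tau>: "\<tau> = (R', M')" and q: "q \<le> 70" and c': "cfg R0 R' M' out' ts'"
        and f: "out' @ flats md v ts' = out1 @ flats md v (t # ts2)" "pots md v ts' < pots md v (t # ts2)"
        by (cases \<tau>) auto
      show ?thesis
        unfolding \<tau> prod.case
      proof (intro exI[of _ "71 * pots md v ts'"] exI[of _ out'] exI[of _ ts'] conjI)
        show "71 * pots md v ts' = 71 * pots md v ts'" ..
        show "cfg R0 R' M' out' ts'" by (rule c')
        show "out' @ flats md v ts' = out @ flats md v ts" using f(1) I(3) ts1 by simp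
        show "pots md v ts' \<le> pots md v ts" using f(2) I(5) unfolding ts1 by linarith
        show "Suc q + 71 * pots md v ts' \<le> k" using f(2) q unfolding I(4) ts1 by linarith
      qed
    qed
    show "wp W run_body (\<lambda>t \<tau>. \<exists>k'. Suc t + k' \<le> k \<and> ?I k' \<tau>) \<sigma>"
      by (rule wp_mono[OF body post])
  next
    fix k t \<sigma> assume Ik: "?I k \<sigma>" and nt: "\<not> testval \<sigma> (Less (Reg 14) (Reg 15))"
      and t: "t \<le> Suc (71 * pots md v ts)"
    from unpack[OF Ik] obtain R1 M1 out1 ts1 where I: "\<sigma> = (R1, M1)" "cfg R0 R1 M1 out1 ts1"
      "out1 @ flats md v ts1 = out @ flats md v ts"
      by blast
    have "ts1 = []" using nt cfg_regs[OF I(2) p] I(1) by auto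
    hence "cfg R0 R1 M1 (out @ flats md v ts) []" using I(2,3) by simp
    thus "Q t \<sigma>" using Q t I(1) by simp
  qed
qed

end

section \<open>Preprocessing and repeated emission\<close>

text \<open>In prefix order children have larger addresses than their parent, so a scan from the
  last node down finds their table entries complete. A conjunction has code 0 and a disjunction code
  1, hence \<open>1 - code\<close> is the contribution of a gate to the number of
  conjunctions.\<close>

definition pass_body :: com where
  "pass_body = seqs [Load 21 (Reg 20),
     IfThenElse (Less (Imm 1) (Reg 21)) (seqs [Move 22 (Imm 1), Move 23 (Imm 0)])
       (seqs [Bin 24 Add (Reg 20) (Imm 1), Bin 25 Add (Reg 24) (Reg 12), Load 22 (Reg 25),
          Bin 26 Add (Reg 24) (Reg 22), Bin 25 Add (Reg 25) (Reg 12), Load 23 (Reg 25),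
          Bin 25 Add (Reg 26) (Reg 12), Load 27 (Reg 25), Bin 25 Add (Reg 25) (Reg 12), Load 28 (Reg 25),
          Bin 22 Add (Reg 22) (Reg 27), Bin 22 Add (Reg 22) (Imm 1), Bin 23 Add (Reg 23) (Reg 28),
          Bin 24 Sub (Imm 1) (Reg 21), Bin 23 Add (Reg 23) (Reg 24)]),
     Bin 25 Add (Reg 20) (Reg 12), Store (Reg 25) (Reg 22),
     Bin 25 Add (Reg 25) (Reg 12), Store (Reg 25) (Reg 23), Bin 20 Sub (Reg 20) (Imm 1)]"

definition pass :: com where
  "pass = WhileDo (Less (Imm 1) (Reg 20)) pass_body"

definition zeros :: com where
  "zeros = Seq (push (Imm 0) (Imm 0) (Reg 34)) run"

text \<open>Pushed in reverse: the gadget comes out first, then the closing dollars 5 and the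
  separator zeros.\<close>

definition gen_body :: com where
  "gen_body = seqs [Bin 36 Mod (Reg 35) (Reg 11), Bin 36 Mul (Reg 36) (Reg 10), Bin 36 Add (Reg 36) (Reg 31),
     push (Imm 0) (Imm 0) (Reg 37), push (Imm 0) (Imm 5) (Reg 33), push (Imm 1) (Imm 2) (Imm 5), run,
     Bin 35 Add (Reg 35) (Imm 1)]"

text \<open>Register 31 holds the address of the first vector (shifted down by \<open>m\<close> in mode 2, where
  the variables have numbers from \<open>m\<close> on), 32 the number of blocks, 33 and 34 the numbers of
  closing dollars and of outer zeros, 37 the length of the separators.\<close>

definition gen :: com where
  "gen = seqs [Move 15 (Reg 14), Move 36 (Reg 31), zeros, Move 35 (Imm 0),
     WhileDo (Less (Reg 35) (Reg 32)) gen_body, Move 36 (Reg 31), zeros]"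

section \<open>Correctness of preprocessing and of repeated emission\<close>

context ram
begin

definition pass_inv :: "(nat \<Rightarrow> nat) \<Rightarrow> nat \<Rightarrow> (nat \<Rightarrow> nat) \<Rightarrow> (nat \<Rightarrow> nat) \<Rightarrow> bool" where
  "pass_inv R0 i R M \<longleftrightarrow> (\<forall>r<20. R r = R0 r) \<and> R 20 = i \<and> i < 2 + nodes F \<and> (\<forall>p<N. M p = inp p) \<and>
     (\<forall>j G. (j, G) \<in> occ 2 F \<longrightarrow> i < j \<longrightarrow> M (N + j) = nodes G \<and> M (2 * N + j) = ands G)"

lemma pass_body_correct:
  assumes inv: "pass_inv R0 i R M" and R0: "R0 12 = N" and i: "1 < i"
  shows "wp W pass_body (\<lambda>k (R', M'). k \<le> 26 \<and> pass_inv R0 (i - 1) R' M') (R, M)"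
proof -
  from inv have R: "R 12 = N" "R 20 = i" and iF: "i < 2 + nodes F" and Mi: "M i = inp i"
    and later: "\<And>j G. (j, G) \<in> occ 2 F \<Longrightarrow> i < j \<Longrightarrow> M (N + j) = nodes G \<and> M (N + N + j) = ands G"
    using R0 N_ge by (auto simp: pass_inv_def mult_2)
  \<comment> \<open>The table entries of the children, named before the kind of the node is known;
    at a leaf these values carry no meaning.\<close>
  define l1 where "l1 = M (N + Suc i)"
  define l2 where "l2 = M (N + Suc (i + l1))"
  define a1 where "a1 = M (N + N + Suc i)"
  define a2 where "a2 = M (N + N + Suc (i + l1))"
  define len where "len = (if 1 < inp i then 1 else Suc (l1 + l2))"
  define an where "an = (if 1 < inp i then 0 else a1 + a2 + (1 - inp i))"
  have val: "nodes G = len \<and> ands G = an \<and> (\<not> 1 < inp i \<longrightarrow> Suc (i + l1) < N)" if G: "(i, G) \<in> occ 2 F" for G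
  proof -
    have hd: "inp i = hd (encode_formula m G)" using occ_code[of F inp 2 m i G] encoded G by simp
    consider (leaf) w where "G = Pos w \<or> G = Neg w" | (gate) F1 F2 where "G = Conj F1 F2 \<or> G = Disj F1 F2"
      by (cases G) auto
    then show ?thesis
    proof cases
      case leaf
      thus ?thesis using hd by (auto simp: len_def an_def)
    next
      case gate
      have sub: "(Suc i, F1) \<in> occ 2 F" "(Suc (i + nodes F1), F2) \<in> occ 2 F"
        using occ_trans[OF G] gate by auto
      have v: "l1 = nodes F1" "a1 = ands F1" "l2 = nodes F2" "a2 = ands F2"
        using later[OF sub(1)] later[OF sub(2)] by (simp_all add: l1_def a1_def l2_def a2_def)
      show ?thesis using hd gate v occ_less[OF sub(2)] by (auto simp: len_def an_def)
    qed
  qed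
  obtain G where G: "(i, G) \<in> occ 2 F" using occ_exists[of 2 i F] i iF by auto
  have W: "8 * N < W" using SB_ge W_gt by linarith
  have iN: "i < N" using occ_less[OF G] by simp
  have lt: "len < N" "an < N" "\<not> 1 < inp i \<Longrightarrow> Suc (i + l1) < N"
    using val[OF G] occ_less[OF G] i Suc_ands_le[of G] Suc_nodes[of G] by auto
  have lt': "l1 < N" "l2 < N" "a1 < N" "a2 < N" "a1 + a2 < N" "l1 + l2 < N" if "\<not> 1 < inp i"
    using lt that by (auto simp: len_def an_def)
  have fin: "pass_inv R0 (i - 1) R' (M(N + i := len, N + N + i := an))"
    if "\<forall>r<20. R' r = R r" "R' 20 = i - 1" for R'
  proof -
    have "(\<forall>p<N. (M(N + i := len, N + N + i := an)) p = inp p)" using inv by (auto simp: pass_inv_def)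
    moreover have "(M(N + i := len, N + N + i := an)) (N + j) = nodes G' \<and>
        (M(N + i := len, N + N + i := an)) (2 * N + j) = ands G'"
      if "(j, G') \<in> occ 2 F" "i - 1 < j" for j G'
    proof (cases "j = i")
      case True
      thus ?thesis using val[of G'] that(1) iN by (auto simp: mult_2)
    next
      case False
      hence "i < j" using that(2) by linarith
      thus ?thesis using later[OF that(1)] occ_less[OF that(1)] iN by (auto simp: mult_2)
    qed
    moreover have "\<forall>r<20. R' r = R0 r" using that(1) inv by (simp add: pass_inv_def)
    ultimately show ?thesis using that(2) iF unfolding pass_inv_def by auto
  qed
  show ?thesis
  proof (cases "1 < inp i")
    case True
    hence la: "len = 1" "an = 0" by (simp_all add: len_def an_def)
    have "inp i < W" using inp_less[OF iN] .
    with True W iN N_ge show ?thesis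
      using fin unfolding la
      by (simp add: pass_body_def R Mi ac_simps)
  next
    case False
    hence la: "len = Suc (l1 + l2)" "an = a1 + a2 + (1 - inp i)" by (simp_all add: len_def an_def)
    have l: "M (N + Suc i) = l1" "M (N + Suc (i + l1)) = l2" "M (N + N + Suc i) = a1" "M (N + N + Suc (i + l1)) = a2"
      by (simp_all add: l1_def l2_def a1_def a2_def)
    have "i - Suc 0 < W" "Suc 0 - inp i < W" using W iN by linarith+
    thus ?thesis
      using False W iN N_ge lt lt' Mi l inp_less[OF iN] fin[unfolded la] unfolding la
      by (simp add: pass_body_def R ac_simps)
  qed
qed

text \<open>A node costs 27, which is 26 for the body and 1 for the test. The scan may stop at 1
  because node addresses start at 2.\<close>

lemma pass_correct:
  assumes "pass_inv R0 i R M" "R0 12 = N" "1 \<le> i"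
    and Q: "\<And>k R' M'. k \<le> 27 * i + 1 \<Longrightarrow> \<forall>r<20. R' r = R0 r \<Longrightarrow> static M' \<Longrightarrow> Q k (R', M')"
  shows "wp W pass Q (R, M)"
proof -
  let ?I = "\<lambda>k (R', M'). \<exists>j\<le>i. 1 \<le> j \<and> k = 27 * j \<and> pass_inv R0 j R' M'"
  have init: "?I (27 * i) (R, M)" using assms by auto
  show ?thesis
    unfolding pass_def
  proof (rule wp_While[of ?I, OF init])
    fix k \<sigma> assume Ik: "?I k \<sigma>" and t: "testval \<sigma> (Less (Imm 1) (Reg 20))"
    obtain R1 M1 where \<sigma>: "\<sigma> = (R1, M1)" by (cases \<sigma>)
    from Ik \<sigma> obtain j where j: "j \<le> i" "1 \<le> j" "k = 27 * j" "pass_inv R0 j R1 M1" by auto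
    have "1 < j" using t \<sigma> j(4) by (simp add: pass_inv_def)
    have "\<exists>k'. Suc q + k' \<le> k \<and> ?I k' \<tau>" if "case \<tau> of (R', M') \<Rightarrow> q \<le> 26 \<and> pass_inv R0 (j - 1) R' M'" for q \<tau>
      using that j \<open>1 < j\<close> by (intro exI[of _ "27 * (j - 1)"]) auto
    with pass_body_correct[OF j(4) assms(2) \<open>1 < j\<close>]
    show "wp W pass_body (\<lambda>t \<tau>. \<exists>k'. Suc t + k' \<le> k \<and> ?I k' \<tau>) \<sigma>"
      unfolding \<sigma> by (rule wp_mono)
  next
    fix k t \<sigma> assume Ik: "?I k \<sigma>" and nt: "\<not> testval \<sigma> (Less (Imm 1) (Reg 20))" and t: "t \<le> Suc (27 * i)"
    obtain R1 M1 where \<sigma>: "\<sigma> = (R1, M1)" by (cases \<sigma>)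
    from Ik \<sigma> obtain j where j: "1 \<le> j" "pass_inv R0 j R1 M1" by auto
    hence "j = 1" using nt \<sigma> by (simp add: pass_inv_def)
    hence "static M1" using j(2) occ_less by (fastforce simp: pass_inv_def static_def)
    moreover have "\<forall>r<20. R1 r = R0 r" using j(2) by (simp add: pass_inv_def)
    ultimately show "Q t \<sigma>" using Q t \<sigma> by simp
  qed
qed

text \<open>Renews the snapshot after registers below 40 were changed on purpose, as happens between
  two runs of the loop.\<close>

lemma cfg_new:
  "cfg R0 R M out ts \<Longrightarrow> R' 15 = R 15 \<Longrightarrow> R' 16 = R 16 \<Longrightarrow> cfg R' R' M out ts"
  by (simp add: cfg_def)

lemma push_correct:
  assumes c: "cfg R0 R M out ts" and ne: "a \<noteq> Reg 15" "b \<noteq> Reg 15" "e \<noteq> Reg 15"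
    and t: "ok t" "task_words t = (opval (R, M) a, opval (R, M) b, opval (R, M) e)" "opval (R, M) e < W"
    and bd: "SB + 3 * length ts + 3 < W" "3 * N + length out \<le> SB"
    and Q: "\<And>R' M'. cfg R0 R' M' out (t # ts) \<Longrightarrow> \<forall>r. r \<noteq> 15 \<longrightarrow> R' r = R r \<Longrightarrow> Q 7 (R', M')"
  shows "wp W (push a b e) Q (R, M)"
proof -
  have lt: "opval (R, M) a < W" "opval (R, M) b < W"
    using t SB_ge W_gt N_ge by (cases t; auto dest!: occ_less)+
  have sp: "R 15 = SB + 3 * length ts" using c by (simp add: cfg_def)
  hence "R 15 + 3 < W" using bd by simp
  thus ?thesis
    using Q cfg_push[OF c bd(2) t(2,1)] by (subst wp_push[OF ne _ lt t(3)]) (auto simp: sp)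
qed

lemma zeros_correct:
  assumes c: "cfg R0 R M out []" and p: "params R0 md v" and Z: "R 34 = Z"
    and bd: "20 * SB + 100 < W" "3 * N + length out + Z < SB"
    and Q: "\<And>k R' M'. k \<le> 71 * Z + 80 \<Longrightarrow> cfg R0 R' M' (out @ replicate Z 0) [] \<Longrightarrow> Q k (R', M')"
  shows "wp W zeros Q (R, M)"
  unfolding zeros_def wp_Seq
proof (rule push_correct[OF c, where t = "Rep 0 Z"])
  fix R' M' assume c': "cfg R0 R' M' out [Rep 0 Z]"
  show "wp W run (\<lambda>u. Q (7 + u)) (R', M')"
    by (rule run_correct[OF c' p]) (use bd Q in auto)
qed (use Z bd N_ge in auto)

definition block :: "nat \<Rightarrow> bool list \<Rightarrow> nat \<Rightarrow> nat list" where
  "block md v cnt = gadget_string md v 2 5 F @ replicate cnt 5 @ replicate (ands F) 0"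

lemma gen_body_correct:
  assumes c: "cfg R R M out []" and regs: "R 10 = m" "R 11 = n" "R 12 = N" "R 14 = SB" "R 30 = md" "R 31 = base"
      "R 33 = cnt" "R 37 = ands F" "R 35 = q" "md = 1 \<or> md = 2"
    and v: "vec md (base + q mod n * m) v"
    and bd: "20 * SB + 100 < W" "3 * N + length out + length (block md v cnt) < SB"
    and small: "base + q mod n * m < W" "Suc q < W" "q mod n < W"
    and Q: "\<And>k R' M'. k \<le> 320 * length (block md v cnt) \<Longrightarrow> cfg R' R' M' (out @ block md v cnt) [] \<Longrightarrow>
      (\<forall>r<40. r \<notin> {15, 16, 35, 36} \<longrightarrow> R' r = R r) \<Longrightarrow> R' 35 = Suc q \<Longrightarrow> Q k (R', M')"
  shows "wp W gen_body Q (R, M)"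
proof -
  let ?R = "R(36 := q mod n * m + base)" and ?Q = "\<lambda>k. Q (Suc (Suc (Suc k)))"
  let ?len = "length (gadget_string md v 2 5 F)"
  have c0: "cfg ?R ?R M out []" by (rule cfg_new[OF c]) auto
  have p: "params ?R md v" using regs v by (auto simp: params_def add.commute)
  have len: "0 < ?len" by (rule gadget_string_nonempty)
  have bl: "length (block md v cnt) = ?len + cnt + ands F" by (simp add: block_def)
  have W: "ands F < W" "cnt < W" "5 < W" "5 < 2 * N" "q mod n * m < W"
    using bd bl SB_ge W_gt N_ge small(1) nodes_pos[of F] by linarith+
  have "wp W (seqs [push (Imm 0) (Imm 0) (Reg 37), push (Imm 0) (Imm 5) (Reg 33), push (Imm 1) (Imm 2) (Imm 5), run,
     Bin 35 Add (Reg 35) (Imm 1)]) ?Q (?R, M)"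
    unfolding seqs.simps wp_Seq
  proof (rule push_correct[OF c0, where t = "Rep 0 (ands F)"])
    fix R1 M1 assume c1: "cfg ?R R1 M1 out [Rep 0 (ands F)]" and r1: "\<forall>r. r \<noteq> 15 \<longrightarrow> R1 r = ?R r"
    show "wp W (push (Imm 0) (Imm 5) (Reg 33)) (\<lambda>t. wp W (push (Imm 1) (Imm 2) (Imm 5)) (\<lambda>ta. wp W run
      (\<lambda>tb. wp W (Bin 35 Add (Reg 35) (Imm 1)) (\<lambda>tc. wp W Skip (\<lambda>u. ?Q ((7 + (t + (ta + (tb + (tc + u)))))))))) ) (R1, M1)"
    proof (rule push_correct[OF c1, where t = "Rep 5 cnt"])
      fix R2 M2 assume c2: "cfg ?R R2 M2 out [Rep 5 cnt, Rep 0 (ands F)]" and r2: "\<forall>r. r \<noteq> 15 \<longrightarrow> R2 r = R1 r"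
      show "wp W (push (Imm 1) (Imm 2) (Imm 5)) (\<lambda>ta. wp W run
        (\<lambda>tb. wp W (Bin 35 Add (Reg 35) (Imm 1)) (\<lambda>tc. wp W Skip (\<lambda>u. ?Q ((7 + (7 + (ta + (tb + (tc + u))))))))) ) (R2, M2)"
      proof (rule push_correct[OF c2, where t = "Node 2 5 F"])
        fix R3 M3 assume c3: "cfg ?R R3 M3 out [Node 2 5 F, Rep 5 cnt, Rep 0 (ands F)]"
        show "wp W run (\<lambda>tb. wp W (Bin 35 Add (Reg 35) (Imm 1)) (\<lambda>tc. wp W Skip
          (\<lambda>u. ?Q ((7 + (7 + (7 + (tb + (tc + u))))))))) (R3, M3)"
        proof (rule run_correct[OF c3 p])
          let ?ts = "[Node 2 5 F, Rep 5 cnt, Rep 0 (ands F)]"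
          have fl: "flats md v ?ts = block md v cnt" by (simp add: block_def)
          have pt: "pots md v ?ts \<le> 4 * length (block md v cnt)"
            unfolding bl using len by (simp del: gadget_string_nonempty length_greater_0_conv)
          show "SB + 3 * pots md v ?ts + 12 < W" using pt bd by linarith
          show "3 * N + length out + length (flats md v ?ts) < SB" unfolding fl by (rule bd(2))
          fix k R4 M4 assume k: "k \<le> 71 * pots md v ?ts + 1" and "cfg ?R R4 M4 (out @ flats md v ?ts) []"
          hence c4: "cfg ?R R4 M4 (out @ block md v cnt) []" unfolding fl by simp
          have r4: "R4 r = ?R r" if "r < 40" "r \<noteq> 15" "r \<noteq> 16" for r
            using c4 that by (simp add: cfg_def)
          \<comment> \<open>The 284 is 71 times the factor 4 that bounds the potential; the constant
            overhead fits in because a block is never empty.\<close>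
          have "k \<le> 284 * length (block md v cnt) + 1" using k pt by linarith
          hence "3 + (7 + (7 + (7 + (k + (1 + 1))))) \<le> 320 * length (block md v cnt)"
            using len bl by linarith
          moreover have "cfg (R4(35 := Suc q)) (R4(35 := Suc q)) M4 (out @ block md v cnt) []"
            by (rule cfg_new[OF c4]) auto
          ultimately show "wp W (Bin 35 Add (Reg 35) (Imm 1)) (\<lambda>tc. wp W Skip
            (\<lambda>u. ?Q ((7 + (7 + (7 + (k + (tc + u)))))))) (R4, M4)"
            using small r4[of 35] regs Q r4 by simp
        qed
      qed (use W bd in auto)
    qed (use W bd r1 regs in auto)
  qed (use W bd N_ge regs in auto)
  thus ?thesis
    using small regs W by (simp add: gen_body_def add.commute[of base])
qed

text \<open>The loop over the blocks holds 321 time units per symbol still to be emitted: 320 for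
  the body and one for the test, since every block is nonempty. The additive constant covers the
  overhead of the two runs of outer zeros and of the setup.\<close>

lemma gen_correct:
  fixes v :: "nat \<Rightarrow> bool list" and md cnt Z lm :: nat
  defines "body \<equiv> \<lambda>l. concat (map (\<lambda>q. block md (v (q mod n)) cnt) [0..<l])"
  defines "A \<equiv> replicate Z 0 @ body lm @ replicate Z 0"
  assumes M: "static M" "outp (3 * N) M out" "R 16 = 3 * N + length out"
    and regs: "R 10 = m" "R 11 = n" "R 12 = N" "R 14 = SB" "R 30 = md" "R 31 = base" "R 32 = lm"
      "R 33 = cnt" "R 34 = Z" "R 37 = ands F" "md = 1 \<or> md = 2"
    and v: "0 < n" "\<And>q. q < n \<Longrightarrow> vec md (base + q * m) (v q)" "\<And>q. q < n \<Longrightarrow> base + q * m < W"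
    and bd: "20 * SB + 100 < W" "3 * N + length out + length A < SB" "lm < W" "n < W"
    and Q: "\<And>k R' M'. k \<le> 321 * length A + 180 \<Longrightarrow> static M' \<Longrightarrow> outp (3 * N) M' (out @ A) \<Longrightarrow>
      R' 16 = 3 * N + length (out @ A) \<Longrightarrow> (\<forall>r<40. r \<notin> {15, 16, 35, 36} \<longrightarrow> R' r = R r) \<Longrightarrow> Q k (R', M')"
  shows "wp W gen Q (R, M)"
proof -
  let ?R1 = "R(15 := SB, 36 := base)"
  let ?out1 = "out @ replicate Z 0"
  have c1: "cfg ?R1 ?R1 M out []" using M by (simp add: cfg_def)
  have p1: "params ?R1 md (v 0)" using regs v(2)[OF v(1)] by (auto simp: params_def)
  have lA: "length A = Z + length (body lm) + Z" by (simp add: A_def)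
  let ?I = "\<lambda>k (R', M'). \<exists>q\<le>lm. k = 321 * (length (body lm) - length (body q)) \<and>
    cfg R' R' M' (?out1 @ body q) [] \<and> (\<forall>r<40. r \<notin> {15, 16, 35, 36} \<longrightarrow> R' r = R r) \<and> R' 35 = q"
  have body_Suc: "body (Suc q) = body q @ block md (v (q mod n)) cnt" for q
    by (simp add: body_def)
  have body_mono: "length (body q) \<le> length (body q')" if "q \<le> q'" for q q'
    using that by (induction rule: dec_induct) (auto simp: body_Suc)
  have loop: "wp W (WhileDo (Less (Reg 35) (Reg 32)) gen_body) Q' (R', M')"
    if init: "?I (321 * length (body lm)) (R', M')"
      and Q': "\<And>k R' M'. k \<le> 321 * length (body lm) + 1 \<Longrightarrow> cfg R' R' M' (?out1 @ body lm) [] \<Longrightarrow>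
        (\<forall>r<40. r \<notin> {15, 16, 35, 36} \<longrightarrow> R' r = R r) \<Longrightarrow> Q' k (R', M')" for Q' R' M'
  proof (rule wp_While[of ?I, OF init])
    fix k \<sigma> assume Ik: "?I k \<sigma>" and t: "testval \<sigma> (Less (Reg 35) (Reg 32))"
    obtain R2 M2 where \<sigma>: "\<sigma> = (R2, M2)" by (cases \<sigma>)
    from Ik \<sigma> obtain q where q: "q \<le> lm" "k = 321 * (length (body lm) - length (body q))"
      "cfg R2 R2 M2 (?out1 @ body q) []" "\<forall>r<40. r \<notin> {15, 16, 35, 36} \<longrightarrow> R2 r = R r" "R2 35 = q" by auto
    have "q < lm" using t \<sigma> q(4,5) regs by simp
    hence le: "length (body q) + length (block md (v (q mod n)) cnt) \<le> length (body lm)"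
      using body_mono[of "Suc q" lm] by (simp add: body_Suc)
    have qn: "q mod n < n" using v(1) by simp
    have bpos: "0 < length (block md (v (q mod n)) cnt)"
      using gadget_string_nonempty[of md "v (q mod n)" 2 5 F] unfolding block_def length_append by linarith
    show "wp W gen_body (\<lambda>t \<tau>. \<exists>k'. Suc t + k' \<le> k \<and> ?I k' \<tau>) \<sigma>"
      unfolding \<sigma>
    proof (rule gen_body_correct[OF q(3), where md = md and q = q and base = base and cnt = cnt and v = "v (q mod n)"])
      fix k1 R3 M3 assume k1: "k1 \<le> 320 * length (block md (v (q mod n)) cnt)"
        and c3: "cfg R3 R3 M3 ((?out1 @ body q) @ block md (v (q mod n)) cnt) []"
        and r3: "\<forall>r<40. r \<notin> {15, 16, 35, 36} \<longrightarrow> R3 r = R2 r" "R3 35 = Suc q"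
      have "cfg R3 R3 M3 (?out1 @ body (Suc q)) []" using c3 by (simp add: body_Suc)
      hence "?I (321 * (length (body lm) - length (body (Suc q)))) (R3, M3)"
        unfolding prod.case using \<open>q < lm\<close> r3 q(4) by (intro exI[of _ "Suc q"]) auto
      moreover have "Suc k1 + 321 * (length (body lm) - length (body (Suc q))) \<le> k"
        using k1 le bpos unfolding q(2) body_Suc length_append by linarith
      ultimately show "\<exists>k'. Suc k1 + k' \<le> k \<and> ?I k' (R3, M3)" by blast
    qed (use q regs v qn bd le lA \<open>q < lm\<close> in auto)
  next
    fix k t \<sigma> assume Ik: "?I k \<sigma>" and nt: "\<not> testval \<sigma> (Less (Reg 35) (Reg 32))" and t: "t \<le> Suc (321 * length (body lm))"
    obtain R2 M2 where \<sigma>: "\<sigma> = (R2, M2)" by (cases \<sigma>)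
    from Ik \<sigma> obtain q where q: "q \<le> lm"
      "cfg R2 R2 M2 (?out1 @ body q) []" "\<forall>r<40. r \<notin> {15, 16, 35, 36} \<longrightarrow> R2 r = R r" "R2 35 = q" by auto
    have "q = lm" using nt \<sigma> q regs by simp
    thus "Q' t \<sigma>" using Q' t q \<sigma> by simp
  qed
  have z: "wp W zeros (\<lambda>t. wp W (Move 35 (Imm 0)) (\<lambda>ta. wp W (WhileDo (Less (Reg 35) (Reg 32)) gen_body)
    (\<lambda>tb. wp W (Move 36 (Reg 31)) (\<lambda>tc. wp W zeros (\<lambda>td. Q (Suc (Suc (t + (ta + (tb + (tc + (td + 1)))))))))))) (?R1, M)"
  proof (rule zeros_correct[OF c1 p1])
    fix k1 R2 M2 assume k1: "k1 \<le> 71 * Z + 80" and c2: "cfg ?R1 R2 M2 ?out1 []"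
    have r2: "\<forall>r<40. r \<notin> {15, 16, 36} \<longrightarrow> R2 r = R r" "R2 36 = base"
      using c2 by (auto simp: cfg_def)
    let ?R3 = "R2(35 := 0)"
    have c3: "cfg ?R3 ?R3 M2 ?out1 []" by (rule cfg_new[OF c2]) auto
    have "wp W (WhileDo (Less (Reg 35) (Reg 32)) gen_body)
      (\<lambda>tb. wp W (Move 36 (Reg 31)) (\<lambda>tc. wp W zeros (\<lambda>td. Q (Suc (Suc (k1 + (1 + (tb + (tc + (td + 1)))))))))) (?R3, M2)"
    proof (rule loop)
      show "case (?R3, M2) of (R', M') \<Rightarrow> \<exists>q\<le>lm. 321 * length (body lm) = 321 * (length (body lm) - length (body q)) \<and>
        cfg R' R' M' (?out1 @ body q) [] \<and> (\<forall>r<40. r \<notin> {15, 16, 35, 36} \<longrightarrow> R' r = R r) \<and> R' 35 = q"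
        unfolding prod.case using c3 r2 by (intro exI[of _ 0]) (auto simp: body_def)
      fix k2 R4 M4 assume k2: "k2 \<le> 321 * length (body lm) + 1" and c4: "cfg R4 R4 M4 (?out1 @ body lm) []"
        and r4: "\<forall>r<40. r \<notin> {15, 16, 35, 36} \<longrightarrow> R4 r = R r"
      let ?R5 = "R4(36 := base)"
      have c5: "cfg ?R5 ?R5 M4 (?out1 @ body lm) []" by (rule cfg_new[OF c4]) auto
      have p5: "params ?R5 md (v 0)" using regs r4 v(2)[OF v(1)] by (auto simp: params_def)
      have "wp W zeros (\<lambda>td. Q (Suc (Suc (k1 + (1 + (k2 + (1 + (td + 1)))))))) (?R5, M4)"
      proof (rule zeros_correct[OF c5 p5])
        fix k3 R6 M6 assume k3: "k3 \<le> 71 * Z + 80"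
          and c6: "cfg ?R5 R6 M6 ((?out1 @ body lm) @ replicate Z 0) []"
        have out: "(?out1 @ body lm) @ replicate Z 0 = out @ A" by (simp add: A_def)
        show "Q (Suc (Suc (k1 + (1 + (k2 + (1 + (k3 + 1))))))) (R6, M6)"
        proof (rule Q)
          show "Suc (Suc (k1 + (1 + (k2 + (1 + (k3 + 1)))))) \<le> 321 * length A + 180"
            using k1 k2 k3 lA by linarith
          show "static M6" "outp (3 * N) M6 (out @ A)" "R6 16 = 3 * N + length (out @ A)"
            using c6 unfolding out by (simp_all add: cfg_def)
          show "\<forall>r<40. r \<notin> {15, 16, 35, 36} \<longrightarrow> R6 r = R r"
            using c6 r4 by (simp add: cfg_def)
        qed
      qed (use r4 regs bd lA in auto)
      thus "wp W (Move 36 (Reg 31)) (\<lambda>tc. wp W zeros (\<lambda>td. Q (Suc (Suc (k1 + (1 + (k2 + (tc + (td + 1))))))))) (R4, M4)"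
        using r4 regs v(3)[of 0] v(1) by simp
    qed
    thus "wp W (Move 35 (Imm 0)) (\<lambda>ta. wp W (WhileDo (Less (Reg 35) (Reg 32)) gen_body)
      (\<lambda>tb. wp W (Move 36 (Reg 31)) (\<lambda>tc. wp W zeros (\<lambda>td. Q (Suc (Suc (k1 + (ta + (tb + (tc + (td + 1))))))))))) (R2, M2)"
      using W_gt by simp
  qed (use regs bd lA in auto)
  have "SB < W" "base < W" using W_gt v(3)[of 0] v(1) by simp_all
  thus ?thesis
    using z by (simp add: gen_def regs wp_Seq[abs_def] wp_Skip[abs_def])
qed

end

section \<open>The reduction\<close>

text \<open>The input length \<open>N = 4 * m + 1 + 2 * m * n\<close> is recomputed from
  \<open>m\<close> and \<open>n\<close>. The stack starts at \<open>N ^ 4\<close>, far behind the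
  output, and the scan of the nodes at \<open>4 * m\<close>, the address of the last one.\<close>

definition setup_prog :: com where
  "setup_prog = seqs [Load 10 (Imm 0), Load 11 (Imm 1), Bin 17 Mul (Reg 10) (Reg 11), Bin 13 Mul (Reg 10) (Imm 4),
     Bin 12 Mul (Reg 17) (Imm 2), Bin 12 Add (Reg 12) (Reg 13), Bin 12 Add (Reg 12) (Imm 1),
     Bin 14 Mul (Reg 12) (Reg 12), Bin 14 Mul (Reg 14) (Reg 14), Move 20 (Reg 13)]"

text \<open>The root has address 2, so cell \<open>2 * N + 2\<close> holds the number of
  conjunctions of the formula. The output begins at \<open>3 * N\<close>, right behind the
  tables.\<close>

definition middle_prog :: com where
  "middle_prog = seqs [Bin 37 Add (Reg 12) (Reg 12), Bin 37 Add (Reg 37) (Imm 2), Load 37 (Reg 37),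
     Bin 16 Mul (Reg 12) (Imm 3), Move 1 (Reg 16), Bin 18 Mul (Reg 11) (Reg 37)]"

definition xgen :: com where
  "xgen = seqs [Move 30 (Imm 1), Bin 31 Add (Reg 13) (Imm 1), Bin 32 Add (Reg 11) (Reg 11), Move 33 (Reg 37),
     Move 34 (Imm 0), gen, Bin 2 Sub (Reg 16) (Reg 1), Move 3 (Reg 16)]"

text \<open>Register 31 still holds the address of the first list; adding \<open>m * n\<close> gives
  the second one, and \<open>m\<close> is subtracted because its variables are numbered from
  \<open>m\<close> on.\<close>

definition ygen :: com where
  "ygen = seqs [Move 30 (Imm 2), Bin 31 Add (Reg 31) (Reg 17), Bin 31 Sub (Reg 31) (Reg 10), Move 32 (Reg 11),
     Move 33 (Imm 0), Move 34 (Reg 18), gen, Bin 4 Sub (Reg 16) (Reg 3)]"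

definition final_prog :: com where
  "final_prog = seqs [Bin 0 Mul (Reg 18) (Imm 3), Bin 0 Add (Reg 0) (Imm 1)]"

text \<open>Empty lists are split off, as \<open>gen\<close> reduces indices modulo
  \<open>n\<close>. Both strings are then empty, their lengths being the initial zeros of registers
  2 and 4, and the target is 1.\<close>

definition reduction_prog :: com where
  "reduction_prog = seqs [setup_prog, pass, middle_prog,
     IfThenElse (Eq (Reg 11) (Imm 0)) Skip (Seq xgen ygen), final_prog]"

section \<open>Lengths and positions in the encoded input\<close>

lemma nth_concat_uniform:
  assumes "\<And>x. x \<in> set xs \<Longrightarrow> length x = m" "q < length xs" "j < m"
  shows "concat xs ! (q * m + j) = xs ! q ! j"
  using assms by (induction xs arbitrary: q) (auto simp: nth_append nth_Cons add.assoc split: nat.splits)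

lemma length_concat_uniform: "(\<And>x. x \<in> set xs \<Longrightarrow> length x = m) \<Longrightarrow> length (concat xs) = length xs * m"
  by (induction xs) auto

text \<open>The largest possible code is that of the negated variable number
  \<open>2 * m - 1\<close>.\<close>

lemma encode_formula_le:
  assumes "set (leaf_vars F) \<subseteq> XVar ` {..<m} \<union> YVar ` {..<m}" "c \<in> set (encode_formula m F)"
  shows "c \<le> 4 * m + 1"
  using assms by (induction F) auto

locale pair_instance =
  fixes m n :: nat and F :: formula and A B :: "bool list list"
  assumes inst: "formula_pair_instance m n F A B"
begin

definition codes :: "nat list" where
  "codes = encode_instance m n F A B"

definition cell :: "nat \<Rightarrow> nat" where
  "cell p = (if p < length codes then codes ! p else 0)"

abbreviation N :: nat where
  "N \<equiv> length codes"

lemma size_F: "formula_size F = 2 * m"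
proof -
  have "formula_size F = card (set (leaf_vars F))"
    using inst distinct_card[of "leaf_vars F"] by (simp add: formula_pair_instance_def formula_size_def)
  also have "\<dots> = card (XVar ` {..<m} \<union> YVar ` {..<m})"
    using inst by (simp add: formula_pair_instance_def)
  also have "\<dots> = m + m"
    by (subst card_Un_disjoint) (auto simp: card_image inj_on_def)
  finally show ?thesis by simp
qed

lemma nodes_F: "Suc (nodes F) = 4 * m"
  using Suc_nodes[of F] size_F by simp

text \<open>Every formula has a leaf, so the case of no variables cannot arise.\<close>

lemma m_pos: "0 < m"
  using nodes_F by linarith

lemma lengths: "length A = n" "length B = n" "a \<in> set A \<Longrightarrow> length a = m" "b \<in> set B \<Longrightarrow> length b = m"
  "length (concat A) = n * m" "length (concat B) = n * m"
  using inst length_concat_uniform[of A m] length_concat_uniform[of B m]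
  by (auto simp: formula_pair_instance_def)

lemma N_eq: "N = 4 * m + 1 + 2 * (n * m)"
  using nodes_F by (simp add: codes_def encode_instance_def lengths)

lemma N_ge5: "5 \<le> N"
  using N_eq m_pos by simp

lemma codes_nonempty [simp]: "codes \<noteq> []"
  using N_ge5 by auto

lemma vec_position: "q < n \<Longrightarrow> j < m \<Longrightarrow> q * m + j < n * m"
proof -
  assume q: "q < n" "j < m"
  have "q * m + j < Suc q * m" using q by simp
  also have "\<dots> \<le> n * m" using q by (intro mult_right_mono) auto
  finally show ?thesis .
qed

lemma codes_nth:
  "codes ! 0 = m" "codes ! Suc 0 = n"
  "k < nodes F \<Longrightarrow> codes ! (2 + k) = encode_formula m F ! k"
  "q < n \<Longrightarrow> j < m \<Longrightarrow> codes ! (4 * m + 1 + (q * m + j)) = of_bool (A ! q ! j)"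
  "q < n \<Longrightarrow> j < m \<Longrightarrow> codes ! (4 * m + 1 + n * m + (q * m + j)) = of_bool (B ! q ! j)"
proof -
  show "codes ! 0 = m" "codes ! Suc 0 = n" by (simp_all add: codes_def encode_instance_def)
  show "k < nodes F \<Longrightarrow> codes ! (2 + k) = encode_formula m F ! k"
    by (simp add: codes_def encode_instance_def nth_append)
  have e: "4 * m + 1 + p = Suc (Suc (nodes F + p))" for p using nodes_F by simp
  show "codes ! (4 * m + 1 + (q * m + j)) = of_bool (A ! q ! j)" if q: "q < n" "j < m"
    unfolding e using vec_position[OF q] nth_concat_uniform[of A m q j] lengths q
    by (simp add: codes_def encode_instance_def nth_append)
  show "codes ! (4 * m + 1 + n * m + (q * m + j)) = of_bool (B ! q ! j)" if q: "q < n" "j < m"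
    unfolding add.assoc[of "4 * m + 1"] e using vec_position[OF q] nth_concat_uniform[of B m q j] lengths q
    by (simp add: codes_def encode_instance_def nth_append)
qed

text \<open>As \<open>m\<close> is positive, \<open>n\<close> is at most \<open>n * m\<close>, and
  the codes of the formula do not exceed the address at which the lists begin. Hence input words fit
  into machine words.\<close>

lemma codes_le: "c \<in> set codes \<Longrightarrow> c \<le> N"
proof -
  assume "c \<in> set codes"
  then consider "c = m" | "c = n" | "c \<in> set (encode_formula m F)" | "c \<le> 1"
    by (auto simp: codes_def encode_instance_def)
  thus "c \<le> N"
  proof cases
    case 3
    hence "c \<le> 4 * m + 1"
      using encode_formula_le[of F m c] inst by (simp add: formula_pair_instance_def)
    thus ?thesis using N_eq by simp
  next
    case 2
    have "n \<le> n * m" using m_pos by simp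
    with 2 show ?thesis using N_eq by linarith
  qed (use N_eq in auto)
qed

text \<open>As \<open>5 \<le> N\<close>, factors 5 are traded for factors \<open>N\<close>. These
  inequalities separate input, output, stack and word range at the scales \<open>N\<close>,
  \<open>N ^ 2\<close>, \<open>N ^ 4\<close> and \<open>N ^ 6\<close>.\<close>

lemma N_powers: "125 * N \<le> N ^ 4" "25 * N ^ 2 \<le> N ^ 4" "25 * N ^ 4 \<le> N ^ 6" "625 \<le> N ^ 4"
proof -
  have a: "5 ^ k * N ^ l \<le> N ^ (k + l)" for k l
    using power_mono[of 5 N k] N_ge5 by (simp add: power_add)
  show "125 * N \<le> N ^ 4" "25 * N ^ 2 \<le> N ^ 4" "25 * N ^ 4 \<le> N ^ 6" "625 \<le> N ^ 4"
    using a[of 3 1] a[of 2 2] a[of 2 4] a[of 4 0] by simp_all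
qed

lemma big: "20 * N ^ 4 + 100 < N ^ 6"
  using N_powers by linarith

sublocale ram m n N "N ^ 4" "N ^ 6" F cell
proof
  show "cell (2 + k) = encode_formula m F ! k" if "k < nodes F" for k
    using codes_nth(3)[OF that] that nodes_F N_eq by (simp add: cell_def)
  show "set (leaf_vars F) \<subseteq> XVar ` {..<m} \<union> YVar ` {..<m}"
    using inst by (simp add: formula_pair_instance_def)
  show "2 + nodes F \<le> N" using nodes_F N_eq by simp
  show "cell p < N ^ 6" if "p < N" for p
    using codes_le[of "codes ! p"] that N_powers by (simp add: cell_def)
  show "8 * N \<le> N ^ 4" "N ^ 4 < N ^ 6" using N_powers by linarith+
qed

text \<open>The quadratic bound on the gadget cost gives \<open>O(n * m ^ 2)\<close> symbols, and
  the input length is at least both \<open>2 * n * m\<close> and \<open>4 * m\<close>.\<close>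

lemma total_length:
  "length (xstr n F A) \<le> 2 * N ^ 2" "length (ystr n F B) \<le> 2 * N ^ 2"
proof -
  have c: "gadget_cost F \<le> 4 * m ^ 2" using gadget_cost_le_square[of F] by (simp add: size_F power_mult_distrib)
  have a: "ands F \<le> 2 * m ^ 2"
  proof -
    have "ands F \<le> 2 * m" using Suc_ands_le[of F] size_F by simp
    also have "\<dots> \<le> 2 * m ^ 2" using m_pos by (simp add: power2_eq_square)
    finally show ?thesis .
  qed
  have N2: "8 * (n * m\<^sup>2) \<le> N ^ 2"
  proof -
    have "(2 * (n * m)) * (4 * m) \<le> N * N" using N_eq by (intro mult_mono) auto
    thus ?thesis by (simp add: power2_eq_square mult.assoc mult.left_commute)
  qed
  have "length (xstr n F A) \<le> 2 * n * (4 * m ^ 2 + 2 * (2 * m ^ 2))"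
    using c a by (intro order.trans[OF length_xstr_le] mult_left_mono) linarith+
  thus "length (xstr n F A) \<le> 2 * N ^ 2" using N2 by simp
  have "length (ystr n F B) \<le> n * (4 * m ^ 2 + 3 * (2 * m ^ 2))"
    using c a by (intro order.trans[OF length_ystr_le] mult_left_mono) linarith+
  thus "length (ystr n F B) \<le> 2 * N ^ 2" using N2 by simp
qed

lemma xstr_gen: "xstr n F A = replicate 0 0 @
    concat (map (\<lambda>q. block 1 (A ! (q mod n)) (ands F)) [0..<2 * n]) @ replicate 0 0"
  by (simp add: xstr_def blocks_def block_def gadget_string_def comp_def)

lemma ystr_gen: "ystr n F B = replicate (n * ands F) 0 @
    concat (map (\<lambda>q. block 2 (B ! (q mod n)) 0) [0..<n]) @ replicate (n * ands F) 0"
proof -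
  have "map (\<lambda>q. block 2 (B ! (q mod n)) 0) [0..<n] = map (\<lambda>q. gy (B ! q) 2 5 F @ replicate (ands F) 0) [0..<n]"
    by (simp add: block_def gadget_string_def)
  note eq = this
  show ?thesis unfolding eq ystr_def blocks_def map_map comp_def ..
qed

lemma vec_A:
  assumes q: "q < n"
  shows "vec 1 (4 * m + 1 + q * m) (A ! q)"
  unfolding vec_def
proof (intro allI impI)
  fix j assume j: "j < m"
  have "4 * m + 1 + q * m + j < N" using vec_position[OF q j] N_eq by linarith
  thus "4 * m + 1 + q * m + (1 - 1) * m + j < N \<and> cell (4 * m + 1 + q * m + (1 - 1) * m + j) = of_bool (A ! q ! j)"
    using codes_nth(4)[OF q j] by (simp add: cell_def add.assoc)
qed

lemma vec_B:
  assumes q: "q < n"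
  shows "vec 2 (4 * m + 1 + n * m - m + q * m) (B ! q)"
  unfolding vec_def
proof (intro allI impI)
  fix j assume j: "j < m"
  have e: "4 * m + 1 + n * m - m + q * m + (2 - 1) * m + j = 4 * m + 1 + n * m + (q * m + j)" by simp
  have "4 * m + 1 + n * m + (q * m + j) < N" using vec_position[OF q j] N_eq by linarith
  thus "4 * m + 1 + n * m - m + q * m + (2 - 1) * m + j < N \<and>
      cell (4 * m + 1 + n * m - m + q * m + (2 - 1) * m + j) = of_bool (B ! q ! j)"
    unfolding e using codes_nth(5)[OF q j] by (simp add: cell_def)
qed

section \<open>Correctness of the assembled program\<close>

abbreviation W :: nat where
  "W \<equiv> N ^ 6"

definition setup_regs :: "nat \<Rightarrow> nat" where
  "setup_regs = (\<lambda>r. 0)(10 := m, 11 := n, 17 := m * n, 13 := 4 * m, 12 := N, 14 := N ^ 4, 20 := 4 * m)"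

lemma setup_correct:
  assumes Q: "\<And>k. k \<le> 12 \<Longrightarrow> Q k (setup_regs, cell)"
  shows "wp W setup_prog Q ((\<lambda>r. 0), cell)"
proof -
  have c: "cell 0 = m" "cell (Suc 0) = n" using codes_nth N_ge5 by (auto simp: cell_def)
  have lt: "m < W" "n < W" "m * n < W" "m * 4 < W" "m * n * 2 < W" "m * n * 2 + m * 4 < W" "N < W" "N * N < W" "N ^ 4 < W"
    "Suc 0 < W" "0 < W" "4 * m < W"
  proof -
    have "n \<le> m * n" using m_pos by simp
    hence "n \<le> N" "m \<le> N" "m * n \<le> N" "m * 4 \<le> N" "m * n * 2 \<le> N" "m * n * 2 + m * 4 \<le> N" "4 * m \<le> N"
      using N_eq unfolding mult.commute[of n m] by linarith+
    moreover have "N < W" "N ^ 4 < W" using N_powers by linarith+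
    moreover have "N * N < W" using N_powers by (simp add: power2_eq_square)
    ultimately show "m < W" "n < W" "m * n < W" "m * 4 < W" "m * n * 2 < W" "m * n * 2 + m * 4 < W"
      "N < W" "N * N < W" "N ^ 4 < W" "Suc 0 < W" "0 < W" "4 * m < W" using N_ge5 by linarith+
  qed
  have e: "Suc (m * n * 2 + m * 4) = N" "N * N * (N * N) = N ^ 4"
    using N_eq by (simp_all only: mult.commute[of n m] power4_eq_xxxx mult.assoc)
  have r: "(\<lambda>r. 0)(10 := m, 11 := n, 17 := m * n, 13 := m * 4, 12 := N, 14 := N ^ 4, 20 := m * 4) = setup_regs"
    by (simp add: setup_regs_def mult.commute)
  show ?thesis
    using lt c e r by (simp add: setup_prog_def) (rule Q, simp)
qed

text \<open>Keeps the growing output clear of the stack.\<close>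

lemma small: "3 * N + length (xstr n F A) + length (ystr n F B) < N ^ 4"
proof -
  have "3 * N \<le> N ^ 2" using N_ge5 by (simp add: power2_eq_square)
  moreover have "0 < N ^ 2" by simp
  ultimately show ?thesis using total_length N_powers(2) by linarith
qed

lemma consts_less: "n \<le> N" "ands F \<le> N" "n * ands F \<le> N" "N < W" "N ^ 4 < W" "m * n \<le> N" "3 * (n * ands F) + 1 < W"
proof -
  have a: "ands F \<le> 2 * m" using Suc_ands_le[of F] size_F by simp
  have "n * ands F \<le> 2 * (n * m)" by (rule order.trans[OF mult_left_mono[OF a, of n]]) simp_all
  thus l: "n * ands F \<le> N" using N_eq by linarith
  moreover have "n \<le> n * m" using m_pos by simp
  ultimately show "n \<le> N" "ands F \<le> N" using N_eq a by linarith+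
  show "N < W" "N ^ 4 < W" using N_powers by linarith+
  show "m * n \<le> N" using N_eq by (simp add: mult.commute)
  show "3 * (n * ands F) + 1 < W" using l N_powers N_ge5 by linarith
qed

definition ready :: "(nat \<Rightarrow> nat) \<Rightarrow> bool" where
  "ready R \<longleftrightarrow> R 10 = m \<and> R 11 = n \<and> R 12 = N \<and> R 13 = 4 * m \<and> R 14 = N ^ 4 \<and> R 17 = m * n \<and>
     R 18 = n * ands F \<and> R 37 = ands F"

lemma middle_correct:
  assumes R: "\<forall>r<20. R r = setup_regs r" and M: "static M"
    and Q: "\<And>k R'. k \<le> 8 \<Longrightarrow> ready R' \<Longrightarrow> R' 16 = 3 * N \<Longrightarrow> R' 1 = 3 * N \<Longrightarrow> R' 2 = 0 \<Longrightarrow> R' 3 = 0 \<Longrightarrow>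
      R' 4 = 0 \<Longrightarrow> Q k (R', M)"
  shows "wp W middle_prog Q (R, M)"
proof -
  have v: "M (Suc (Suc (N + N))) = ands F" using staticD[OF M occ_self] by (simp add: mult_2)
  have lt: "N + N < W" "Suc (Suc (N + N)) < W" "ands F < W" "N * 3 < W" "n * ands F < W"
    using consts_less N_powers N_ge5 by linarith+
  have r: "R 10 = m" "R 11 = n" "R 12 = N" "R 13 = 4 * m" "R 14 = N ^ 4" "R 17 = m * n" "R 2 = 0" "R 3 = 0" "R 4 = 0"
    using R by (simp_all add: setup_regs_def)
  show ?thesis
    using v lt r by (simp add: middle_prog_def) (rule Q; simp add: ready_def)
qed

lemma xgen_correct:
  assumes n: "0 < n" and r: "ready R" "R 16 = 3 * N" "R 1 = 3 * N" and M: "static M"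
    and Q: "\<And>k R' M'. k \<le> 321 * length (xstr n F A) + 190 \<Longrightarrow> ready R' \<Longrightarrow> static M' \<Longrightarrow>
      outp (3 * N) M' (xstr n F A) \<Longrightarrow> R' 16 = 3 * N + length (xstr n F A) \<Longrightarrow> R' 1 = 3 * N \<Longrightarrow>
      R' 2 = length (xstr n F A) \<Longrightarrow> R' 3 = 3 * N + length (xstr n F A) \<Longrightarrow> R' 31 = 4 * m + 1 \<Longrightarrow> Q k (R', M')"
  shows "wp W xgen Q (R, M)"
proof -
  let ?R = "R(30 := 1, 31 := 4 * m + 1, 32 := n + n, 33 := ands F, 34 := 0)"
  have lt: "1 < W" "4 * m + 1 < W" "n + n < W" "ands F < W" "n < W"
    "3 * N + length (xstr n F A) < W" "3 * N < W"
    using consts_less N_powers N_ge5 N_eq small by linarith+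
  have "wp W gen (\<lambda>k. wp W (Bin 2 Sub (Reg 16) (Reg 1)) (\<lambda>l. wp W (Move 3 (Reg 16)) (\<lambda>u. Q (Suc (Suc (Suc (Suc (Suc (k + (l + (u + 1))))))))))) (?R, M)"
  proof (rule gen_correct[where v = "\<lambda>q. A ! q" and md = 1 and cnt = "ands F" and Z = 0 and lm = "2 * n" and out = "[]"
        and base = "4 * m + 1", folded xstr_gen])
    fix k R' M' assume h: "k \<le> 321 * length (xstr n F A) + 180" "static M'" "outp (3 * N) M' ([] @ xstr n F A)"
      "R' 16 = 3 * N + length ([] @ xstr n F A)" "\<forall>r<40. r \<notin> {15, 16, 35, 36} \<longrightarrow> R' r = ?R r"
    hence r': "R' 1 = 3 * N" "ready (R'(2 := length (xstr n F A), 3 := 3 * N + length (xstr n F A)))" "R' 31 = 4 * m + 1"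
      using r by (simp_all add: ready_def)
    show "wp W (Bin 2 Sub (Reg 16) (Reg 1)) (\<lambda>l. wp W (Move 3 (Reg 16)) (\<lambda>u. Q (Suc (Suc (Suc (Suc (Suc (k + (l + (u + 1)))))))))) (R', M')"
      using h r' lt by simp (rule Q; simp)
  next
    show "vec 1 (4 * m + 1 + q * m) (A ! q)" if "q < n" for q by (rule vec_A[OF that])
    show "4 * m + 1 + q * m < W" if "q < n" for q
      using vec_position[OF that m_pos] N_eq consts_less by linarith
  qed (use r M lt n big small in \<open>auto simp: ready_def outp_def\<close>)
  thus ?thesis
    using lt r by (simp add: xgen_def ready_def wp_Seq[abs_def] wp_Skip[abs_def])
qed

lemma ygen_correct:
  assumes n: "0 < n" and r: "ready R" "R 16 = 3 * N + length x" "R 3 = 3 * N + length x" "R 31 = 4 * m + 1"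
    and x: "x = xstr n F A" and M: "static M" "outp (3 * N) M x"
    and Q: "\<And>k R' M'. k \<le> 321 * length (ystr n F B) + 190 \<Longrightarrow> ready R' \<Longrightarrow>
      outp (3 * N) M' (x @ ystr n F B) \<Longrightarrow> R' 1 = R 1 \<Longrightarrow> R' 2 = R 2 \<Longrightarrow>
      R' 3 = R 3 \<Longrightarrow> R' 4 = length (ystr n F B) \<Longrightarrow> Q k (R', M')"
  shows "wp W ygen Q (R, M)"
proof -
  let ?R = "R(30 := 2, 31 := 4 * m + 1 + n * m - m, 32 := n, 33 := 0, 34 := n * ands F)"
  have lt: "0 < W" "2 < W" "4 * m + 1 + n * m < W" "4 * m + 1 + n * m - m < W" "n < W" "n * ands F < W"
    "length (ystr n F B) < W"
    using consts_less N_powers N_ge5 N_eq small by linarith+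
  have "wp W gen (\<lambda>k. wp W (Bin 4 Sub (Reg 16) (Reg 3)) (\<lambda>u. Q (Suc (Suc (Suc (Suc (Suc (Suc (k + (u + 1)))))))))) (?R, M)"
  proof (rule gen_correct[where v = "\<lambda>q. B ! q" and md = 2 and cnt = 0 and Z = "n * ands F" and lm = n and out = x
        and base = "4 * m + 1 + n * m - m", folded ystr_gen])
    fix k R' M' assume h: "k \<le> 321 * length (ystr n F B) + 180" "static M'" "outp (3 * N) M' (x @ ystr n F B)"
      "R' 16 = 3 * N + length (x @ ystr n F B)" "\<forall>r<40. r \<notin> {15, 16, 35, 36} \<longrightarrow> R' r = ?R r"
    hence r': "R' 1 = R 1" "R' 2 = R 2" "R' 3 = R 3" "ready (R'(4 := length (ystr n F B)))"
      using r by (simp_all add: ready_def)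
    show "wp W (Bin 4 Sub (Reg 16) (Reg 3)) (\<lambda>u. Q (Suc (Suc (Suc (Suc (Suc (Suc (k + (u + 1))))))))) (R', M')"
      using h r' r(3) lt by simp (rule Q; simp)
  next
    show "vec 2 (4 * m + 1 + n * m - m + q * m) (B ! q)" if "q < n" for q by (rule vec_B[OF that])
    show "4 * m + 1 + n * m - m + q * m < W" if "q < n" for q
      using vec_position[OF that m_pos] N_eq consts_less by linarith
  qed (use r M lt n big small x in \<open>auto simp: ready_def\<close>)
  thus ?thesis
    using lt r by (simp add: ygen_def ready_def wp_Seq[abs_def] wp_Skip[abs_def] mult.commute[of m n])
qed

lemma read_block_append:
  assumes "outp p (snd \<sigma>) (x @ y)"
  shows "read_block \<sigma> p (length x) = x" "read_block \<sigma> (p + length x) (length y) = y"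
proof -
  have 1: "snd \<sigma> (p + k) = x ! k" if "k < length x" for k
    using assms that by (auto simp: outp_def nth_append)
  have 2: "snd \<sigma> (p + length x + k) = y ! k" if "k < length y" for k
  proof -
    have "snd \<sigma> (p + (length x + k)) = (x @ y) ! (length x + k)"
      using assms that unfolding outp_def by auto
    thus ?thesis by (simp add: add.assoc)
  qed
  show "read_block \<sigma> p (length x) = x" "read_block \<sigma> (p + length x) (length y) = y"
    by (auto simp: read_block_def 1 2 intro!: nth_equalityI)
qed

lemma final_correct:
  assumes "ready R" and Q: "\<And>k R'. k \<le> 3 \<Longrightarrow> R' 0 = 3 * (n * ands F) + 1 \<Longrightarrow> (\<forall>r. r \<noteq> 0 \<longrightarrow> R' r = R r) \<Longrightarrow> Q k (R', M)"
  shows "wp W final_prog Q (R, M)"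
proof -
  have "Suc (n * ands F * 3) < W" "n * ands F * 3 < W" using consts_less by linarith+
  thus ?thesis
    using assms(1) by (simp add: final_prog_def ready_def) (rule Q; simp)
qed

lemma generate_correct:
  assumes r: "ready R" "R 16 = 3 * N" "R 1 = 3 * N" "R 2 = 0" "R 3 = 0" "R 4 = 0" and M: "static M"
  shows "wp W (IfThenElse (Eq (Reg 11) (Imm 0)) Skip (Seq xgen ygen)) (\<lambda>k (R', M').
    k \<le> 321 * (length (xstr n F A) + length (ystr n F B)) + 400 \<and> ready R' \<and>
    read_block (R', M') (R' 1) (R' 2) = xstr n F A \<and> read_block (R', M') (R' 3) (R' 4) = ystr n F B) (R, M)"
proof (cases "n = 0")
  case True
  have e: "xstr n F A = []" "ystr n F B = []" by (simp_all add: True xstr_def ystr_def)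
  have "R 11 = n" using r(1) by (simp add: ready_def)
  hence "R 11 = 0" by (rule trans) (rule True)
  thus ?thesis using r by (simp add: e read_block_def)
next
  case False
  hence n: "0 < n" by simp
  have "wp W (Seq xgen ygen) (\<lambda>k (R', M').
    Suc k \<le> 321 * (length (xstr n F A) + length (ystr n F B)) + 400 \<and> ready R' \<and>
    read_block (R', M') (R' 1) (R' 2) = xstr n F A \<and> read_block (R', M') (R' 3) (R' 4) = ystr n F B) (R, M)"
    unfolding wp_Seq
  proof (rule xgen_correct[OF n r(1-3) M])
    fix k1 R1 M1 assume k1: "k1 \<le> 321 * length (xstr n F A) + 190" and r1: "ready R1" "R1 16 = 3 * N + length (xstr n F A)"
      "R1 3 = 3 * N + length (xstr n F A)" "R1 31 = 4 * m + 1" "R1 1 = 3 * N" "R1 2 = length (xstr n F A)"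
      and M1: "static M1" "outp (3 * N) M1 (xstr n F A)"
    show "wp W ygen (\<lambda>u (R', M'). Suc (k1 + u) \<le> 321 * (length (xstr n F A) + length (ystr n F B)) + 400 \<and> ready R' \<and>
      read_block (R', M') (R' 1) (R' 2) = xstr n F A \<and> read_block (R', M') (R' 3) (R' 4) = ystr n F B) (R1, M1)"
    proof (rule ygen_correct[OF n r1(1-4) refl M1])
      fix k2 R2 M2 assume k2: "k2 \<le> 321 * length (ystr n F B) + 190" and r2: "ready R2" "R2 1 = R1 1" "R2 2 = R1 2"
        "R2 3 = R1 3" "R2 4 = length (ystr n F B)" and M2: "outp (3 * N) M2 (xstr n F A @ ystr n F B)"
      show "case (R2, M2) of (R', M') \<Rightarrow> Suc (k1 + k2) \<le> 321 * (length (xstr n F A) + length (ystr n F B)) + 400 \<and> ready R' \<and>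
        read_block (R', M') (R' 1) (R' 2) = xstr n F A \<and> read_block (R', M') (R' 3) (R' 4) = ystr n F B"
        using k1 k2 r1 r2 read_block_append[of "3 * N" "(R2, M2)" "xstr n F A" "ystr n F B"] M2 by simp
    qed
  qed
  thus ?thesis using False r(1) by (simp add: ready_def)
qed

text \<open>The factor 321 of the emission also pays for the scan: this costs 27 per address, and
  the additive constants are absorbed because \<open>m\<close> is positive.\<close>

lemma reduction_prog_correct:
  "\<exists>t. computes_within 6 reduction_prog codes t (xstr n F A, ystr n F B, 3 * (n * ands F) + 1) \<and>
    t \<le> 321 * (N + length (xstr n F A) + length (ystr n F B))"
proof -
  let ?X = "length (xstr n F A)" and ?Y = "length (ystr n F B)"
  let ?post = "\<lambda>t \<tau>. ram_output \<tau> = (xstr n F A, ystr n F B, 3 * (n * ands F) + 1) \<and>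
    t \<le> 27 * (4 * m) + 1 + 321 * (?X + ?Y) + 424"
  have "wp W reduction_prog ?post ((\<lambda>r. 0), cell)"
    unfolding reduction_prog_def seqs.simps wp_Seq
  proof (rule setup_correct)
    fix k1 :: nat assume k1: "k1 \<le> 12"
    \<comment> \<open>The last address of the formula is \<open>4 * m\<close>, so the table
      condition is vacuous at the start of the scan.\<close>
    have no: "\<not> 4 * m < j" if "(j, G) \<in> occ 2 F" for j G
      using occ_bounds[OF that] nodes_F nodes_pos[of G] by linarith
    have inv: "pass_inv setup_regs (4 * m) setup_regs cell"
      unfolding pass_inv_def
    proof (intro conjI allI impI)
      show "4 * m < 2 + nodes F" using nodes_F by simp
    qed (use no in \<open>auto simp: setup_regs_def\<close>)
    show "wp W pass (\<lambda>t. wp W middle_prog (\<lambda>ta. wp W (IfThenElse (Eq (Reg 11) (Imm 0)) Skip (Seq xgen ygen))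
      (\<lambda>tb. wp W final_prog (\<lambda>tc. wp W Skip (\<lambda>u. ?post (k1 + (t + (ta + (tb + (tc + u))))))))))
      (setup_regs, cell)"
    proof (rule pass_correct[OF inv])
      fix k2 R2 M2 assume k2: "k2 \<le> 27 * (4 * m) + 1" and R2: "\<forall>r<20. R2 r = setup_regs r" and M2: "static M2"
      show "wp W middle_prog (\<lambda>ta. wp W (IfThenElse (Eq (Reg 11) (Imm 0)) Skip (Seq xgen ygen))
        (\<lambda>tb. wp W final_prog (\<lambda>tc. wp W Skip (\<lambda>u. ?post (k1 + (k2 + (ta + (tb + (tc + u)))))))))  (R2, M2)"
      proof (rule middle_correct[OF R2 M2])
        fix k3 :: nat and R3 assume k3: "k3 \<le> 8" and r3: "ready R3" "R3 16 = 3 * N" "R3 1 = 3 * N" "R3 2 = 0" "R3 3 = 0" "R3 4 = 0"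
        show "wp W (IfThenElse (Eq (Reg 11) (Imm 0)) Skip (Seq xgen ygen))
          (\<lambda>tb. wp W final_prog (\<lambda>tc. wp W Skip (\<lambda>u. ?post (k1 + (k2 + (k3 + (tb + (tc + u)))))))) (R3, M2)"
        proof (rule wp_mono[OF generate_correct[OF r3 M2]])
          fix k4 \<tau> assume h: "case \<tau> of (R', M') \<Rightarrow> k4 \<le> 321 * (?X + ?Y) + 400 \<and> ready R' \<and>
            read_block (R', M') (R' 1) (R' 2) = xstr n F A \<and> read_block (R', M') (R' 3) (R' 4) = ystr n F B"
          obtain R4 M4 where \<tau>: "\<tau> = (R4, M4)" by (cases \<tau>)
          have h': "k4 \<le> 321 * (?X + ?Y) + 400" "ready R4"
            "read_block (R4, M4) (R4 1) (R4 2) = xstr n F A" "read_block (R4, M4) (R4 3) (R4 4) = ystr n F B"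
            using h \<tau> by auto
          show "wp W final_prog (\<lambda>tc. wp W Skip (\<lambda>u. ?post (k1 + (k2 + (k3 + (k4 + (tc + u))))))) \<tau>"
            unfolding \<tau>
          proof (rule final_correct[OF h'(2)])
            fix k5 :: nat and R5 assume k5: "k5 \<le> 3" and R5: "R5 0 = 3 * (n * ands F) + 1" "\<forall>r. r \<noteq> 0 \<longrightarrow> R5 r = R4 r"
            have "k1 + (k2 + (k3 + (k4 + (k5 + 1)))) \<le> 27 * (4 * m) + 1 + 321 * (?X + ?Y) + 424"
              using k1 k2 k3 k5 h'(1) by linarith
            moreover have "ram_output (R5, M4) = (xstr n F A, ystr n F B, 3 * (n * ands F) + 1)"
              using R5 h'(3,4) by (simp add: ram_output_def read_block_def)
            ultimately show "wp W Skip (\<lambda>u. ?post (k1 + (k2 + (k3 + (k4 + (k5 + u)))))) (R5, M4)"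
              by simp
          qed
        qed
      qed
    qed (use m_pos in \<open>auto simp: setup_regs_def\<close>)
  qed
  then obtain t \<tau> where t: "exec W reduction_prog ((\<lambda>r. 0), cell) t \<tau>" "?post t \<tau>" by (auto simp: wp_def)
  have "initial_state codes = ((\<lambda>r. 0), cell)" by (auto simp: initial_state_def cell_def)
  moreover have "4 * m + 1 \<le> N" using N_eq by simp
  hence "27 * (4 * m) + 1 + 321 * (?X + ?Y) + 424 \<le> 321 * (N + ?X + ?Y)" using m_pos by simp
  with t(2) have "t \<le> 321 * (N + ?X + ?Y)" by (blast intro: order.trans)
  ultimately show ?thesis using t unfolding computes_within_def by metis
qed

end

text \<open>With \<open>u = sqrt (log 2 x)\<close> the quadratic Taylor bound gives
  \<open>1 + 2 * u ^ 2 \<le> exp (2 * u)\<close>, and \<open>1 / 2 \<le> ln 2\<close> changes the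
  base to 2. This absorbs the logarithmic factor of the gadget length.\<close>

lemma log_le_exp_sqrt:
  assumes "1 \<le> x"
  shows "1 + 2 * log 2 x \<le> 2 powr (4 * sqrt (log 2 x))"
proof -
  define u where "u = sqrt (log 2 x)"
  have u: "0 \<le> u" "log 2 x = u\<^sup>2" using assms by (simp_all add: u_def)
  have "2 * u \<le> 4 * u * ln 2"
  proof -
    have "1 / 2 \<le> ln (2 :: real)"
      by (rule iffD2[OF ln_ge_iff]) (simp_all only: exp_half_le2 zero_less_numeral)
    from mult_left_mono[OF this, of "4 * u"] u(1) show ?thesis by simp
  qed
  have "1 + 2 * u\<^sup>2 \<le> exp (2 * u)"
  proof -
    have "1 + 2 * u + (2 * u)\<^sup>2 / 2 \<le> exp (2 * u)" using exp_lower_Taylor_quadratic[of "2 * u"] u(1) by simp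
    thus ?thesis using u(1) by (simp add: power2_eq_square)
  qed
  also have "\<dots> \<le> exp (4 * u * ln 2)" using \<open>2 * u \<le> 4 * u * ln 2\<close> by simp
  also have "\<dots> = 2 powr (4 * u)" by (simp add: powr_def)
  finally have "1 + 2 * u\<^sup>2 \<le> 2 powr (4 * u)" .
  thus ?thesis unfolding u(2)[symmetric] unfolding u_def .
qed

lemma gadget_cost_bound:
  "real (gadget_cost F + 3 * ands F) \<le> 4 * real (formula_size F) * 2 powr (4 * sqrt (log 2 (real (formula_size F))))"
proof -
  let ?s = "real (formula_size F)" and ?e = "2 powr (4 * sqrt (log 2 (real (formula_size F))))"
  have s: "1 \<le> ?s" using formula_size_pos[of F] by linarith
  have "1 + 2 * log 2 ?s \<le> ?e" by (rule log_le_exp_sqrt[OF s])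
  from mult_left_mono[OF this, of ?s] s have "?s * (1 + 2 * log 2 ?s) \<le> ?s * ?e" by simp
  hence c: "real (gadget_cost F) \<le> ?s * ?e" using gadget_cost_le_log[of F] by linarith
  have "1 \<le> ?e" using s by (intro ge_one_powr_ge_zero) auto
  from mult_left_mono[OF this, of ?s] s have "?s \<le> ?s * ?e" by simp
  moreover have "real (ands F) \<le> ?s" using Suc_ands_le[of F] by linarith
  ultimately have "real (gadget_cost F) + 3 * real (ands F) \<le> 4 * (?s * ?e)" using c by linarith
  thus ?thesis by simp
qed

theorem theoremD1:
  shows "\<exists>(prog :: com) (k :: nat) (c :: nat) (alph :: nat \<Rightarrow> nat) (g :: nat \<Rightarrow> real) (C :: real).
    (\<lambda>s. real (alph s)) \<in> \<Theta>(\<lambda>s. real s) \<and>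
    g \<in> O(\<lambda>s. sqrt (log 2 (real s))) \<and>
    (\<forall>(m :: nat) (n :: nat) (F :: formula) (A :: bool list list) (B :: bool list list) (s :: nat).
       formula_pair_instance m n F A B \<and> s = formula_size F \<longrightarrow>
       (\<exists>(x :: nat list) (y :: nat list) (\<rho> :: nat) (t :: nat).
          computes_within k prog (encode_instance m n F A B) t (x, y, \<rho>) \<and>
          t \<le> c * (length (encode_instance m n F A B) + length x + length y) \<and>
          set x \<subseteq> {..<alph s} \<and> set y \<subseteq> {..<alph s} \<and>
          real (length x) \<le> C * real n * real s * 2 powr g s \<and>
          real (length y) \<le> C * real n * real s * 2 powr g s \<and>
          (LCS x y \<ge> \<rho> \<longleftrightarrow>
             (\<exists>a\<in>set A. \<exists>b\<in>set B. feval (pair_assignment a b) F))))"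
proof (rule exI, rule exI, rule exI, rule exI, rule exI, rule exI, intro conjI allI impI)
  \<comment> \<open>The witnesses introduced above stay schematic until the facts below fix them:
    \<open>reduction_prog\<close>, word exponent 6, time factor 321 and length factor 8, besides
    \<open>?alph\<close> and \<open>?g\<close>.\<close>
  let ?alph = "\<lambda>s :: nat. 4 * s + 2" and ?g = "\<lambda>s :: nat. 4 * sqrt (log 2 (real s))"
  \<comment> \<open>For \<open>1 \<le> s\<close>, the value \<open>4 * s + 2\<close> lies between
    \<open>4 * s\<close> and \<open>6 * s\<close>.\<close>
  show "(\<lambda>s. real (?alph s)) \<in> \<Theta>(\<lambda>s. real s)"
    by (rule bigthetaI'[of 4 6], simp, simp, rule eventually_mono[OF eventually_ge_at_top[of 1]]) auto
  show "?g \<in> O(\<lambda>s. sqrt (log 2 (real s)))" by simp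
  fix m n F A B s assume "formula_pair_instance m n F A B \<and> s = formula_size F"
  hence inst: "formula_pair_instance m n F A B" and s: "s = formula_size F" by auto
  interpret pair_instance m n F A B by unfold_locales (rule inst)
  obtain t where t: "computes_within 6 reduction_prog codes t (xstr n F A, ystr n F B, 3 * (n * ands F) + 1)"
    "t \<le> 321 * (length codes + length (xstr n F A) + length (ystr n F B))"
    using reduction_prog_correct by blast
  let ?b = "gadget_cost F + 3 * ands F"
  have b: "real ?b \<le> 4 * real s * 2 powr ?g s" unfolding s by (rule gadget_cost_bound)
  \<comment> \<open>The 8 is the factor 2 for writing the gadgets twice times the 4 of
    \<open>gadget_cost_bound\<close>.\<close>
  have bound: "real l \<le> 8 * real n * real s * 2 powr ?g s" if "l \<le> 2 * n * ?b" for l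
  proof -
    have "real l \<le> real (2 * n * ?b)" using that by (rule of_nat_mono)
    also have "\<dots> = 2 * real n * real ?b" by simp
    also have "\<dots> \<le> 2 * real n * (4 * real s * 2 powr ?g s)" by (rule mult_left_mono[OF b]) simp
    finally show ?thesis by (simp add: mult_ac)
  qed
  have len: "length (xstr n F A) \<le> 2 * n * ?b" "length (ystr n F B) \<le> 2 * n * ?b"
    by (rule order.trans[OF length_xstr_le] order.trans[OF length_ystr_le]; simp)+
  show "\<exists>x y \<rho> t. computes_within 6 reduction_prog (encode_instance m n F A B) t (x, y, \<rho>) \<and>
      t \<le> 321 * (length (encode_instance m n F A B) + length x + length y) \<and>
      set x \<subseteq> {..<?alph s} \<and> set y \<subseteq> {..<?alph s} \<and>
      real (length x) \<le> 8 * real n * real s * 2 powr ?g s \<and>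
      real (length y) \<le> 8 * real n * real s * 2 powr ?g s \<and>
      (LCS x y \<ge> \<rho> \<longleftrightarrow> (\<exists>a\<in>set A. \<exists>b\<in>set B. feval (pair_assignment a b) F))"
  proof (rule exI[of _ "xstr n F A"], rule exI[of _ "ystr n F B"], rule exI[of _ "3 * (n * ands F) + 1"],
      rule exI[of _ t], intro conjI)
    show "set (xstr n F A) \<subseteq> {..<?alph s}" "set (ystr n F B) \<subseteq> {..<?alph s}"
      unfolding s by (rule set_xstr set_ystr)+
  qed (rule t[unfolded codes_def] bound[OF len(1)] bound[OF len(2)] LCS_xstr_ystr[OF lengths(1,2)])+
qed

end
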